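(* Let $S$ be a countable set, $(E,\mathcal E)$ a standard Borel space, $(\Omega,\mathcal F)=(E^S,\mathcal E^{S})$, let $(H,\mathcal H,\mathbb P)$ be a probability space, and let $(\gamma[\xi])_{\xi\in H}$ be a random specification on $\Omega$ with $\mathcal G(\gamma[\xi])\neq\emptyset$ for $\mathbb P$-almost all $\xi$. Suppose $\kappa:H\to\mathcal P(\mathcal P(\Omega))$ is a metastate. Then there is an associated decomposition metastate $\kappa^{\rm ex}:H\to\mathcal P(\mathcal P(\Omega))$ which has the following two properties. 1. $\kappa^{\rm ex}$ has the same barycenter as $\kappa$, i.e., for $\mathbb P$-almost all $\xi$, $$\int_{\mathcal P(\Omega)}\kappa^{\rm ex}[\xi](d\nu)\,\nu=\int_{\mathcal P(\Omega)}\kappa[\xi](d\nu)\,\nu .$$ 2. For $\mathbb P$-almost all $\xi$, $\kappa^{\rm ex}$ is supported on the corresponding extremal Gibbs measures, i.e., $\kappa^{\rm ex}[\xi]\big(\mathrm{ex}\,\mathcal G(\gamma[\xi])\big)=1$.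
   Context: For a measurable space $X$, $\mathcal P(X)$ is the set of probability measures on $X$, and the evaluation sigma-algebra $e(\mathcal P(X))$ is the smallest sigma-algebra on $\mathcal P(X)$ making all maps $\nu\mapsto\nu(A)$, $A\subset X$ measurable, measurable. $\mathcal P(\Omega)$ always carries $e(\mathcal P(\Omega))$; $\mathcal P(\mathcal P(\Omega))=\mathcal P(\mathcal P(\Omega),e(\mathcal P(\Omega)))$ carries its own evaluation sigma-algebra $e(\mathcal P(\mathcal P(\Omega)))$. $\Lambda\Subset S$ means $\Lambda$ is a finite subset of $S$. A specification $\gamma=(\gamma_\Lambda)_{\Lambda\Subset S}$ is a family of probability kernels from $\Omega$ to $\mathcal P(\Omega)$ that is consistent: $\int\gamma_\Lambda(d\sigma|\omega)\gamma_\Delta(A|\sigma)=\gamma_\Lambda(A|\omega)$ for all finite $\Delta\subset\Lambda$, $A\in\mathcal F$, $\omega\in\Omega$; and proper: for all $\Lambda\Subset S$, $\gamma_\Lambda(A|\omega)=\mathbf 1_A(\omega)$ if $A$ is measurable outside of $\Lambda$ (i.e. $A$ lies in the sigma-algebra generated by the coordinates in $S\setminus\Lambda$). No quasilocality or non-nullness is assumed. A random specification is a family $(\gamma[\xi])_{\xi\in H}$ of specifications such that for all $\Lambda\Subset S$ and $A\in\mathcal F$ the map $(\xi,\omega)\mapsto\gamma_\Lambda[\xi](A|\omega)$ is $(\mathcal H\otimes\mathcal F)$–$\mathcal B[0,1]$ measurable. For a specification $\gamma$, $\mathcal G(\gamma)$ is the set of infinite-volume Gibbs measures: all $\mu\in\mathcal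 P(\Omega)$ with $\int\mu(d\omega)\gamma_\Lambda(A|\omega)=\mu(A)$ for all $\Lambda\Subset S$, $A\in\mathcal F$. It is convex, and $\mathrm{ex}\,\mathcal G(\gamma)$ denotes its set of extreme points. A metastate is a measurable map $\kappa:H\to\mathcal P(\mathcal P(\Omega))$ (with respect to $\mathcal H$ and $e(\mathcal P(\mathcal P(\Omega)))$) such that $\kappa[\xi]\big(\mathcal G(\gamma[\xi])\big)=1$ for $\mathbb P$-almost all $\xi$. The barycenter $\int\kappa[\xi](d\nu)\,\nu$ is the probability measure $A\mapsto\int\kappa[\xi](d\nu)\,\nu(A)$ on $(\Omega,\mathcal F)$. *)

theory Defs
  imports "HOL-Probability.Probability"
begin

text \<open>Throughout, \<^term>\<open>S\<close> is the set of sites and \<^term>\<open>E\<close> a measurable space of local states. Measurable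
  spaces are values of type \<^typ>\<open>'a measure\<close> of which only \<^const>\<open>space\<close> and \<^const>\<open>sets\<close> are
  used. The set of probability measures on \<^term>\<open>M\<close> with the evaluation sigma-algebra is
  \<^term>\<open>prob_algebra M\<close>.\<close>

definition standard_borel_space :: "'a measure \<Rightarrow> bool" where
  "standard_borel_space M \<longleftrightarrow>
    (\<exists>X. completely_metrizable_space X \<and> separable_space X \<and> topspace X = space M \<and>
         sets M = sigma_sets (topspace X) {U. openin X U})"

abbreviation config_space :: "'s set \<Rightarrow> 'e measure \<Rightarrow> ('s \<Rightarrow> 'e) measure" where
  "config_space S E \<equiv> Pi\<^sub>M S (\<lambda>_. E)"

text \<open>Sub-sigma-algebra of the configuration space generated by the coordinates in \<^term>\<open>\<Delta>\<close>.\<close>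

definition coord_sets :: "'s set \<Rightarrow> 'e measure \<Rightarrow> 's set \<Rightarrow> ('s \<Rightarrow> 'e) set set" where
  "coord_sets S E \<Delta> =
    sigma_sets (space (config_space S E))
      {(\<lambda>\<omega>. \<omega> i) -` B \<inter> space (config_space S E) | i B. i \<in> \<Delta> \<and> B \<in> sets E}"

type_synonym ('s, 'e) kernels = "'s set \<Rightarrow> ('s \<Rightarrow> 'e) \<Rightarrow> ('s \<Rightarrow> 'e) measure"

text \<open>A family of kernels is only looked at for finite \<^term>\<open>\<Lambda> \<subseteq> S\<close> and for configurations in the
  configuration space. Kernels are measurable with respect to the full product sigma-algebra, with
  properness imposed separately.\<close>

definition gibbs_specification :: "'s set \<Rightarrow> 'e measure \<Rightarrow> ('s, 'e) kernels \<Rightarrow> bool" where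
  "gibbs_specification S E \<gamma> \<longleftrightarrow>
    (\<forall>\<Lambda>. finite \<Lambda> \<and> \<Lambda> \<subseteq> S \<longrightarrow>
       \<gamma> \<Lambda> \<in> config_space S E \<rightarrow>\<^sub>M prob_algebra (config_space S E)) \<and>
    (\<forall>\<Lambda> \<Delta>. finite \<Lambda> \<and> \<Lambda> \<subseteq> S \<and> \<Delta> \<subseteq> \<Lambda> \<longrightarrow>
       (\<forall>A\<in>sets (config_space S E). \<forall>\<omega>\<in>space (config_space S E).
          (\<integral>\<^sup>+\<sigma>. emeasure (\<gamma> \<Delta> \<sigma>) A \<partial>(\<gamma> \<Lambda> \<omega>)) = emeasure (\<gamma> \<Lambda> \<omega>) A)) \<and>
    (\<forall>\<Lambda>. finite \<Lambda> \<and> \<Lambda> \<subseteq> S \<longrightarrow>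
       (\<forall>A\<in>coord_sets S E (S - \<Lambda>). \<forall>\<omega>\<in>space (config_space S E).
          emeasure (\<gamma> \<Lambda> \<omega>) A = indicator A \<omega>))"

text \<open>\<^term>\<open>P\<close> plays the role of the disorder space, of which only the measurable structure matters
  here.\<close>

definition random_specification ::
    "'h measure \<Rightarrow> 's set \<Rightarrow> 'e measure \<Rightarrow> ('h \<Rightarrow> ('s, 'e) kernels) \<Rightarrow> bool" where
  "random_specification P S E \<gamma> \<longleftrightarrow>
    (\<forall>\<xi>\<in>space P. gibbs_specification S E (\<gamma> \<xi>)) \<and>
    (\<forall>\<Lambda>. finite \<Lambda> \<and> \<Lambda> \<subseteq> S \<longrightarrow>
       (\<forall>A\<in>sets (config_space S E).
          (\<lambda>(\<xi>, \<omega>). measure (\<gamma> \<xi> \<Lambda> \<omega>) A) \<in> borel_measurable (P \<Otimes>\<^sub>M config_space S E)))"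

definition gibbs_measures :: "'s set \<Rightarrow> 'e measure \<Rightarrow> ('s, 'e) kernels \<Rightarrow> ('s \<Rightarrow> 'e) measure set" where
  "gibbs_measures S E \<gamma> =
    {\<mu> \<in> space (prob_algebra (config_space S E)).
       \<forall>\<Lambda>. finite \<Lambda> \<and> \<Lambda> \<subseteq> S \<longrightarrow>
         (\<forall>A\<in>sets (config_space S E). (\<integral>\<^sup>+\<omega>. emeasure (\<gamma> \<Lambda> \<omega>) A \<partial>\<mu>) = emeasure \<mu> A)}"

text \<open>Extreme points, written setwise since measures do not form a real vector space and
  \<^const>\<open>extreme_point_of\<close> does not apply.\<close>

definition extreme_measures :: "'a measure set \<Rightarrow> 'a measure set" where
  "extreme_measures G =
    {\<mu> \<in> G. \<forall>\<nu>\<^sub>1\<in>G. \<forall>\<nu>\<^sub>2\<in>G. \<forall>t::real. 0 < t \<and> t < 1 \<and>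
       (\<forall>A\<in>sets \<mu>. measure \<mu> A = t * measure \<nu>\<^sub>1 A + (1 - t) * measure \<nu>\<^sub>2 A) \<longrightarrow>
       \<nu>\<^sub>1 = \<mu> \<and> \<nu>\<^sub>2 = \<mu>}"

text \<open>Since \<^const>\<open>emeasure\<close> vanishes off the sigma-algebra, the almost sure condition contains the
  measurability of the set of Gibbs measures.\<close>

definition metastate ::
    "'h measure \<Rightarrow> 's set \<Rightarrow> 'e measure \<Rightarrow> ('h \<Rightarrow> ('s, 'e) kernels) \<Rightarrow>
     ('h \<Rightarrow> ('s \<Rightarrow> 'e) measure measure) \<Rightarrow> bool" where
  "metastate P S E \<gamma> \<kappa> \<longleftrightarrow>
    \<kappa> \<in> P \<rightarrow>\<^sub>M prob_algebra (prob_algebra (config_space S E)) \<and>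
    (AE \<xi> in P. emeasure (\<kappa> \<xi>) (gibbs_measures S E (\<gamma> \<xi>)) = 1)"

text \<open>The library's \<^const>\<open>join\<close> cannot be used here: it expects a measure on
  \<^const>\<open>subprob_algebra\<close>.\<close>

definition barycenter :: "'a measure \<Rightarrow> 'a measure measure \<Rightarrow> 'a measure" where
  "barycenter M K = measure_of (space M) (sets M) (\<lambda>A. \<integral>\<^sup>+\<nu>. emeasure \<nu> A \<partial>K)"

lemma sets_barycenter [simp]: "sets (barycenter M K) = sets M"
  and space_barycenter [simp]: "space (barycenter M K) = space M"
  by (simp_all add: barycenter_def)

lemma emeasure_barycenter:
  assumes K: "K \<in> space (prob_algebra (prob_algebra M))" and A: "A \<in> sets M"
  shows "emeasure (barycenter M K) A = (\<integral>\<^sup>+\<nu>. emeasure \<nu> A \<partial>K)"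
proof (rule emeasure_measure_of[OF barycenter_def])
  have setsK: "sets K = sets (prob_algebra M)"
    using K by (simp add: space_prob_algebra)
  have spaceK: "space K = space (prob_algebra M)"
    using setsK by (rule sets_eq_imp_space_eq)
  show "sets M \<subseteq> Pow (space M)"
    by (rule sets.space_closed)
  show "A \<in> sets (barycenter M K)"
    using A by simp
  show "positive (sets (barycenter M K)) (\<lambda>A. \<integral>\<^sup>+\<nu>. emeasure \<nu> A \<partial>K)"
    by (simp add: positive_def)
  show "countably_additive (sets (barycenter M K)) (\<lambda>A. \<integral>\<^sup>+\<nu>. emeasure \<nu> A \<partial>K)"
  proof (rule countably_additiveI)
    fix B :: "nat \<Rightarrow> 'a set"
    assume B: "range B \<subseteq> sets (barycenter M K)" "disjoint_family B"
    have meas: "(\<lambda>\<nu>. emeasure \<nu> (B i)) \<in> borel_measurable K" for i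
    proof -
      have "B i \<in> sets M" using B(1) by auto
      then have "(\<lambda>\<nu>. emeasure \<nu> (B i)) \<in> borel_measurable (prob_algebra M)"
        unfolding prob_algebra_def
        by (intro measurable_restrict_space1 measurable_emeasure_subprob_algebra)
      then show ?thesis
        by (simp add: measurable_cong_sets[OF setsK refl])
    qed
    have "(\<Sum>i. \<integral>\<^sup>+\<nu>. emeasure \<nu> (B i) \<partial>K) = (\<integral>\<^sup>+\<nu>. (\<Sum>i. emeasure \<nu> (B i)) \<partial>K)"
      by (rule nn_integral_suminf[symmetric]) (rule meas)
    also have "\<dots> = (\<integral>\<^sup>+\<nu>. emeasure \<nu> (\<Union>i. B i) \<partial>K)"
      using B by (intro nn_integral_cong suminf_emeasure) (auto simp: spaceK space_prob_algebra)
    finally show "(\<Sum>i. \<integral>\<^sup>+\<nu>. emeasure \<nu> (B i) \<partial>K) = (\<integral>\<^sup>+\<nu>. emeasure \<nu> (\<Union>i. B i) \<partial>K)" .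
  qed
qed

end

theory Submission
  imports Defs
begin

text \<open>Along an exhausting sequence \<open>\<Lambda>\<^sub>n\<close> of finite volumes the kernels \<open>K\<^sub>n = \<gamma>\<^sub>\<Lambda>\<^sub>n\<close> satisfy \<open>K\<^sub>m K\<^sub>n = K\<^sub>m\<close> for
  \<open>n \<le> m\<close>, and the Gibbs measures are the common invariant measures. On \<open>L\<^sup>2(\<mu>)\<close> with \<open>\<mu>\<close> Gibbs they
  act as a decreasing sequence of orthogonal projections, hence \<open>K\<^sub>n(x, B)\<close> converges in \<open>L\<^sup>2(\<mu>)\<close>, and almost
  surely along a subsequence. A Borel coding of the configurations by reals turns the limits of
  distribution functions into a kernel \<open>\<pi>\<close> with \<open>\<mu> = \<integral>\<pi>(x) \<mu>(dx)\<close>. Almost every \<open>\<pi>(x)\<close> is Gibbs and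
  satisfies \<open>\<integral>K\<^sub>m(y, B)\<^sup>2 \<pi>(x)(dy) \<longlonglongrightarrow> \<pi>(x)(B)\<^sup>2\<close>, which characterises the extreme Gibbs measures by countably
  many measurable conditions. The decomposition metastate is the law of \<open>\<pi>\<close> under the barycenter.\<close>

section \<open>Coding configurations by reals\<close>

text \<open>Two obstacles shape the construction. Off its sigma-algebra a measure vanishes, so mass
  one on the extreme Gibbs measures includes the claim that they form a measurable set; this is why
  extremality is replaced by countably many conditions on averages instead of triviality of a tail
  sigma-algebra. And pointwise convergence is available only at rational levels of the real code,
  outside a null set, so a weak limit on the line could place mass off the codes. Integrating
  against \<mu> removes this: by invariance each \<open>K n\<close> has mean \<mu>, the limit
  distribution functions inherit that mean, and convergence in L1(\<mu>) then extends from
  half-lines to all Borel sets. All that is kept of the standard Borel structure is a pair of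
  measurable maps with \<open>d (e y) = y\<close> on the space, the same for every \<xi>.\<close>

abbreviation baire :: "(nat \<Rightarrow> nat) measure" where
  "baire \<equiv> Pi\<^sub>M UNIV (\<lambda>_. count_space UNIV)"

lemma space_baire [simp]: "space baire = UNIV"
  by (simp add: space_PiM)

text \<open>Both coordinates take countably many values, so the predicate is a countable union of
  cylinder conditions; hence any relation \<open>Q\<close> on indices is allowed, however irregular
  the points behind the indices are.\<close>

lemma pred_baire2:
  "Measurable.pred baire (\<lambda>s. Q (s n) (s m))"
proof -
  have "Measurable.pred baire (\<lambda>s. \<exists>i j. s n = i \<and> s m = j \<and> Q i j)"
    by measurable
  then show ?thesis by simp
qed

text \<open>A point is coded by the indices of points of a dense sequence at distance less than \<open>2\<^sup>-\<^sup>n\<close>;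
  decoding takes the limit. This avoids showing that the set of codes is Borel.\<close>

lemma standard_borel_baire_retract:
  assumes "standard_borel_space E" "space E \<noteq> {}"
  obtains f :: "'e \<Rightarrow> nat \<Rightarrow> nat" and g :: "(nat \<Rightarrow> nat) \<Rightarrow> 'e"
  where "\<And>n. (\<lambda>x. f x n) \<in> E \<rightarrow>\<^sub>M count_space UNIV" "g \<in> baire \<rightarrow>\<^sub>M E"
    "\<And>x. x \<in> space E \<Longrightarrow> g (f x) = x"
proof -
  obtain X where X: "completely_metrizable_space X" "separable_space X" "topspace X = space E"
    "sets E = sigma_sets (topspace X) {U. openin X U}"
    using assms(1) unfolding standard_borel_space_def by blast
  obtain M d where Md: "Metric_space M d" "Metric_space.mcomplete M d"
    "X = Metric_space.mtopology M d"
    using X(1) unfolding completely_metrizable_space_def by blast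
  interpret Metric_space M d by fact
  have M: "space E = M" using X(3) Md(3) by simp
  have openE: "U \<in> sets E" if "openin mtopology U" for U
    unfolding X(4) using that Md(3) by auto
  obtain C where C: "countable C" "C \<subseteq> M" "mtopology closure_of C = M"
    using X(2) Md(3) unfolding separable_space_def by auto
  have "C \<noteq> {}" using C(3) assms(2) M by auto
  define D where "D = from_nat_into C"
  have DM: "D i \<in> M" for i
    using from_nat_into[OF \<open>C \<noteq> {}\<close>, of i] C(2) by (auto simp: D_def)
  have dense: "\<exists>i. d x (D i) < r" if xr: "x \<in> M" "r > 0" for x r
  proof -
    have "x \<in> {x \<in> M. \<forall>r>0. \<exists>y\<in>C. y \<in> mball x r}"
      using xr C(3) unfolding metric_closure_of by simp
    then obtain y where "y \<in> C" "y \<in> mball x r"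
      using xr by blast
    moreover obtain i where "y = D i"
      using from_nat_into_surj[OF C(1) \<open>y \<in> C\<close>] D_def by auto
    ultimately show ?thesis by auto
  qed
  define f where "f x n = (LEAST i. d x (D i) < (1/2) ^ n)" for x n
  have f_meas: "(\<lambda>x. f x n) \<in> E \<rightarrow>\<^sub>M count_space UNIV" for n
    unfolding f_def
  proof (rule measurable_Least)
    fix i
    have "{x \<in> space E. d x (D i) < (1/2) ^ n} = mball (D i) ((1/2) ^ n)"
      using DM by (auto simp: M commute)
    then show "Measurable.pred E (\<lambda>x. d x (D i) < (1/2) ^ n)"
      unfolding pred_def by (simp add: openE)
  qed
  \<comment> \<open>The fallback \<open>D 0\<close> keeps \<open>g\<close> total with values in
    \<open>M\<close>; this case is treated separately when preimages of open sets are
    computed.\<close>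
  define g where "g s = (if MCauchy (\<lambda>n. D (s n))
     then (THE l. limitin mtopology (\<lambda>n. D (s n)) l sequentially) else D 0)" for s
  have g_lim: "limitin mtopology (\<lambda>n. D (s n)) (g s) sequentially" if c: "MCauchy (\<lambda>n. D (s n))" for s
  proof -
    obtain l where l: "limitin mtopology (\<lambda>n. D (s n)) l sequentially"
      using Md(2) c unfolding mcomplete_def by blast
    have "(THE l. limitin mtopology (\<lambda>n. D (s n)) l sequentially) = l"
      by (rule the_equality[where a=l]) (rule l, rule limitin_metric_unique[OF _ l trivial_limit_sequentially])
    with l c show ?thesis by (simp add: g_def)
  qed
  have gM: "g s \<in> M" for s
    using g_lim[of s] DM by (cases "MCauchy (\<lambda>n. D (s n))") (auto simp: limitin_metric g_def)
  have g_f: "g (f x) = x" if x: "x \<in> space E" for x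
  proof -
    have xM: "x \<in> M" using x M by simp
    have dist: "d x (D (f x n)) < (1/2) ^ n" for n
        unfolding f_def by (rule LeastI_ex) (rule dense[OF xM], simp)
    have lim: "limitin mtopology (\<lambda>n. D (f x n)) x sequentially"
      unfolding limitin_metric
    proof (intro conjI allI impI)
      fix \<epsilon> :: real assume "\<epsilon> > 0"
      have "(\<lambda>n. (1/2::real) ^ n) \<longlonglongrightarrow> 0" by (rule LIMSEQ_power_zero) simp
      then have "\<forall>\<^sub>F n in sequentially. (1/2::real) ^ n < \<epsilon>"
        using \<open>\<epsilon> > 0\<close> by (rule order_tendstoD)
      then show "\<forall>\<^sub>F n in sequentially. D (f x n) \<in> M \<and> d (D (f x n)) x < \<epsilon>"
      proof eventually_elim
        case (elim n)
        then show ?case using dist[of n] DM commute[of x] by simp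
      qed
    qed (rule xM)
    have "MCauchy (\<lambda>n. D (f x n))"
      using lim by (rule convergent_imp_MCauchy[rotated]) (use DM in auto)
    from limitin_metric_unique[OF g_lim[OF this] lim trivial_limit_sequentially] show ?thesis .
  qed
  have cauchy_meas: "Measurable.pred baire (\<lambda>s. MCauchy (\<lambda>n. D (s n)))"
  proof -
    have "MCauchy (\<lambda>n. D (s n)) \<longleftrightarrow>
      (\<forall>k::nat. \<exists>N. \<forall>n n'. N \<le> n \<longrightarrow> N \<le> n' \<longrightarrow> d (D (s n)) (D (s n')) < inverse (real (Suc k)))" for s
    proof
      assume "MCauchy (\<lambda>n. D (s n))"
      then show "\<forall>k::nat. \<exists>N. \<forall>n n'. N \<le> n \<longrightarrow> N \<le> n' \<longrightarrow> d (D (s n)) (D (s n')) < inverse (real (Suc k))"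
        unfolding MCauchy_def by (metis inverse_positive_iff_positive of_nat_0_less_iff zero_less_Suc)
    next
      assume *: "\<forall>k::nat. \<exists>N. \<forall>n n'. N \<le> n \<longrightarrow> N \<le> n' \<longrightarrow> d (D (s n)) (D (s n')) < inverse (real (Suc k))"
      show "MCauchy (\<lambda>n. D (s n))"
        unfolding MCauchy_def
      proof (intro conjI allI impI)
        fix \<epsilon> :: real assume "\<epsilon> > 0"
        then obtain k where "inverse (real (Suc k)) < \<epsilon>" using reals_Archimedean by blast
        then show "\<exists>N. \<forall>n n'. N \<le> n \<longrightarrow> N \<le> n' \<longrightarrow> d (D (s n)) (D (s n')) < \<epsilon>"
          using * by (meson less_trans)
      qed (use DM in auto)
    qed
    then show ?thesis
      by (simp only:) (intro pred_intros_countable pred_intros_logic pred_baire2)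
  qed
  have g_meas: "g \<in> baire \<rightarrow>\<^sub>M E"
  proof (rule measurable_sigma_sets[OF X(4)])
    fix U assume "U \<in> {U. openin X U}"
    then have U: "openin mtopology U" using Md(3) by simp
    \<comment> \<open>Membership of a limit in an open set becomes a countable condition on the
      terms: they eventually stay at points whose ball of one fixed radius lies in \<open>U\<close>.
      Eventual membership in \<open>U\<close> alone would not suffice, since the limit could sit on
      the boundary.\<close>
    define V where "V k = {x \<in> M. mball x (inverse (real (Suc k))) \<subseteq> U}" for k
    have iff: "g s \<in> U \<longleftrightarrow> (\<exists>k N. \<forall>n. N \<le> n \<longrightarrow> D (s n) \<in> V k)" if c: "MCauchy (\<lambda>n. D (s n))" for s
    proof
      assume "g s \<in> U"
      then obtain r where r: "r > 0" "mball (g s) r \<subseteq> U"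
        using U unfolding openin_mtopology by blast
      obtain k where k: "inverse (real (Suc k)) < r / 2"
        using reals_Archimedean[of "r/2"] r by auto
      obtain N where N: "\<And>n. N \<le> n \<Longrightarrow> d (D (s n)) (g s) < r / 2"
        using g_lim[OF c] r(1) unfolding limitin_metric eventually_sequentially
        by (meson half_gt_zero)
      have "D (s n) \<in> V k" if "N \<le> n" for n
      proof -
        have "y \<in> U" if "y \<in> mball (D (s n)) (inverse (real (Suc k)))" for y
        proof -
          have "d (g s) y \<le> d (g s) (D (s n)) + d (D (s n)) y"
            using triangle gM DM that by simp
          also have "\<dots> < r" using N[OF \<open>N \<le> n\<close>] that k commute[of "g s"] by simp
          finally show ?thesis using r(2) gM that by auto
        qed
        then show ?thesis unfolding V_def using DM by blast
      qed
      then show "\<exists>k N. \<forall>n. N \<le> n \<longrightarrow> D (s n) \<in> V k" by blast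
    next
      assume "\<exists>k N. \<forall>n. N \<le> n \<longrightarrow> D (s n) \<in> V k"
      then obtain k N where N: "\<And>n. N \<le> n \<Longrightarrow> D (s n) \<in> V k" by blast
      obtain N' where N': "\<And>n. N' \<le> n \<Longrightarrow> d (D (s n)) (g s) < inverse (real (Suc k))"
        using g_lim[OF c] unfolding limitin_metric eventually_sequentially
        by (meson inverse_positive_iff_positive of_nat_0_less_iff zero_less_Suc)
      have "g s \<in> mball (D (s (max N N'))) (inverse (real (Suc k)))"
        using N'[of "max N N'"] gM DM by simp
      then show "g s \<in> U" using N[of "max N N'"] unfolding V_def by auto
    qed
    have "Measurable.pred baire (\<lambda>s. MCauchy (\<lambda>n. D (s n)) \<and> (\<exists>k N. \<forall>n. N \<le> n \<longrightarrow> D (s n) \<in> V k)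
        \<or> \<not> MCauchy (\<lambda>n. D (s n)) \<and> D 0 \<in> U)"
    proof (intro pred_intros_logic pred_intros_countable cauchy_meas)
      show "Measurable.pred baire (\<lambda>s. D (s n) \<in> V k)" for n k
        using pred_baire2[of "\<lambda>i j. D i \<in> V k" n n] .
    qed simp_all
    also have "(\<lambda>s. MCauchy (\<lambda>n. D (s n)) \<and> (\<exists>k N. \<forall>n. N \<le> n \<longrightarrow> D (s n) \<in> V k)
        \<or> \<not> MCauchy (\<lambda>n. D (s n)) \<and> D 0 \<in> U)
      = (\<lambda>s. g s \<in> U)"
    proof
      have g0: "g s = D 0" if "\<not> MCauchy (\<lambda>n. D (s n))" for s
        using that by (simp add: g_def)
      show "(MCauchy (\<lambda>n. D (s n)) \<and> (\<exists>k N. \<forall>n. N \<le> n \<longrightarrow> D (s n) \<in> V k)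
        \<or> \<not> MCauchy (\<lambda>n. D (s n)) \<and> D 0 \<in> U) = (g s \<in> U)" for s
        by (cases "MCauchy (\<lambda>n. D (s n))") (simp_all add: iff g0)
    qed
    finally have "{s \<in> space baire. g s \<in> U} \<in> sets baire" unfolding pred_def .
    also have "{s \<in> space baire. g s \<in> U} = g -` U \<inter> space baire" by auto
    finally show "g -` U \<inter> space baire \<in> sets baire" .
  qed (use gM X(3) M openin_subset[of X] in auto)
  show thesis by (rule that[OF f_meas g_meas g_f])
qed

text \<open>Only the digits 0 and 1 occur, so expansions are unique.\<close>

definition ternary :: "(nat \<Rightarrow> bool) \<Rightarrow> real" where
  "ternary b = (\<Sum>k. of_bool (b k) * (1/3) ^ Suc k)"

lemma ternary_summable: "summable (\<lambda>k. of_bool (b k) * (1/3::real) ^ Suc k)"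
  by (rule summable_comparison_test[of _ "\<lambda>k. (1/3::real) ^ Suc k"])
    (auto simp: summable_Suc_iff[of "\<lambda>k. (1/3::real) ^ k"])

lemma ternary_bounds: "0 \<le> ternary b" "ternary b \<le> 1/2"
proof -
  show "0 \<le> ternary b"
    unfolding ternary_def by (intro suminf_nonneg ternary_summable) auto
  have "ternary b \<le> (\<Sum>k. (1/3::real) * (1/3) ^ k)"
    unfolding ternary_def
    by (rule suminf_le[OF _ ternary_summable]) (auto intro: summable_mult)
  also have "\<dots> = 1/2"
    by (subst suminf_mult) (auto simp: suminf_geometric)
  finally show "ternary b \<le> 1/2" .
qed

lemma ternary_shift: "3 * ternary b = of_bool (b 0) + ternary (\<lambda>k. b (Suc k))"
proof -
  have "3 * ternary b = (\<Sum>k. 3 * (of_bool (b k) * (1/3) ^ Suc k))"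
    unfolding ternary_def by (rule suminf_mult[symmetric, OF ternary_summable])
  also have "\<dots> = (\<Sum>k. of_bool (b k) * (1/3) ^ k)"
    by (rule suminf_cong) simp
  also have "\<dots> = (\<Sum>k. of_bool (b (Suc k)) * (1/3) ^ Suc k) + of_bool (b 0)"
    using suminf_split_head[of "\<lambda>k. of_bool (b k) * (1/3::real) ^ k"]
      ternary_summable[of "\<lambda>k. b (Suc k)"]
      summable_Suc_iff[of "\<lambda>k. of_bool (b k) * (1/3::real) ^ k"] by simp
  finally show ?thesis by (simp add: ternary_def)
qed

text \<open>Iterating the map that drops the leading ternary digit and then reading the next one by
  a floor gives a formula meaningful for every real, so decoding is Borel on the whole line.\<close>

definition ternary_digit :: "nat \<Rightarrow> real \<Rightarrow> bool" where
  "ternary_digit k x \<longleftrightarrow> \<lfloor>3 * ((\<lambda>y. 3 * y - of_int \<lfloor>3 * y\<rfloor>) ^^ k) x\<rfloor> = 1"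

text \<open>After the shift the tail is at most 1/2, so it cannot carry into the leading digit; base
  2 would allow a tail equal to 1.\<close>

lemma ternary_floor: "\<lfloor>3 * ternary b\<rfloor> = of_bool (b 0)"
  using ternary_bounds[of "\<lambda>k. b (Suc k)"] unfolding ternary_shift
  by (cases "b 0") (auto intro!: floor_unique)

lemma ternary_digit_ternary: "ternary_digit k (ternary b) = b k"
proof -
  have "((\<lambda>y. 3 * y - of_int \<lfloor>3 * y\<rfloor>) ^^ k) (ternary b) = ternary (\<lambda>j. b (j + k))"
  proof (induction k)
    case (Suc k)
    then show ?case
      using ternary_shift[of "\<lambda>j. b (j + k)"] ternary_floor[of "\<lambda>j. b (j + k)"] by simp
  qed simp
  then show ?thesis
    by (simp add: ternary_digit_def ternary_floor)
qed

lemma measurable_ternary_digit: "Measurable.pred borel (ternary_digit k)"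
proof -
  have [measurable]: "((\<lambda>y::real. 3 * y - of_int \<lfloor>3 * y\<rfloor>) ^^ k) \<in> borel_measurable borel"
    by (induction k) (simp_all add: measurable_compose)
  show ?thesis unfolding ternary_digit_def by measurable
qed

lemma baire_real_retract:
  obtains c :: "(nat \<Rightarrow> nat) \<Rightarrow> real" and h :: "real \<Rightarrow> nat \<Rightarrow> nat"
  where "c \<in> borel_measurable baire" "\<And>s. c s \<in> {0..1}" "h \<in> borel \<rightarrow>\<^sub>M baire" "\<And>s. h (c s) = s"
proof
  \<comment> \<open>A sequence of naturals becomes a 0/1 sequence through the indicator of its
    graph, indexed by coded pairs; decoding finds \<open>s n\<close> as the least \<open>m\<close>
    whose bit is set, and \<open>LEAST\<close> gives some value also at reals that are no
    codes.\<close>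
  define bits :: "(nat \<Rightarrow> nat) \<Rightarrow> nat \<Rightarrow> bool"
    where "bits s k \<longleftrightarrow> s (fst (prod_decode k)) = snd (prod_decode k)" for s k
  define h :: "real \<Rightarrow> nat \<Rightarrow> nat"
    where "h x n = (LEAST m. ternary_digit (prod_encode (n, m)) x)" for x n
  have [measurable]: "Measurable.pred baire (\<lambda>s. bits s k)" for k
    unfolding bits_def by measurable
  show "(\<lambda>s. ternary (bits s)) \<in> borel_measurable baire"
    unfolding ternary_def by measurable
  show "ternary (bits s) \<in> {0..1}" for s
    using ternary_bounds[of "bits s"] by auto
  note measurable_ternary_digit[measurable]
  have "(\<lambda>x. h x n) \<in> borel \<rightarrow>\<^sub>M count_space UNIV" for n
    unfolding h_def by measurable
  then show "h \<in> borel \<rightarrow>\<^sub>M baire"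
    by (intro measurable_PiM_single') (auto simp: PiE_UNIV_domain)
  show "h (ternary (bits s)) = s" for s
    by (auto simp: fun_eq_iff h_def ternary_digit_ternary bits_def intro: Least_equality)
qed

lemma config_space_real_retract:
  assumes "countable S" "standard_borel_space E" "space (config_space S E) \<noteq> {}"
  obtains e :: "('s \<Rightarrow> 'e) \<Rightarrow> real" and d :: "real \<Rightarrow> 's \<Rightarrow> 'e"
  where "e \<in> borel_measurable (config_space S E)" "\<And>\<omega>. \<omega> \<in> space (config_space S E) \<Longrightarrow> e \<omega> \<in> {0..1}"
    "d \<in> borel \<rightarrow>\<^sub>M config_space S E" "\<And>\<omega>. \<omega> \<in> space (config_space S E) \<Longrightarrow> d (e \<omega>) = \<omega>"
proof -
  \<comment> \<open>For \<open>S = {}\<close> the configuration space has one point even if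
    \<open>E\<close> is empty, so the empty index set is handled on its own.\<close>
  have E_ne: "space E \<noteq> {}" if "S \<noteq> {}"
    using assms(3) that by (auto simp: space_PiM PiE_eq_empty_iff)
  show thesis
  proof (cases "S = {}")
    case True
    show thesis
      by (rule that[of "\<lambda>_. 0" "\<lambda>_ _. undefined"]) (auto simp: True space_PiM space_PiM_empty sets_PiM_empty)
  next
    case False
    obtain f g where fg [measurable]: "\<And>n. (\<lambda>x. f x n) \<in> E \<rightarrow>\<^sub>M count_space UNIV" "g \<in> baire \<rightarrow>\<^sub>M E"
      and gf: "\<And>x. x \<in> space E \<Longrightarrow> g (f x) = x"
      by (rule standard_borel_baire_retract[OF assms(2) E_ne[OF False]]) blast
    obtain c :: "(nat \<Rightarrow> nat) \<Rightarrow> real" and h where ch [measurable]: "c \<in> borel_measurable baire" "h \<in> borel \<rightarrow>\<^sub>M baire"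
      and c01: "\<And>s. c s \<in> {0..1}" and hc: "\<And>s. h (c s) = s"
      by (rule baire_real_retract) blast
    let ?num = "to_nat_on S"
    \<comment> \<open>The codes of the single spins, one sequence per site, are interleaved into one
      sequence by pairing site number and position; pairs whose first entry numbers no site get the
      arbitrary value 0.\<close>
    define \<phi> where "\<phi> \<omega> k = (case prod_decode k of (i, n) \<Rightarrow>
      if i \<in> ?num ` S then f (\<omega> (inv_into S ?num i)) n else 0)" for \<omega> k
    define \<psi> where "\<psi> s = (\<lambda>i\<in>S. g (\<lambda>n. s (prod_encode (?num i, n))))" for s :: "nat \<Rightarrow> nat"
    have inj: "inj_on ?num S" using assms(1) by (rule inj_on_to_nat_on)
    have "(\<lambda>\<omega>. \<phi> \<omega> k) \<in> config_space S E \<rightarrow>\<^sub>M count_space UNIV" for k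
    proof (cases "fst (prod_decode k) \<in> ?num ` S")
      case True
      then have [measurable]: "(\<lambda>\<omega>. \<omega> (inv_into S ?num (fst (prod_decode k)))) \<in> config_space S E \<rightarrow>\<^sub>M E"
        by (intro measurable_component_singleton inv_into_into)
      show ?thesis
        using True by (simp add: \<phi>_def case_prod_beta)
    next
      case False
      then show ?thesis by (simp add: \<phi>_def case_prod_beta)
    qed
    then have [measurable]: "\<phi> \<in> config_space S E \<rightarrow>\<^sub>M baire"
      by (intro measurable_PiM_single') (auto simp: PiE_UNIV_domain)
    have [measurable]: "(\<lambda>s. \<lambda>n. s (prod_encode (j, n))) \<in> baire \<rightarrow>\<^sub>M baire" for j
      by (intro measurable_PiM_single') (auto simp: PiE_UNIV_domain)
    have [measurable]: "\<psi> \<in> baire \<rightarrow>\<^sub>M config_space S E"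
      unfolding \<psi>_def by (intro measurable_restrict) measurable
    have \<psi>\<phi>: "\<psi> (\<phi> \<omega>) = \<omega>" if \<omega>: "\<omega> \<in> space (config_space S E)" for \<omega>
    proof
      fix i
      show "\<psi> (\<phi> \<omega>) i = \<omega> i"
      proof (cases "i \<in> S")
        case True
        then have "\<omega> i \<in> space E" using \<omega> by (auto simp: space_PiM)
        then show ?thesis
          using True gf by (simp add: \<psi>_def \<phi>_def inv_into_f_f[OF inj])
      next
        case False
        then show ?thesis using \<omega> by (auto simp: \<psi>_def space_PiM PiE_def extensional_def)
      qed
    qed
    show thesis
    proof (rule that[of "\<lambda>\<omega>. c (\<phi> \<omega>)" "\<lambda>x. \<psi> (h x)"])
      show "(\<lambda>\<omega>. c (\<phi> \<omega>)) \<in> borel_measurable (config_space S E)" by measurable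
      show "(\<lambda>x. \<psi> (h x)) \<in> borel \<rightarrow>\<^sub>M config_space S E" by measurable
    qed (use c01 hc \<psi>\<phi> in auto)
  qed
qed

section \<open>Kernels from limits of distribution functions\<close>

text \<open>A monotone function on the rationals need not be right continuous; the infimum over
  strictly larger rationals is its right continuous version and, being countable, stays measurable
  in \<open>x\<close>. The fixed values below 0 and from 1 on give the limits at both infinities and
  replace a tightness argument.\<close>

lemma cdf_kernel:
  fixes F :: "rat \<Rightarrow> 'x \<Rightarrow> real"
  assumes meas [measurable]: "\<And>q. F q \<in> borel_measurable X"
    and mono: "\<And>x p q. x \<in> space X \<Longrightarrow> p \<le> q \<Longrightarrow> F p x \<le> F q x"
    and low: "\<And>x q. x \<in> space X \<Longrightarrow> q < 0 \<Longrightarrow> F q x = 0"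
    and high: "\<And>x q. x \<in> space X \<Longrightarrow> 1 \<le> q \<Longrightarrow> F q x = 1"
  obtains \<rho> where "\<rho> \<in> X \<rightarrow>\<^sub>M prob_algebra (borel :: real measure)"
    "\<And>x t. x \<in> space X \<Longrightarrow> measure (\<rho> x) {..t} = (INF q\<in>{q. t < of_rat q}. F q x)"
proof -
  define G where "G x t = (INF q\<in>{q. t < of_rat q}. F q x)" for x and t :: real
  have nonneg: "0 \<le> F q x" if "x \<in> space X" for q x
    using mono[OF that, of "min q (-1)" q] low[OF that, of "min q (-1)"] by simp
  have bdd: "bdd_below ((\<lambda>q. F q x) ` Q)" if "x \<in> space X" for x Q
    using nonneg[OF that] by (intro bdd_belowI[of _ 0]) auto
  have ne: "{q. t < of_rat q} \<noteq> {}" for t :: real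
    using of_rat_dense[of t "t + 1"] by auto
  have G_le: "G x t \<le> F q x" if "x \<in> space X" "t < of_rat q" for x t q
    unfolding G_def using that by (intro cINF_lower bdd) auto
  have G_mono: "G x s \<le> G x t" if "x \<in> space X" "s \<le> t" for x s t
    unfolding G_def using that ne bdd by (intro cINF_superset_mono) auto
  have G_nonneg: "0 \<le> G x t" if "x \<in> space X" for x t
    unfolding G_def using ne nonneg[OF that] by (intro cINF_greatest) auto
  have G_cont: "continuous (at_right a) (G x)" if x: "x \<in> space X" for x a
  proof (subst continuous_at_right_real_increasing)
    show "\<forall>\<epsilon>>0. \<exists>\<delta>>0. G x (a + \<delta>) - G x a < \<epsilon>"
    proof (intro allI impI)
      fix \<epsilon> :: real assume "\<epsilon> > 0"
      then have "(INF q\<in>{q. a < of_rat q}. F q x) < G x a + \<epsilon>"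
        unfolding G_def by simp
      then obtain q where q: "a < of_rat q" "F q x < G x a + \<epsilon>"
        using cINF_less_iff[OF ne bdd[OF x]] by auto
      obtain p where p: "a < of_rat p" "of_rat p < (of_rat q :: real)"
        using of_rat_dense[OF q(1)] by blast
      have "G x (a + (of_rat p - a)) \<le> F q x"
        using p by (intro G_le x) simp
      then show "\<exists>\<delta>>0. G x (a + \<delta>) - G x a < \<epsilon>"
        using q p by (intro exI[of _ "of_rat p - a"]) auto
    qed
  qed (rule G_mono[OF x])
  have G0: "G x t = 0" if x: "x \<in> space X" and "t < 0" for x t
  proof -
    obtain q where q: "t < of_rat q" "of_rat q < (0::real)"
      using of_rat_dense[OF \<open>t < 0\<close>] by blast
    then have "F q x = 0" using low[OF x] by simp
    then show ?thesis using G_le[OF x q(1)] G_nonneg[OF x, of t] by simp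
  qed
  have G1: "G x t = 1" if x: "x \<in> space X" and "1 \<le> t" for x t
  proof -
    have "F q x = 1" if "q \<in> {q. t < of_rat q}" for q
    proof (rule high[OF x])
      have "1 \<le> (of_rat q :: real)" using that \<open>1 \<le> t\<close> by (simp del: one_le_of_rat_iff)
      then show "1 \<le> q" by simp
    qed
    then show ?thesis
      unfolding G_def using ne by (subst INF_cong[OF refl, of _ _ "\<lambda>_. 1"]) (auto simp: cINF_const)
  qed
  have bot: "(G x \<longlongrightarrow> 0) at_bot" if "x \<in> space X" for x
    by (rule tendsto_eventually) (use eventually_at_bot_dense[of "\<lambda>t. G x t = 0"] G0[OF that] in blast)
  have top: "(G x \<longlongrightarrow> 1) at_top" if "x \<in> space X" for x
    by (rule tendsto_eventually) (use eventually_at_top_linorder[of "\<lambda>t. G x t = 1"] G1[OF that] in blast)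
  have dist: "real_distribution (interval_measure (G x))" if "x \<in> space X" for x
    by (rule real_distribution_interval_measure) (use that G_mono G_cont bot top in auto)
  have cdf: "measure (interval_measure (G x)) {..t} = G x t" if "x \<in> space X" for x t
    by (rule measure_interval_measure_Iic) (use that G_mono G_cont bot in auto)
  have "(\<lambda>x. interval_measure (G x)) \<in> X \<rightarrow>\<^sub>M prob_algebra borel"
  proof (rule measurable_prob_algebra_generated[where G="range (\<lambda>t::real. {..t})" and \<Omega>=UNIV])
    show "sets borel = sigma_sets UNIV (range (\<lambda>t::real. {..t}))"
      by (subst borel_eq_atMost) simp
    show "Int_stable (range (\<lambda>t::real. {..t}))"
      by (auto simp: Int_stable_def)
    show "prob_space (interval_measure (G x))" if "x \<in> space X" for x
      using dist[OF that] by (simp add: real_distribution_def)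
    fix A assume "A \<in> range (\<lambda>t::real. {..t})"
    then obtain t where A: "A = {..t}" by auto
    have "(\<lambda>x. ennreal (G x t)) \<in> borel_measurable X"
      unfolding G_def by measurable
    also have "?this \<longleftrightarrow> (\<lambda>x. emeasure (interval_measure (G x)) A) \<in> borel_measurable X"
    proof (rule measurable_cong)
      fix x assume x: "x \<in> space X"
      interpret real_distribution "interval_measure (G x)" by (rule dist[OF x])
      show "ennreal (G x t) = emeasure (interval_measure (G x)) A"
        by (simp add: A emeasure_eq_measure cdf[OF x])
    qed
    finally show "(\<lambda>x. emeasure (interval_measure (G x)) A) \<in> borel_measurable X" .
  qed auto
  then show thesis
    by (rule that) (simp add: cdf G_def)
qed

text \<open>The upper limit is monotone in the level at every \<open>x\<close>, convergent or not,
  so the result is a probability kernel on the whole space and no exceptional set has to be cut out.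
  The formula with \<open>lim\<close> is claimed only at points where all rational levels
  converge.\<close>

lemma limit_cdf_kernel:
  assumes L: "\<And>k::nat. L k \<in> X \<rightarrow>\<^sub>M prob_algebra M"
    and e [measurable]: "e \<in> borel_measurable M" and e01: "\<And>y. y \<in> space M \<Longrightarrow> e y \<in> {0..1::real}"
  defines "A \<equiv> \<lambda>t. {y \<in> space M. e y \<le> t}"
  obtains \<rho> where "\<rho> \<in> X \<rightarrow>\<^sub>M prob_algebra (borel :: real measure)"
    "\<And>x t. x \<in> space X \<Longrightarrow> (\<And>q::rat. convergent (\<lambda>k. measure (L k x) (A (of_rat q)))) \<Longrightarrow>
      measure (\<rho> x) {..t} = (INF q\<in>{q. t < of_rat q}. lim (\<lambda>k. measure (L k x) (A (of_rat q))))"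
proof -
  define F where "F q x = real_of_ereal (limsup (\<lambda>k. ereal (measure (L k x) (A (of_rat q)))))" for q :: rat and x
  have A [measurable]: "A t \<in> sets M" for t
    unfolding A_def by measurable
  have prob: "prob_space (L k x)" "sets (L k x) = sets M" if "x \<in> space X" for k x
    using measurable_space[OF L that] by (auto simp: space_prob_algebra)
  have F_meas: "F q \<in> borel_measurable X" for q
  proof -
    have [measurable]: "(\<lambda>x. measure (L k x) (A (of_rat q))) \<in> borel_measurable X" for k
      by (rule measurable_compose[OF L measurable_measure_prob_algebra[OF A]])
    show ?thesis unfolding F_def by measurable
  qed
  have bounds: "0 \<le> limsup (\<lambda>k. ereal (measure (L k x) (A t)))" "limsup (\<lambda>k. ereal (measure (L k x) (A t))) \<le> 1"
    if "x \<in> space X" for x t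
  proof -
    show "0 \<le> limsup (\<lambda>k. ereal (measure (L k x) (A t)))"
      by (rule le_Limsup) (auto simp: trivial_limit_sequentially)
    show "limsup (\<lambda>k. ereal (measure (L k x) (A t))) \<le> 1"
      by (rule Limsup_bounded) (auto intro!: always_eventually prob_space.prob_le_1 prob that)
  qed
  have F_mono: "F p x \<le> F q x" if x: "x \<in> space X" and "p \<le> q" for x p q
    unfolding F_def
  proof (rule real_of_ereal_positive_mono)
    show "limsup (\<lambda>k. ereal (measure (L k x) (A (of_rat p)))) \<le> limsup (\<lambda>k. ereal (measure (L k x) (A (of_rat q))))"
    proof (rule Limsup_mono, rule always_eventually, rule allI)
      fix k
      interpret prob_space "L k x" by (rule prob[OF x])
      have "(of_rat p :: real) \<le> of_rat q" using \<open>p \<le> q\<close> by (simp add: of_rat_less_eq)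
      then have "measure (L k x) (A (of_rat p)) \<le> measure (L k x) (A (of_rat q))"
        using prob(2)[OF x] A by (intro finite_measure_mono) (auto simp: A_def)
      then show "ereal (measure (L k x) (A (of_rat p))) \<le> ereal (measure (L k x) (A (of_rat q)))" by simp
    qed
    show "limsup (\<lambda>k. ereal (measure (L k x) (A (of_rat q)))) \<noteq> \<infinity>"
      using bounds(2)[OF x, of "of_rat q"] by auto
  qed (rule bounds[OF x])
  have F_low: "F q x = 0" if x: "x \<in> space X" and "q < 0" for x q
  proof -
    have "(of_rat q :: real) < 0" using \<open>q < 0\<close> by simp
    moreover have "0 \<le> e y" if "y \<in> space M" for y using e01[OF that] by simp
    ultimately have "\<not> e y \<le> of_rat q" if "y \<in> space M" for y using that by (meson not_less order_trans)
    then have "A (of_rat q) = {}" by (auto simp: A_def)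
    then show ?thesis by (simp add: F_def Limsup_const)
  qed
  have F_high: "F q x = 1" if x: "x \<in> space X" and "1 \<le> q" for x q
  proof -
    have "1 \<le> (of_rat q :: real)" using \<open>1 \<le> q\<close> by simp
    moreover have "e y \<le> 1" if "y \<in> space M" for y using e01[OF that] by simp
    ultimately have "e y \<le> of_rat q" if "y \<in> space M" for y using that by (meson order_trans)
    then have "A (of_rat q) = space M" by (auto simp: A_def)
    then have "measure (L k x) (A (of_rat q)) = 1" for k
      using prob_space.prob_space[OF prob(1)[OF x]] sets_eq_imp_space_eq[OF prob(2)[OF x]] by metis
    then show ?thesis by (simp add: F_def Limsup_const)
  qed
  obtain \<rho> where \<rho>: "\<rho> \<in> X \<rightarrow>\<^sub>M prob_algebra (borel :: real measure)"
    "\<And>x t. x \<in> space X \<Longrightarrow> measure (\<rho> x) {..t} = (INF q\<in>{q. t < of_rat q}. F q x)"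
    by (rule cdf_kernel[of F X, OF F_meas F_mono F_low F_high]) auto
  show thesis
  proof (rule that[OF \<rho>(1)])
    fix x and t :: real
    assume x: "x \<in> space X" and conv: "\<And>q::rat. convergent (\<lambda>k. measure (L k x) (A (of_rat q)))"
    have "F q x = lim (\<lambda>k. measure (L k x) (A (of_rat q)))" for q
    proof -
      have "(\<lambda>k. ereal (measure (L k x) (A (of_rat q)))) \<longlonglongrightarrow> ereal (lim (\<lambda>k. measure (L k x) (A (of_rat q))))"
        using conv[of q] by (simp add: convergent_LIMSEQ_iff)
      from lim_imp_Limsup[OF trivial_limit_sequentially this] show ?thesis
        by (simp add: F_def)
    qed
    then show "measure (\<rho> x) {..t} = (INF q\<in>{q. t < of_rat q}. lim (\<lambda>k. measure (L k x) (A (of_rat q))))"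
      using \<rho>(2)[OF x] by simp
  qed
qed

text \<open>Assumption \<open>c\<close> makes the squared increments summable along a subsequence chosen uniformly in
  finitely many \<open>j\<close> at a time.\<close>

lemma AE_convergent_subsequence:
  fixes g :: "nat \<Rightarrow> nat \<Rightarrow> 'a \<Rightarrow> real"
  assumes M: "prob_space M"
    and g [measurable]: "\<And>n j. g n j \<in> borel_measurable M"
    and g01: "\<And>n j x. x \<in> space M \<Longrightarrow> g n j x \<in> {0..1}"
    and c: "\<And>n m j. n \<le> m \<Longrightarrow> (\<integral>x. (g n j x - g m j x)\<^sup>2 \<partial>M) = c n j - c m j"
    and c0: "\<And>n j. 0 \<le> c n j"
  obtains r :: "nat \<Rightarrow> nat" where "strict_mono r" "AE x in M. \<forall>j. convergent (\<lambda>k. g (r k) j x)"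
proof -
  interpret prob_space M by (rule M)
  have dec: "c m j \<le> c n j" if "n \<le> m" for n m j
  proof -
    have "0 \<le> (\<integral>x. (g n j x - g m j x)\<^sup>2 \<partial>M)" by simp
    then show ?thesis using c[OF that] by simp
  qed
  have Cauchy: "Cauchy (\<lambda>n. c n j)" for j
  proof -
    have "decseq (\<lambda>n. c n j)" using dec by (auto simp: decseq_def)
    then have "convergent (\<lambda>n. c n j)"
      using c0 decseq_bounded[of "\<lambda>n. c n j"] by (metis convergent_def decseq_convergent)
    then show ?thesis by (rule convergent_Cauchy)
  qed
  have "\<exists>N. \<forall>j\<le>k. \<forall>n\<ge>N. \<forall>m\<ge>n. c n j - c m j \<le> (1/4) ^ k" for k
  proof -
    have "\<exists>N. \<forall>n\<ge>N. \<forall>m\<ge>n. c n j - c m j \<le> (1/4) ^ k" for j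
    proof -
      obtain N where N: "\<And>m n. m \<ge> N \<Longrightarrow> n \<ge> N \<Longrightarrow> dist (c m j) (c n j) < (1/4) ^ k"
        using metric_CauchyD[OF Cauchy[of j], of "(1/4) ^ k"] by auto
      have "c n j - c m j \<le> (1/4) ^ k" if "N \<le> n" "n \<le> m" for n m
        using N[of n m] that by (simp add: dist_real_def)
      then show ?thesis by blast
    qed
    then obtain N where N: "\<And>j n m. N j \<le> n \<Longrightarrow> n \<le> m \<Longrightarrow> c n j - c m j \<le> (1/4) ^ k"
      by metis
    have "N j \<le> Max (N ` {..k})" if "j \<le> k" for j
      using that by (intro Max_ge) auto
    then show ?thesis
      using N by (intro exI[of _ "Max (N ` {..k})"]) (meson order_trans)
  qed
  then obtain N where N: "\<And>k j n m. j \<le> k \<Longrightarrow> N k \<le> n \<Longrightarrow> n \<le> m \<Longrightarrow> c n j - c m j \<le> (1/4) ^ k"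
    by metis
  \<comment> \<open>The summand \<open>k\<close> gives strict growth and the sum gives
    \<open>N k \<le> r k\<close>, so that step \<open>k\<close> controls the increments of every
    index \<open>j \<le> k\<close>.\<close>
  define r where "r k = k + (\<Sum>i\<le>k. N i)" for k
  have r_mono: "strict_mono r" unfolding strict_mono_Suc_iff r_def by simp
  have r_ge: "N k \<le> r k" for k
    unfolding r_def using member_le_sum[of k "{..k}" N] by simp
  define d where "d k j x = \<bar>g (r (Suc k)) j x - g (r k) j x\<bar>" for k j x
  have d [measurable]: "d k j \<in> borel_measurable M" for k j
    unfolding d_def by measurable
  have d0: "0 \<le> d k j x" for k j x by (simp add: d_def)
  have d01: "d k j x \<le> 1" if "x \<in> space M" for k j x
    using g01[OF that, of "r (Suc k)" j] g01[OF that, of "r k" j] by (auto simp: d_def)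
  have sq_int: "integrable M (\<lambda>x. (g (r k) j x - g (r (Suc k)) j x)\<^sup>2)" for k j
  proof (rule integrable_const_bound[of _ 1])
    have "\<bar>g (r k) j x - g (r (Suc k)) j x\<bar>\<^sup>2 \<le> 1" if "x \<in> space M" for x
      using d01[OF that, of k j] by (intro power_le_one) (auto simp: d_def abs_minus_commute)
    then show "AE x in M. norm ((g (r k) j x - g (r (Suc k)) j x)\<^sup>2) \<le> 1" by auto
  qed measurable
  have d_int: "integrable M (d k j)" for k j
    using d01 by (intro integrable_const_bound[of _ 1]) (auto simp: d_def)
  have d_le: "(\<integral>x. d k j x \<partial>M) \<le> 2 * (1/2) ^ k" if "j \<le> k" for k j
  proof -
    have "(\<integral>x. d k j x \<partial>M) \<le> (\<integral>x. (1/2) ^ k + 2 ^ k * (g (r k) j x - g (r (Suc k)) j x)\<^sup>2 \<partial>M)"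
    proof (rule integral_mono[OF d_int])
      show "integrable M (\<lambda>x. (1/2) ^ k + 2 ^ k * (g (r k) j x - g (r (Suc k)) j x)\<^sup>2)"
        by (intro Bochner_Integration.integrable_add integrable_mult_right sq_int) simp
      fix x
      let ?u = "d k j x" and ?a = "2 ^ k :: real"
      \<comment> \<open>Expanding the square gives \<open>u \<le> 1/a + a * u\<^sup>2\<close>, which
        bounds an L1 norm by a squared L2 norm without Cauchy-Schwarz. With \<open>a = 2 ^ k\<close>
        and squared norm at most \<open>(1/4) ^ k\<close> both terms are at most
        \<open>(1/2) ^ k\<close>.\<close>
      have "0 \<le> (?a * ?u - 1)\<^sup>2 + 2 * ?a * ?u - ?a * ?u" by (simp add: d_def)
      then have "?a * ?u \<le> 1 + ?a\<^sup>2 * ?u\<^sup>2"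
        by (simp add: power2_eq_square algebra_simps)
      then have "?a * ?u \<le> ?a * ((1/2) ^ k + ?a * ?u\<^sup>2)"
        by (simp add: algebra_simps power2_eq_square power_one_over)
      then have "?u \<le> (1/2) ^ k + ?a * ?u\<^sup>2" by simp
      also have "?u\<^sup>2 = (g (r k) j x - g (r (Suc k)) j x)\<^sup>2"
        by (simp add: d_def power2_commute)
      finally show "?u \<le> (1/2) ^ k + ?a * (g (r k) j x - g (r (Suc k)) j x)\<^sup>2" .
    qed
    also have "\<dots> = (1/2) ^ k + 2 ^ k * (c (r k) j - c (r (Suc k)) j)"
      using sq_int c[of "r k" "r (Suc k)" j] r_mono
      by (simp add: prob_space strict_mono_less_eq)
    also have "\<dots> \<le> (1/2) ^ k + 2 ^ k * (1/4) ^ k"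
      using N[OF that r_ge, of "r (Suc k)"] r_mono by (simp add: strict_mono_less_eq)
    also have "(2::real) ^ k * (1/4) ^ k = (1/2) ^ k" by (simp flip: power_mult_distrib)
    finally show ?thesis by simp
  qed
  have "AE x in M. convergent (\<lambda>k. g (r k) j x)" for j
  proof -
    \<comment> \<open>The geometric estimate is available only for \<open>k \<ge> j\<close>; the
      finitely many earlier increments are bounded by 1.\<close>
    define B where "B k = (if k < j then 1 else 2 * (1/2) ^ k :: real)" for k
    have B_sum: "summable B"
    proof (rule summable_comparison_test_ev)
      show "\<forall>\<^sub>F k in sequentially. norm (B k) \<le> 2 * (1/2) ^ k"
        using eventually_ge_at_top[of j] by eventually_elim (simp add: B_def)
    qed (auto intro: summable_mult)
    have d_B: "(\<integral>\<^sup>+x. ennreal (d k j x) \<partial>M) \<le> ennreal (B k)" for k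
    proof -
      have "(\<integral>x. d k j x \<partial>M) \<le> (\<integral>x. 1 \<partial>M)"
        using d01 d_int by (intro integral_mono) auto
      then have "(\<integral>x. d k j x \<partial>M) \<le> B k"
        using d_le[of j k] by (auto simp: B_def prob_space)
      then show ?thesis
        using d0 by (subst nn_integral_eq_integral[OF d_int]) (auto intro: ennreal_leI)
    qed
    have "(\<integral>\<^sup>+x. (\<Sum>k. ennreal (d k j x)) \<partial>M) = (\<Sum>k. \<integral>\<^sup>+x. ennreal (d k j x) \<partial>M)"
      by (rule nn_integral_suminf) measurable
    also have "\<dots> \<le> (\<Sum>k. ennreal (B k))"
      by (intro suminf_le d_B) auto
    also have "\<dots> = ennreal (\<Sum>k. B k)"
      by (rule suminf_ennreal2[OF _ B_sum]) (simp add: B_def)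
    also have "\<dots> < \<infinity>" by simp
    finally have "AE x in M. (\<Sum>k. ennreal (d k j x)) \<noteq> \<infinity>"
      by (intro nn_integral_noteq_infinite) auto
    then show ?thesis
    proof eventually_elim
      case (elim x)
      have "summable (\<lambda>k. d k j x)"
        by (rule summable_suminf_not_top) (use elim in \<open>auto simp: d_def\<close>)
      then have "summable (\<lambda>k. g (r (Suc k)) j x - g (r k) j x)"
        unfolding d_def by (rule summable_rabs_cancel)
      then have "convergent (\<lambda>n. \<Sum>k<n. g (r (Suc k)) j x - g (r k) j x)"
        by (simp add: summable_iff_convergent)
      then have "convergent (\<lambda>n. g (r n) j x - g (r 0) j x)"
        by (simp add: sum_lessThan_telescope[of "\<lambda>n. g (r n) j x"])
      then show ?case by (simp add: convergent_diff_const_right_iff)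
    qed
  qed
  then have "AE x in M. \<forall>j. convergent (\<lambda>k. g (r k) j x)"
    by (simp add: AE_all_countable)
  with r_mono show thesis by (rule that)
qed

section \<open>Consistent families of kernels\<close>

text \<open>Kernels, products, squares and absolute differences preserve this class, and its members
  are integrable under every probability measure; integrability thus turns into a membership
  rule.\<close>

definition unit_funs :: "'a measure \<Rightarrow> ('a \<Rightarrow> real) set" where
  "unit_funs M = {f \<in> borel_measurable M. \<forall>x\<in>space M. 0 \<le> f x \<and> f x \<le> 1}"

lemma unit_funs_measurable: "f \<in> unit_funs M \<Longrightarrow> f \<in> borel_measurable M"
  and unit_funs_nonneg: "f \<in> unit_funs M \<Longrightarrow> x \<in> space M \<Longrightarrow> 0 \<le> f x"
  and unit_funs_le_1: "f \<in> unit_funs M \<Longrightarrow> x \<in> space M \<Longrightarrow> f x \<le> 1"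
  by (auto simp: unit_funs_def)

lemma unit_funs_indicator: "A \<in> sets M \<Longrightarrow> indicator A \<in> unit_funs M"
  by (auto simp: unit_funs_def indicator_def)

lemma unit_funs_mult: "f \<in> unit_funs M \<Longrightarrow> g \<in> unit_funs M \<Longrightarrow> (\<lambda>x. f x * g x) \<in> unit_funs M"
  by (auto simp: unit_funs_def intro: mult_le_one)

lemma unit_funs_power2: "f \<in> unit_funs M \<Longrightarrow> (\<lambda>x. (f x)\<^sup>2) \<in> unit_funs M"
  by (auto simp: unit_funs_def intro: power_le_one)

lemma unit_funs_abs_diff: "f \<in> unit_funs M \<Longrightarrow> g \<in> unit_funs M \<Longrightarrow> (\<lambda>x. \<bar>f x - g x\<bar>) \<in> unit_funs M"
  by (fastforce simp: unit_funs_def)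

lemma unit_funs_diff_power2: "f \<in> unit_funs M \<Longrightarrow> g \<in> unit_funs M \<Longrightarrow> (\<lambda>x. (f x - g x)\<^sup>2) \<in> unit_funs M"
  using unit_funs_power2[OF unit_funs_abs_diff, of f M g] by simp

lemma unit_funs_const: "0 \<le> c \<Longrightarrow> c \<le> 1 \<Longrightarrow> (\<lambda>x. c) \<in> unit_funs M"
  by (auto simp: unit_funs_def)

lemma prob_algebraD:
  assumes "\<mu> \<in> space (prob_algebra M)"
  shows "prob_space \<mu>" "sets \<mu> = sets M" "space \<mu> = space M"
  using assms by (auto simp: space_prob_algebra dest: sets_eq_imp_space_eq)

context
  fixes \<mu> :: "'a measure" and M f
  assumes \<mu>: "\<mu> \<in> space (prob_algebra M)" and f: "f \<in> unit_funs M"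
begin

interpretation prob_space \<mu> using \<mu> by (rule prob_algebraD)

lemma unit_funs_measurable': "f \<in> borel_measurable \<mu>"
  using unit_funs_measurable[OF f] prob_algebraD(2)[OF \<mu>] by (simp cong: measurable_cong_sets)

lemma integrable_unit_funs: "integrable \<mu> f"
  by (rule integrable_const_bound[of _ 1])
    (use f prob_algebraD(3)[OF \<mu>] unit_funs_measurable' in \<open>auto simp: unit_funs_def\<close>)

lemma integral_unit_funs_nonneg: "0 \<le> (\<integral>x. f x \<partial>\<mu>)"
  using f prob_algebraD(3)[OF \<mu>] by (intro integral_nonneg_AE) (auto simp: unit_funs_def)

lemma integral_unit_funs_le_1: "(\<integral>x. f x \<partial>\<mu>) \<le> 1"
proof -
  have "(\<integral>x. f x \<partial>\<mu>) \<le> (\<integral>x. 1 \<partial>\<mu>)"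
    using f prob_algebraD(3)[OF \<mu>]
    by (intro integral_mono_AE integrable_unit_funs) (auto simp: unit_funs_def)
  then show ?thesis by (simp add: prob_space)
qed

lemma nn_integral_unit_funs: "(\<integral>\<^sup>+x. ennreal (f x) \<partial>\<mu>) = ennreal (\<integral>x. f x \<partial>\<mu>)"
  using f prob_algebraD(3)[OF \<mu>]
  by (intro nn_integral_eq_integral integrable_unit_funs) (auto simp: unit_funs_def)

end

lemma measure_eq_integral:
  assumes "\<mu> \<in> space (prob_algebra M)" "A \<in> sets M"
  shows "(\<integral>x. indicator A x \<partial>\<mu>) = measure \<mu> A"
  using assms sets.sets_into_space[OF assms(2)] by (simp add: prob_algebraD Int_absorb2)

lemma unit_funs_kernel:
  assumes K: "K \<in> X \<rightarrow>\<^sub>M prob_algebra M" and f: "f \<in> unit_funs M"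
  shows "(\<lambda>x. \<integral>y. f y \<partial>K x) \<in> unit_funs X"
  unfolding unit_funs_def
proof (intro CollectI conjI ballI)
  show "(\<lambda>x. \<integral>y. f y \<partial>K x) \<in> borel_measurable X"
    using measurable_compose[OF measurable_prob_algebraD[OF K]
        integral_measurable_subprob_algebra[OF unit_funs_measurable[OF f]]] .
  fix x assume "x \<in> space X"
  with K have "K x \<in> space (prob_algebra M)" by (rule measurable_space)
  then show "0 \<le> (\<integral>y. f y \<partial>K x)" "(\<integral>y. f y \<partial>K x) \<le> 1"
    using integral_unit_funs_nonneg integral_unit_funs_le_1 f by auto
qed

lemma unit_funs_measure:
  assumes K: "K \<in> X \<rightarrow>\<^sub>M prob_algebra M" and A: "A \<in> sets M"
  shows "(\<lambda>x. measure (K x) A) \<in> unit_funs X"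
  unfolding unit_funs_def
proof (intro CollectI conjI ballI)
  show "(\<lambda>x. measure (K x) A) \<in> borel_measurable X"
    using measurable_compose[OF K measurable_measure_prob_algebra[OF A]] .
qed (use measurable_space[OF K] in \<open>auto intro: prob_space.prob_le_1 prob_algebraD\<close>)

lemma bind_in_prob_algebra:
  assumes "\<mu> \<in> space (prob_algebra M)" "K \<in> M \<rightarrow>\<^sub>M prob_algebra N"
  shows "\<mu> \<bind> K \<in> space (prob_algebra N)"
  unfolding space_prob_algebra using prob_space_bind'[OF assms] sets_bind'[OF assms] by simp

lemma integral_bind_unit_funs:
  assumes \<mu>: "\<mu> \<in> space (prob_algebra M)" and K: "K \<in> M \<rightarrow>\<^sub>M prob_algebra N" and f: "f \<in> unit_funs N"
  shows "(\<integral>y. f y \<partial>(\<mu> \<bind> K)) = (\<integral>x. \<integral>y. f y \<partial>K x \<partial>\<mu>)"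
proof -
  have K': "K \<in> \<mu> \<rightarrow>\<^sub>M subprob_algebra N"
    using measurable_prob_algebraD[OF K] prob_algebraD(2)[OF \<mu>] by (simp cong: measurable_cong_sets)
  have f_meas: "(\<lambda>y. ennreal (f y)) \<in> borel_measurable N"
    using unit_funs_measurable[OF f] by simp
  have "ennreal (\<integral>y. f y \<partial>(\<mu> \<bind> K)) = (\<integral>\<^sup>+x. \<integral>\<^sup>+y. ennreal (f y) \<partial>K x \<partial>\<mu>)"
    unfolding nn_integral_unit_funs[OF bind_in_prob_algebra[OF \<mu> K] f, symmetric]
    by (rule nn_integral_bind[OF f_meas K'])
  also have "\<dots> = (\<integral>\<^sup>+x. ennreal (\<integral>y. f y \<partial>K x) \<partial>\<mu>)"
    using measurable_space[OF K] prob_algebraD(3)[OF \<mu>]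
    by (intro nn_integral_cong nn_integral_unit_funs[OF _ f]) auto
  also have "\<dots> = ennreal (\<integral>x. \<integral>y. f y \<partial>K x \<partial>\<mu>)"
    by (rule nn_integral_unit_funs[OF \<mu> unit_funs_kernel[OF K f]])
  finally show ?thesis
    using integral_unit_funs_nonneg[OF \<mu> unit_funs_kernel[OF K f]]
      integral_unit_funs_nonneg[OF bind_in_prob_algebra[OF \<mu> K] f] by simp
qed

lemma measure_bind_prob_algebra:
  assumes \<mu>: "\<mu> \<in> space (prob_algebra M)" and K: "K \<in> M \<rightarrow>\<^sub>M prob_algebra N" and A: "A \<in> sets N"
  shows "measure (\<mu> \<bind> K) A = (\<integral>x. measure (K x) A \<partial>\<mu>)"
proof -
  have "measure (\<mu> \<bind> K) A = (\<integral>x. \<integral>y. indicator A y \<partial>K x \<partial>\<mu>)"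
    using integral_bind_unit_funs[OF \<mu> K unit_funs_indicator[OF A]]
      measure_eq_integral[OF bind_in_prob_algebra[OF \<mu> K] A] by simp
  also have "\<dots> = (\<integral>x. measure (K x) A \<partial>\<mu>)"
    using measurable_space[OF K] prob_algebraD(3)[OF \<mu>] A
    by (intro Bochner_Integration.integral_cong measure_eq_integral) auto
  finally show ?thesis .
qed

section \<open>Invariant measures and averaging operators of a consistent family\<close>

definition invariant_measures :: "'a measure \<Rightarrow> (nat \<Rightarrow> 'a \<Rightarrow> 'a measure) \<Rightarrow> 'a measure set" where
  "invariant_measures M K = {\<mu> \<in> space (prob_algebra M). \<forall>n. \<mu> \<bind> K n = \<mu>}"

locale consistent_kernels =
  fixes M :: "'a measure" and K :: "nat \<Rightarrow> 'a \<Rightarrow> 'a measure"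
  assumes kernel: "\<And>n. K n \<in> M \<rightarrow>\<^sub>M prob_algebra M"
    and consistent: "\<And>n m x. n \<le> m \<Longrightarrow> x \<in> space M \<Longrightarrow> K m x \<bind> K n = K m x"
begin

definition T :: "nat \<Rightarrow> ('a \<Rightarrow> real) \<Rightarrow> 'a \<Rightarrow> real" where
  "T n f x = (\<integral>y. f y \<partial>K n x)"

lemma kernel_space: "x \<in> space M \<Longrightarrow> K n x \<in> space (prob_algebra M)"
  using kernel by (rule measurable_space)

lemma T_unit: "f \<in> unit_funs M \<Longrightarrow> T n f \<in> unit_funs M"
  unfolding T_def using unit_funs_kernel[OF kernel] by (simp add: fun_eq_iff)

lemma T_T: "n \<le> m \<Longrightarrow> f \<in> unit_funs M \<Longrightarrow> x \<in> space M \<Longrightarrow> T m (T n f) x = T m f x"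
  using integral_bind_unit_funs[OF kernel_space kernel, of x f m n] consistent[of n m x]
  by (simp add: T_def[abs_def])

lemma T_indicator: "A \<in> sets M \<Longrightarrow> x \<in> space M \<Longrightarrow> T n (indicator A) x = measure (K n x) A"
  unfolding T_def by (rule measure_eq_integral[OF kernel_space])

lemma invariantD:
  assumes "\<mu> \<in> invariant_measures M K"
  shows "\<mu> \<in> space (prob_algebra M)" "\<mu> \<bind> K n = \<mu>"
  using assms by (auto simp: invariant_measures_def)

lemma integral_T:
  assumes \<mu>: "\<mu> \<in> invariant_measures M K" and f: "f \<in> unit_funs M"
  shows "(\<integral>x. T n f x \<partial>\<mu>) = (\<integral>x. f x \<partial>\<mu>)"
  using integral_bind_unit_funs[OF invariantD(1)[OF \<mu>] kernel f, of n] invariantD(2)[OF \<mu>, of n]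
  by (simp add: T_def)

lemma integral_T_indicator:
  assumes \<mu>: "\<mu> \<in> invariant_measures M K" and A: "A \<in> sets M"
  shows "(\<integral>x. T n (indicator A) x \<partial>\<mu>) = measure \<mu> A"
  using integral_T[OF \<mu> unit_funs_indicator[OF A]] measure_eq_integral[OF invariantD(1)[OF \<mu>] A] by simp

text \<open>The idempotent operator \<open>T m\<close> preserves \<open>\<mu>\<close>, so \<open>h = T m g\<close> has vanishing variance under
  \<open>K m x\<close> for almost every \<open>x\<close> and can be pulled out of \<open>T m (g h)\<close>: on \<open>L\<^sup>2(\<mu>)\<close> the operator is
  an orthogonal projection.\<close>

lemma integral_mult_T:
  assumes \<mu>: "\<mu> \<in> invariant_measures M K" and g: "g \<in> unit_funs M"
  shows "(\<integral>x. g x * T m g x \<partial>\<mu>) = (\<integral>x. (T m g x)\<^sup>2 \<partial>\<mu>)"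
proof -
  note \<mu>' = invariantD(1)[OF \<mu>]
  interpret \<mu>: prob_space \<mu> using \<mu>' by (rule prob_algebraD)
  define h where "h = T m g"
  have h: "h \<in> unit_funs M" unfolding h_def by (rule T_unit[OF g])
  have h2: "(\<lambda>y. (h y)\<^sup>2) \<in> unit_funs M" by (rule unit_funs_power2[OF h])
  have gh: "(\<lambda>y. g y * h y) \<in> unit_funs M" by (rule unit_funs_mult[OF g h])
  have Th: "T m h x = h x" if "x \<in> space M" for x
    unfolding h_def by (rule T_T[OF order_refl g that])
  have var: "(\<integral>y. (h y - h x)\<^sup>2 \<partial>K m x) = T m (\<lambda>y. (h y)\<^sup>2) x - (h x)\<^sup>2" if x: "x \<in> space M" for x
  proof -
    interpret prob_space "K m x" by (rule prob_algebraD[OF kernel_space[OF x]])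
    have int: "integrable (K m x) h" "integrable (K m x) (\<lambda>y. (h y)\<^sup>2)"
      by (rule integrable_unit_funs[OF kernel_space[OF x]], fact)+
    have "(\<integral>y. (h y - h x)\<^sup>2 \<partial>K m x) = (\<integral>y. (h y)\<^sup>2 - 2 * h x * h y + (h x)\<^sup>2 \<partial>K m x)"
      by (simp add: power2_diff algebra_simps)
    also have "\<dots> = T m (\<lambda>y. (h y)\<^sup>2) x - 2 * h x * T m h x + (h x)\<^sup>2"
      using int by (simp add: T_def prob_space)
    finally show ?thesis using Th[OF x] by (simp add: power2_eq_square)
  qed
  have int_var: "integrable \<mu> (\<lambda>x. T m (\<lambda>y. (h y)\<^sup>2) x - (h x)\<^sup>2)"
    using integrable_unit_funs[OF \<mu>' T_unit[OF h2]] integrable_unit_funs[OF \<mu>' h2] by simp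
  have "(\<integral>x. T m (\<lambda>y. (h y)\<^sup>2) x - (h x)\<^sup>2 \<partial>\<mu>) = 0"
    using integrable_unit_funs[OF \<mu>' T_unit[OF h2]] integrable_unit_funs[OF \<mu>' h2] integral_T[OF \<mu> h2]
    by simp
  moreover have "AE x in \<mu>. 0 \<le> T m (\<lambda>y. (h y)\<^sup>2) x - (h x)\<^sup>2"
  proof (rule AE_I2)
    fix x assume "x \<in> space \<mu>"
    then have "x \<in> space M" by (simp add: prob_algebraD[OF \<mu>'])
    from var[OF this, symmetric] show "0 \<le> T m (\<lambda>y. (h y)\<^sup>2) x - (h x)\<^sup>2" by simp
  qed
  ultimately have "AE x in \<mu>. T m (\<lambda>y. (h y)\<^sup>2) x - (h x)\<^sup>2 = 0"
    using integral_nonneg_eq_0_iff_AE[OF int_var] by simp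
  moreover have "AE x in \<mu>. x \<in> space M"
    using AE_space[of \<mu>] prob_algebraD(3)[OF \<mu>'] by simp
  ultimately have "AE x in \<mu>. T m (\<lambda>y. g y * h y) x = (h x)\<^sup>2"
  proof eventually_elim
    case (elim x)
    note Kx = kernel_space[OF elim(2), of m]
    interpret Kx: prob_space "K m x" by (rule prob_algebraD[OF Kx])
    have "integrable (K m x) (\<lambda>y. (h y - h x)\<^sup>2)"
      using h elim(2) by (intro integrable_unit_funs[OF Kx] unit_funs_diff_power2 unit_funs_const)
        (auto simp: unit_funs_def)
    from integral_nonneg_eq_0_iff_AE[OF this] have "AE y in K m x. (h y - h x)\<^sup>2 = 0"
      using var[OF elim(2)] elim(1) by simp
    then have "AE y in K m x. g y * h y = h x * g y"
      by eventually_elim simp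
    then have "T m (\<lambda>y. g y * h y) x = (\<integral>y. h x * g y \<partial>K m x)"
      unfolding T_def using unit_funs_measurable'[OF Kx gh] unit_funs_measurable'[OF Kx g]
      by (intro integral_cong_AE) auto
    then show ?case by (simp add: h_def T_def power2_eq_square)
  qed
  then have "(\<integral>x. T m (\<lambda>y. g y * h y) x \<partial>\<mu>) = (\<integral>x. (h x)\<^sup>2 \<partial>\<mu>)"
    using unit_funs_measurable'[OF \<mu>' T_unit[OF gh]] unit_funs_measurable'[OF \<mu>' h2]
    by (intro integral_cong_AE)
  then show ?thesis
    using integral_T[OF \<mu> gh] by (simp add: h_def)
qed

text \<open>Pythagoras: \<open>T m f\<close> equals \<open>T m (T n f)\<close>, the projection of
  \<open>T n f\<close>, so the increment is orthogonal to it. Squared increments are thus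
  differences of one sequence, the form that \<open>AE_convergent_subsequence\<close> asks
  for.\<close>

lemma integral_T_diff_power2:
  assumes \<mu>: "\<mu> \<in> invariant_measures M K" and f: "f \<in> unit_funs M" and "n \<le> m"
  shows "(\<integral>x. (T n f x - T m f x)\<^sup>2 \<partial>\<mu>) = (\<integral>x. (T n f x)\<^sup>2 \<partial>\<mu>) - (\<integral>x. (T m f x)\<^sup>2 \<partial>\<mu>)"
proof -
  note \<mu>' = invariantD(1)[OF \<mu>]
  have "(\<integral>x. T n f x * T m (T n f) x \<partial>\<mu>) = (\<integral>x. (T m (T n f) x)\<^sup>2 \<partial>\<mu>)"
    by (rule integral_mult_T[OF \<mu> T_unit[OF f]])
  moreover have "T m (T n f) x = T m f x" if "x \<in> space \<mu>" for x
    using T_T[OF \<open>n \<le> m\<close> f] that prob_algebraD(3)[OF \<mu>'] by simp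
  ultimately have *: "(\<integral>x. T n f x * T m f x \<partial>\<mu>) = (\<integral>x. (T m f x)\<^sup>2 \<partial>\<mu>)"
    by (simp cong: Bochner_Integration.integral_cong)
  have "integrable \<mu> (\<lambda>x. (T n f x)\<^sup>2)" "integrable \<mu> (\<lambda>x. (T m f x)\<^sup>2)" "integrable \<mu> (\<lambda>x. T n f x * T m f x)"
    by (intro integrable_unit_funs[OF \<mu>'] unit_funs_power2 unit_funs_mult T_unit f)+
  then show ?thesis
    using * by (simp add: power2_diff mult.assoc)
qed

lemma integral_T_power2_antimono:
  assumes "\<mu> \<in> invariant_measures M K" "f \<in> unit_funs M" "n \<le> m"
  shows "(\<integral>x. (T m f x)\<^sup>2 \<partial>\<mu>) \<le> (\<integral>x. (T n f x)\<^sup>2 \<partial>\<mu>)"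
proof -
  have "0 \<le> (\<integral>x. (T n f x - T m f x)\<^sup>2 \<partial>\<mu>)" by simp
  then show ?thesis using integral_T_diff_power2[OF assms] by simp
qed

text \<open>By invariance \<open>T n (indicator A)\<close> has mean \<open>measure \<mu> A\<close>,
  so the left side is its variance. Its vanishing in the limit is the ergodicity criterion, and its
  nonnegativity bounds the second moment below.\<close>

lemma integral_T_power2_variance:
  assumes \<mu>: "\<mu> \<in> invariant_measures M K" and A: "A \<in> sets M"
  shows "(\<integral>x. (T n (indicator A) x - measure \<mu> A)\<^sup>2 \<partial>\<mu>) =
    (\<integral>x. (T n (indicator A) x)\<^sup>2 \<partial>\<mu>) - (measure \<mu> A)\<^sup>2"
proof -
  note \<mu>' = invariantD(1)[OF \<mu>]
  interpret prob_space \<mu> using \<mu>' by (rule prob_algebraD)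
  have "integrable \<mu> (\<lambda>x. (T n (indicator A) x)\<^sup>2)" "integrable \<mu> (\<lambda>x. T n (indicator A) x)"
    by (intro integrable_unit_funs[OF \<mu>'] unit_funs_power2 T_unit unit_funs_indicator A)+
  then show ?thesis
    using integral_T_indicator[OF \<mu> A, of n]
    by (simp add: power2_diff prob_space) (simp add: power2_eq_square)
qed

end

text \<open>Right continuity lets each inequality afford a strictly larger rational argument. This
  weak form suits limits taken at rational levels, which are only squeezed between values of a
  distribution function.\<close>

lemma real_distribution_cong_rat:
  assumes \<nu>: "real_distribution \<nu>" and \<nu>': "real_distribution \<nu>'"
    and le: "\<And>t (q :: rat). t < of_rat q \<Longrightarrow> cdf \<nu> t \<le> cdf \<nu>' (of_rat q)"
    and ge: "\<And>t (q :: rat). t < of_rat q \<Longrightarrow> cdf \<nu>' t \<le> cdf \<nu> (of_rat q)"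
  shows "\<nu> = \<nu>'"
proof (rule cdf_unique[OF \<nu> \<nu>'])
  have *: "cdf M1 t \<le> cdf M2 t"
    if M2: "real_distribution M2" and le: "\<And>t (q :: rat). t < of_rat q \<Longrightarrow> cdf M1 t \<le> cdf M2 (of_rat q)" for M1 M2 t
  proof (rule ccontr)
    assume "\<not> cdf M1 t \<le> cdf M2 t"
    then have "cdf M2 t < cdf M1 t" by simp
    interpret M2: real_distribution M2 by fact
    have "(cdf M2 \<longlongrightarrow> cdf M2 t) (at_right t)"
      using M2.cdf_is_right_cont[of t] by (simp add: continuous_within)
    then have "\<forall>\<^sub>F s in at_right t. cdf M2 s < cdf M1 t"
      using \<open>cdf M2 t < cdf M1 t\<close> by (rule order_tendstoD)
    then obtain b where b: "t < b" "\<And>s. t < s \<Longrightarrow> s < b \<Longrightarrow> cdf M2 s < cdf M1 t"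
      unfolding eventually_at_right_field by blast
    obtain q where "t < of_rat q" "of_rat q < b" using of_rat_dense[OF b(1)] by blast
    with b(2) le show False by (meson not_less)
  qed
  show "cdf \<nu> = cdf \<nu>'"
    using *[OF \<nu>' le] *[OF \<nu> ge] by (intro ext antisym)
qed

section \<open>Kernels on a space coded by reals\<close>

locale coded_kernels = consistent_kernels +
  fixes e :: "'a \<Rightarrow> real" and d :: "real \<Rightarrow> 'a"
  assumes e [measurable]: "e \<in> borel_measurable M"
    and d [measurable]: "d \<in> borel \<rightarrow>\<^sub>M M"
    and d_e: "\<And>y. y \<in> space M \<Longrightarrow> d (e y) = y"
    and e01: "\<And>y. y \<in> space M \<Longrightarrow> e y \<in> {0..1}"
begin

definition sublevel :: "real \<Rightarrow> 'a set" where
  "sublevel t = {y \<in> space M. e y \<le> t}"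

lemma sublevel_sets [measurable]: "sublevel t \<in> sets M"
  unfolding sublevel_def by measurable

lemma sublevel_mono: "s \<le> t \<Longrightarrow> sublevel s \<subseteq> sublevel t"
  by (auto simp: sublevel_def)

text \<open>A measure is recovered from the law of its code by pushing forward along the left
  inverse \<open>d\<close>; hence the distribution function of the code determines it.\<close>

lemma distr_e:
  assumes "\<nu> \<in> space (prob_algebra M)"
  shows "real_distribution (distr \<nu> borel e)" "cdf (distr \<nu> borel e) t = measure \<nu> (sublevel t)"
    "distr (distr \<nu> borel e) M d = \<nu>"
proof -
  note \<nu> = prob_algebraD[OF assms]
  interpret prob_space \<nu> by (rule \<nu>)
  have e' [measurable]: "e \<in> borel_measurable \<nu>" using \<nu>(2) by (simp cong: measurable_cong_sets)
  show "real_distribution (distr \<nu> borel e)"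
    by (rule real_distribution_distr) (rule e')
  have "e -` {..t} \<inter> space \<nu> = sublevel t" by (auto simp: sublevel_def \<nu>(3))
  then show "cdf (distr \<nu> borel e) t = measure \<nu> (sublevel t)"
    by (simp add: cdf_def measure_distr)
  have "distr (distr \<nu> borel e) M d = distr \<nu> M (d \<circ> e)"
    by (rule distr_distr) (rule d, rule e')
  also have "\<dots> = distr \<nu> \<nu> (\<lambda>y. y)"
    by (rule distr_cong) (simp_all add: d_e \<nu>)
  finally show "distr (distr \<nu> borel e) M d = \<nu>" by simp
qed

lemma prob_eqI:
  assumes \<nu>: "\<nu> \<in> space (prob_algebra M)" and \<nu>': "\<nu>' \<in> space (prob_algebra M)"
    and eq: "\<And>q :: rat. measure \<nu> (sublevel (of_rat q)) = measure \<nu>' (sublevel (of_rat q))"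
  shows "\<nu> = \<nu>'"
proof -
  have "distr \<nu> borel e = distr \<nu>' borel e"
  proof (rule real_distribution_cong_rat)
    fix t :: real and q :: rat assume "t < of_rat q"
    interpret \<nu>: real_distribution "distr \<nu> borel e" by (rule distr_e[OF \<nu>])
    interpret \<nu>': real_distribution "distr \<nu>' borel e" by (rule distr_e[OF \<nu>'])
    show "cdf (distr \<nu> borel e) t \<le> cdf (distr \<nu>' borel e) (of_rat q)"
      using \<nu>.cdf_nondecreasing[of t "of_rat q"] \<open>t < of_rat q\<close> eq[of q] by (simp add: distr_e[OF \<nu>] distr_e[OF \<nu>'])
    show "cdf (distr \<nu>' borel e) t \<le> cdf (distr \<nu> borel e) (of_rat q)"
      using \<nu>'.cdf_nondecreasing[of t "of_rat q"] \<open>t < of_rat q\<close> eq[of q] by (simp add: distr_e[OF \<nu>] distr_e[OF \<nu>'])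
  qed (use distr_e \<nu> \<nu>' in auto)
  then show ?thesis using distr_e(3)[OF \<nu>] distr_e(3)[OF \<nu>'] by metis
qed

text \<open>Probability measures that agree on all rational sublevels coincide, so invariance is a
  countable family of scalar equations. The exceptional null sets can then be collected, and
  invariance becomes a measurable condition.\<close>

lemma invariantI:
  assumes \<nu>: "\<nu> \<in> space (prob_algebra M)"
    and eq: "\<And>n (q :: rat). (\<integral>y. T n (indicator (sublevel (of_rat q))) y \<partial>\<nu>) = measure \<nu> (sublevel (of_rat q))"
  shows "\<nu> \<in> invariant_measures M K"
  unfolding invariant_measures_def
proof (intro CollectI conjI allI \<nu>)
  fix n
  show "\<nu> \<bind> K n = \<nu>"
  proof (rule prob_eqI[OF bind_in_prob_algebra[OF \<nu> kernel] \<nu>])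
    fix q :: rat
    have "measure (\<nu> \<bind> K n) (sublevel (of_rat q)) = (\<integral>y. measure (K n y) (sublevel (of_rat q)) \<partial>\<nu>)"
      by (rule measure_bind_prob_algebra[OF \<nu> kernel sublevel_sets])
    also have "\<dots> = (\<integral>y. T n (indicator (sublevel (of_rat q))) y \<partial>\<nu>)"
      using prob_algebraD(3)[OF \<nu>] by (intro Bochner_Integration.integral_cong) (auto simp: T_indicator)
    finally show "measure (\<nu> \<bind> K n) (sublevel (of_rat q)) = measure \<nu> (sublevel (of_rat q))" by (simp add: eq)
  qed
qed

section \<open>The limit kernel under an invariant measure, for kernels that converge at rational
  levels\<close>

context
  fixes \<mu> and \<rho> :: "'a \<Rightarrow> real measure"
  assumes \<mu>: "\<mu> \<in> invariant_measures M K"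
    and \<rho>: "\<rho> \<in> M \<rightarrow>\<^sub>M prob_algebra borel"
    and conv: "AE x in \<mu>. \<forall>q::rat. convergent (\<lambda>k. measure (K k x) (sublevel (of_rat q)))"
    and cdf_\<rho>: "AE x in \<mu>. \<forall>t. measure (\<rho> x) {..t} =
      (INF q\<in>{q::rat. t < of_rat q}. lim (\<lambda>k. measure (K k x) (sublevel (of_rat q))))"
begin

private lemma \<mu>': "\<mu> \<in> space (prob_algebra M)"
  by (rule invariantD[OF \<mu>])

private lemma sets_\<mu>: "sets \<mu> = sets M" and space_\<mu>: "space \<mu> = space M"
  using prob_algebraD[OF \<mu>'] by auto

private lemma prob_\<mu>: "prob_space \<mu>"
  by (rule prob_algebraD[OF \<mu>'])

interpretation \<mu>: prob_space \<mu> by (rule prob_\<mu>)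

text \<open>The limit at rational levels before right continuity is imposed, so it need not be a
  distribution function. It is tied to \<rho> by the squeeze \<open>measure (\<rho> x) {..t} \<le> F
  q x \<le> measure (\<rho> x) {..of_rat q}\<close> for \<open>t < of_rat q\<close>, almost
  surely.\<close>

private definition F :: "rat \<Rightarrow> 'a \<Rightarrow> real" where
  "F q x = lim (\<lambda>k. measure (K k x) (sublevel (of_rat q)))"

private lemma KA_unit: "B \<in> sets M \<Longrightarrow> (\<lambda>x. measure (K k x) B) \<in> unit_funs M"
  by (rule unit_funs_measure[OF kernel])

private lemma \<rho>_unit: "B \<in> sets borel \<Longrightarrow> (\<lambda>x. measure (\<rho> x) B) \<in> unit_funs M"
  by (rule unit_funs_measure[OF \<rho>])

private lemma integral_K: "B \<in> sets M \<Longrightarrow> (\<integral>x. measure (K k x) B \<partial>\<mu>) = measure \<mu> B"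
  using measure_bind_prob_algebra[OF \<mu>' kernel, of B k] invariantD(2)[OF \<mu>, of k] by simp

private lemma K_mono: "x \<in> space M \<Longrightarrow> s \<le> t \<Longrightarrow> measure (K k x) (sublevel s) \<le> measure (K k x) (sublevel t)"
proof -
  assume x: "x \<in> space M" and "s \<le> t"
  interpret prob_space "K k x" by (rule prob_algebraD[OF kernel_space[OF x]])
  show ?thesis
    using prob_algebraD(2)[OF kernel_space[OF x]] sublevel_mono[OF \<open>s \<le> t\<close>] by (intro finite_measure_mono) auto
qed

private lemma F_lim: "AE x in \<mu>. \<forall>q. (\<lambda>k. measure (K k x) (sublevel (of_rat q))) \<longlonglongrightarrow> F q x"
  using conv by eventually_elim (simp add: F_def convergent_LIMSEQ_iff)

private lemma F_meas [measurable]: "F q \<in> borel_measurable \<mu>"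
proof -
  have [measurable]: "(\<lambda>x. measure (K k x) (sublevel (of_rat q))) \<in> borel_measurable \<mu>" for k
    by (rule unit_funs_measurable'[OF \<mu>' KA_unit[OF sublevel_sets]])
  show ?thesis unfolding F_def by measurable
qed

private lemma KA_meas [measurable]: "B \<in> sets M \<Longrightarrow> (\<lambda>x. measure (K k x) B) \<in> borel_measurable \<mu>"
  by (rule unit_funs_measurable'[OF \<mu>' KA_unit])

private lemma F_01: "AE x in \<mu>. \<forall>q. 0 \<le> F q x \<and> F q x \<le> 1"
  using F_lim AE_space
proof eventually_elim
  case (elim x)
  then have x: "x \<in> space M" by (simp add: space_\<mu>)
  have "0 \<le> F q x \<and> F q x \<le> 1" for q
    using LIMSEQ_le_const[of _ "F q x" 0] LIMSEQ_le_const2[of _ "F q x" 1] elim(1)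
      unit_funs_nonneg[OF KA_unit[OF sublevel_sets] x] unit_funs_le_1[OF KA_unit[OF sublevel_sets] x] by meson
  then show ?case by blast
qed

private lemma F_int: "integrable \<mu> (F q)"
  using F_01 by (intro \<mu>.integrable_const_bound[of _ 1]) auto

private lemma F_L1: "(\<lambda>k. \<integral>x. \<bar>F q x - measure (K k x) (sublevel (of_rat q))\<bar> \<partial>\<mu>) \<longlonglongrightarrow> 0"
proof -
  have "(\<lambda>k. \<integral>x. \<bar>F q x - measure (K k x) (sublevel (of_rat q))\<bar> \<partial>\<mu>) \<longlonglongrightarrow> (\<integral>x. 0 \<partial>\<mu>)"
  proof (rule integral_dominated_convergence[where w="\<lambda>_. 1"])
    show "AE x in \<mu>. (\<lambda>k. \<bar>F q x - measure (K k x) (sublevel (of_rat q))\<bar>) \<longlonglongrightarrow> 0"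
      using F_lim
    proof eventually_elim
      case (elim x)
      then have "(\<lambda>k. \<bar>F q x - measure (K k x) (sublevel (of_rat q))\<bar>) \<longlonglongrightarrow> \<bar>F q x - F q x\<bar>"
        by (intro tendsto_intros) blast
      then show ?case by simp
    qed
    show "AE x in \<mu>. norm \<bar>F q x - measure (K k x) (sublevel (of_rat q))\<bar> \<le> 1" for k
      using F_01 AE_space
    proof eventually_elim
      case (elim x)
      then have "x \<in> space M" by (simp add: space_\<mu>)
      then have "0 \<le> measure (K k x) (sublevel (of_rat q))" "measure (K k x) (sublevel (of_rat q)) \<le> 1"
        by (rule unit_funs_nonneg[OF KA_unit[OF sublevel_sets]], rule unit_funs_le_1[OF KA_unit[OF sublevel_sets]])
      then show ?case using elim(1)[rule_format, of q] by (simp only: real_norm_def abs_abs abs_le_iff) linarith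
    qed
  qed auto
  then show ?thesis by simp
qed

private lemma F_integral: "(\<integral>x. F q x \<partial>\<mu>) = measure \<mu> (sublevel (of_rat q))"
proof -
  have int: "integrable \<mu> (\<lambda>x. measure (K k x) (sublevel (of_rat q)))" for k
    by (rule integrable_unit_funs[OF \<mu>' KA_unit[OF sublevel_sets]])
  have "norm ((\<integral>x. F q x \<partial>\<mu>) - measure \<mu> (sublevel (of_rat q))) \<le> (\<integral>x. \<bar>F q x - measure (K k x) (sublevel (of_rat q))\<bar> \<partial>\<mu>)" for k
    using integral_norm_bound[of \<mu> "\<lambda>x. F q x - measure (K k x) (sublevel (of_rat q))"] F_int int integral_K[OF sublevel_sets]
    by simp
  then have "norm ((\<integral>x. F q x \<partial>\<mu>) - measure \<mu> (sublevel (of_rat q))) \<le> 0"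
    using LIMSEQ_le_const[OF F_L1] by blast
  then show ?thesis by simp
qed

private lemma \<rho>_le_F: "AE x in \<mu>. \<forall>t q. t < of_rat q \<longrightarrow> measure (\<rho> x) {..t} \<le> F q x"
  using cdf_\<rho> F_01
proof eventually_elim
  case (elim x)
  show ?case
  proof (intro allI impI)
    fix t :: real and q assume "t < of_rat q"
    have "bdd_below ((\<lambda>q. F q x) ` {q. t < of_rat q})"
      using elim(2) by (intro bdd_belowI[of _ 0]) auto
    then show "measure (\<rho> x) {..t} \<le> F q x"
      using \<open>t < of_rat q\<close> elim(1)[rule_format, of t] unfolding F_def by (auto intro: cINF_lower)
  qed
qed

private lemma F_le_\<rho>: "AE x in \<mu>. \<forall>q. F q x \<le> measure (\<rho> x) {..of_rat q}"
  using cdf_\<rho> F_lim AE_space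
proof eventually_elim
  case (elim x)
  show ?case
  proof
    fix q
    have "F q x \<le> F p x" if "(of_rat q :: real) < of_rat p" for p
      by (rule LIMSEQ_le[OF elim(2)[rule_format, of q] elim(2)[rule_format, of p]])
        (use elim(3) K_mono[of x "of_rat q" "of_rat p"] that space_\<mu> in auto)
    moreover have "{p::rat. (of_rat q :: real) < of_rat p} \<noteq> {}"
      using of_rat_dense[of "of_rat q" "of_rat q + 1"] by auto
    ultimately have "F q x \<le> (INF p\<in>{p. (of_rat q :: real) < of_rat p}. F p x)"
      by (intro cINF_greatest) auto
    then show "F q x \<le> measure (\<rho> x) {..of_rat q}"
      using elim(1) by (simp add: F_def)
  qed
qed

text \<open>Integrating the squeeze of \<open>F\<close> against \<mu> compares the two distribution
  functions at neighbouring levels. The identity says that, on average, the limits put no mass where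
  the code of \<mu> has none; it is what lets them be tested on arbitrary Borel sets.\<close>

private lemma bind_\<rho>: "\<mu> \<bind> \<rho> = distr \<mu> borel e"
proof (rule real_distribution_cong_rat)
  note \<mu>\<rho> = bind_in_prob_algebra[OF \<mu>' \<rho>]
  show "real_distribution (\<mu> \<bind> \<rho>)"
    using prob_algebraD[OF \<mu>\<rho>] by (simp add: real_distribution_def real_distribution_axioms_def)
  show "real_distribution (distr \<mu> borel e)" by (rule distr_e[OF \<mu>'])
  have cdf: "cdf (\<mu> \<bind> \<rho>) t = (\<integral>x. measure (\<rho> x) {..t} \<partial>\<mu>)" for t
    unfolding cdf_def by (rule measure_bind_prob_algebra[OF \<mu>' \<rho>]) simp
  have int: "integrable \<mu> (\<lambda>x. measure (\<rho> x) {..t})" for t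
    by (rule integrable_unit_funs[OF \<mu>' \<rho>_unit]) simp
  fix t :: real and q :: rat assume t: "t < of_rat q"
  have "(\<integral>x. measure (\<rho> x) {..t} \<partial>\<mu>) \<le> (\<integral>x. F q x \<partial>\<mu>)"
    using \<rho>_le_F t by (intro integral_mono_AE int F_int) auto
  then show "cdf (\<mu> \<bind> \<rho>) t \<le> cdf (distr \<mu> borel e) (of_rat q)"
    by (simp add: cdf F_integral distr_e[OF \<mu>'])
  have "measure \<mu> (sublevel t) \<le> measure \<mu> (sublevel (of_rat q))"
    using t sublevel_mono[of t "of_rat q"] by (intro \<mu>.finite_measure_mono) (auto simp: sets_\<mu>)
  also have "\<dots> = (\<integral>x. F q x \<partial>\<mu>)" by (simp add: F_integral)
  also have "\<dots> \<le> (\<integral>x. measure (\<rho> x) {..of_rat q} \<partial>\<mu>)"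
    using F_le_\<rho> by (intro integral_mono_AE int F_int) auto
  finally show "cdf (distr \<mu> borel e) t \<le> cdf (\<mu> \<bind> \<rho>) (of_rat q)"
    by (simp add: cdf distr_e[OF \<mu>'])
qed

private definition P :: "real set \<Rightarrow> 'a set" where
  "P B = e -` B \<inter> space M"

private lemma P_sets [measurable]: "B \<in> sets borel \<Longrightarrow> P B \<in> sets M"
  unfolding P_def by (rule measurable_sets[OF e])

private lemma integral_\<rho>: "B \<in> sets borel \<Longrightarrow> (\<integral>x. measure (\<rho> x) B \<partial>\<mu>) = measure \<mu> (P B)"
  using measure_bind_prob_algebra[OF \<mu>' \<rho>, of B] e
  by (simp add: bind_\<rho> measure_distr P_def space_\<mu> sets_\<mu> cong: measurable_cong_sets)

private lemma int_\<rho>: "B \<in> sets borel \<Longrightarrow> integrable \<mu> (\<lambda>x. measure (\<rho> x) B)"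
  by (rule integrable_unit_funs[OF \<mu>' \<rho>_unit])

private lemma int_K: "B \<in> sets M \<Longrightarrow> integrable \<mu> (\<lambda>x. measure (K k x) B)"
  by (rule integrable_unit_funs[OF \<mu>' KA_unit])

text \<open>Pointwise convergence may fail at a real level. A rational \<open>q\<close> slightly
  above \<open>t\<close> is used instead, chosen so that \<mu> has mass below \<epsilon>/4 between
  the two levels. The errors made in \<rho> and in \<open>K k\<close> are differences of known sign,
  so their integrals are exactly such masses, uniformly in \<open>k\<close>.\<close>

private lemma L1_atMost:
  "(\<lambda>k. \<integral>x. \<bar>measure (\<rho> x) {..t} - measure (K k x) (P {..t})\<bar> \<partial>\<mu>) \<longlonglongrightarrow> 0"
proof (rule LIMSEQ_I)
  have P: "P {..t} = sublevel t" for t by (auto simp: P_def sublevel_def)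
  fix \<epsilon> :: real assume "\<epsilon> > 0"
  interpret \<mu>e: real_distribution "distr \<mu> borel e" by (rule distr_e[OF \<mu>'])
  have "((\<lambda>s. measure \<mu> (sublevel s)) \<longlongrightarrow> measure \<mu> (sublevel t)) (at_right t)"
    using \<mu>e.cdf_is_right_cont[of t] by (simp add: continuous_within distr_e(2)[OF \<mu>', abs_def])
  then have "\<forall>\<^sub>F s in at_right t. measure \<mu> (sublevel s) < measure \<mu> (sublevel t) + \<epsilon> / 4"
    using \<open>\<epsilon> > 0\<close> by (intro order_tendstoD) auto
  then obtain b where b: "t < b" "\<And>s. t < s \<Longrightarrow> s < b \<Longrightarrow> measure \<mu> (sublevel s) < measure \<mu> (sublevel t) + \<epsilon> / 4"
    unfolding eventually_at_right_field by blast
  obtain q where q: "t < of_rat q" "of_rat q < b" using of_rat_dense[OF b(1)] by blast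
  obtain N where N: "\<And>k. N \<le> k \<Longrightarrow> (\<integral>x. \<bar>F q x - measure (K k x) (sublevel (of_rat q))\<bar> \<partial>\<mu>) < \<epsilon> / 2"
    using order_tendstoD(2)[OF F_L1[of q], of "\<epsilon> / 2"] \<open>\<epsilon> > 0\<close> by (auto simp: eventually_sequentially)
  have "(\<integral>x. \<bar>measure (\<rho> x) {..t} - measure (K k x) (sublevel t)\<bar> \<partial>\<mu>) < \<epsilon>" if "N \<le> k" for k
  proof -
    have "(\<integral>x. \<bar>measure (\<rho> x) {..t} - measure (K k x) (sublevel t)\<bar> \<partial>\<mu>) \<le>
      (\<integral>x. (F q x - measure (\<rho> x) {..t}) + \<bar>F q x - measure (K k x) (sublevel (of_rat q))\<bar>
        + (measure (K k x) (sublevel (of_rat q)) - measure (K k x) (sublevel t)) \<partial>\<mu>)"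
    proof (rule integral_mono_AE)
      show "AE x in \<mu>. \<bar>measure (\<rho> x) {..t} - measure (K k x) (sublevel t)\<bar> \<le>
        (F q x - measure (\<rho> x) {..t}) + \<bar>F q x - measure (K k x) (sublevel (of_rat q))\<bar>
        + (measure (K k x) (sublevel (of_rat q)) - measure (K k x) (sublevel t))"
        using \<rho>_le_F AE_space
      proof eventually_elim
        case (elim x)
        have "measure (\<rho> x) {..t} \<le> F q x" using elim(1) q by blast
        moreover have "measure (K k x) (sublevel t) \<le> measure (K k x) (sublevel (of_rat q))"
          using elim(2) q by (intro K_mono) (auto simp: space_\<mu>)
        ultimately show ?case by linarith
      qed
    qed (intro Bochner_Integration.integrable_add Bochner_Integration.integrable_diff integrable_abs
        F_int int_\<rho> int_K sublevel_sets, simp_all)+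
    also have "\<dots> = (measure \<mu> (sublevel (of_rat q)) - measure \<mu> (sublevel t))
        + (\<integral>x. \<bar>F q x - measure (K k x) (sublevel (of_rat q))\<bar> \<partial>\<mu>) + (measure \<mu> (sublevel (of_rat q)) - measure \<mu> (sublevel t))"
      using F_int int_\<rho>[of "{..t}"] int_K[OF sublevel_sets]
      by (simp add: F_integral integral_\<rho> integral_K P)
    also have "\<dots> < \<epsilon>"
      using N[OF that] b(2)[OF q] by linarith
    finally show ?thesis .
  qed
  then show "\<exists>N. \<forall>k\<ge>N. norm ((\<integral>x. \<bar>measure (\<rho> x) {..t} - measure (K k x) (P {..t})\<bar> \<partial>\<mu>) - 0) < \<epsilon>"
    by (intro exI[of _ N]) (simp add: P)
qed

text \<open>Induction from the intersection-stable generator of half-lines. For a disjoint union the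
  tail \<open>R N\<close> has the same mean mass \<open>measure \<mu> (P (R N))\<close> under \<rho>
  and under every \<open>K k\<close>, so it is small uniformly in \<open>k\<close> and only finitely
  many pieces have to converge.\<close>

private lemma L1_borel:
  assumes "B \<in> sets borel"
  shows "(\<lambda>k. \<integral>x. \<bar>measure (\<rho> x) B - measure (K k x) (P B)\<bar> \<partial>\<mu>) \<longlonglongrightarrow> 0"
proof -
  have borel: "sets borel = sigma_sets UNIV (range (\<lambda>t::real. {..t}))"
    by (subst borel_eq_atMost) simp
  have "Int_stable (range (\<lambda>t::real. {..t}))" by (auto simp: Int_stable_def)
  moreover have "range (\<lambda>t::real. {..t}) \<subseteq> Pow UNIV" by simp
  ultimately show ?thesis
    using assms unfolding borel
  proof (induction rule: sigma_sets_induct_disjoint)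
    case (basic B)
    then show ?case using L1_atMost by auto
  next
    case empty
    then show ?case by (simp add: P_def)
  next
    case (compl B)
    then have B: "B \<in> sets borel" by (simp add: borel)
    have "\<bar>measure (\<rho> x) (UNIV - B) - measure (K k x) (P (UNIV - B))\<bar> =
      \<bar>measure (\<rho> x) B - measure (K k x) (P B)\<bar>" if x: "x \<in> space \<mu>" for x k
    proof -
      have xM: "x \<in> space M" using x by (simp add: space_\<mu>)
      note \<rho>x = prob_algebraD[OF measurable_space[OF \<rho> xM]]
      note Kx = prob_algebraD[OF kernel_space[OF xM, of k]]
      have "measure (\<rho> x) (UNIV - B) = 1 - measure (\<rho> x) B"
        using prob_space.prob_compl[OF \<rho>x(1), of B] B by (simp add: \<rho>x)
      moreover have "P (UNIV - B) = space (K k x) - P B"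
        by (auto simp: P_def Kx)
      then have "measure (K k x) (P (UNIV - B)) = 1 - measure (K k x) (P B)"
        using prob_space.prob_compl[OF Kx(1), of "P B"] P_sets[OF B] by (simp add: Kx)
      ultimately show ?thesis by simp
    qed
    then show ?case using compl.IH by (simp cong: Bochner_Integration.integral_cong)
  next
    case (union B)
    then have B: "B i \<in> sets borel" for i by (auto simp: borel)
    define R where "R N = (\<Union>i\<in>{N..}. B i)" for N :: nat
    have R: "R N \<in> sets borel" for N unfolding R_def using B by auto
    have split: "(\<Union>i. B i) = (\<Union>i\<in>{..<N}. B i) \<union> R N" for N
    proof -
      have "UNIV = {..<N} \<union> {N..}" by auto
      then show ?thesis unfolding R_def by (metis UN_Un)
    qed
    have B_disj: "B i \<inter> B j = {}" if "i \<noteq> j" for i j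
      using union.hyps(1) that by (auto simp: disjoint_family_on_def)
    have disj: "disjoint_family_on B {..<N}" "(\<Union>i\<in>{..<N}. B i) \<inter> R N = {}" for N
    proof -
      show "disjoint_family_on B {..<N}" using B_disj by (simp add: disjoint_family_on_def)
      have "B i \<inter> B j = {}" if "i < N" "N \<le> j" for i j
        using that by (intro B_disj) simp
      then show "(\<Union>i\<in>{..<N}. B i) \<inter> R N = {}"
        unfolding R_def by (simp add: Int_UN_distrib2)
    qed
    have R_lim: "(\<lambda>N. measure \<mu> (P (R N))) \<longlonglongrightarrow> 0"
    proof -
      have "(\<lambda>N. measure \<mu> (P (R N))) \<longlonglongrightarrow> measure \<mu> (\<Inter>N. P (R N))"
      proof (rule \<mu>.finite_Lim_measure_decseq)
        show "range (\<lambda>N. P (R N)) \<subseteq> sets \<mu>"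
          using P_sets[OF R] by (auto simp: sets_\<mu>)
        have "R n \<subseteq> R m" if "m \<le> n" for m n
          unfolding R_def using that by (intro UN_mono) auto
        then show "decseq (\<lambda>N. P (R N))"
          unfolding decseq_def P_def by blast
      qed
      moreover have "(\<Inter>N. P (R N)) = {}"
      proof -
        have "\<exists>N. e y \<notin> R N" for y
        proof (cases "\<exists>i. e y \<in> B i")
          case True
          then obtain i where i: "e y \<in> B i" by blast
          have "e y \<notin> B j" if "Suc i \<le> j" for j
            using B_disj[of i j] i that by auto
          then have "e y \<notin> R (Suc i)" by (simp add: R_def)
          then show ?thesis ..
        next
          case False
          then have "e y \<notin> R 0" by (simp add: R_def)
          then show ?thesis ..
        qed
        then show ?thesis by (simp add: P_def set_eq_iff)
      qed
      ultimately show ?thesis by simp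
    qed
    show ?case
    proof (rule LIMSEQ_I)
      fix \<epsilon> :: real assume "\<epsilon> > 0"
      obtain N where N: "measure \<mu> (P (R N)) < \<epsilon> / 4"
        using order_tendstoD(2)[OF R_lim, of "\<epsilon> / 4"] \<open>\<epsilon> > 0\<close> by (auto simp: eventually_sequentially)
      have "(\<lambda>k. \<Sum>i<N. \<integral>x. \<bar>measure (\<rho> x) (B i) - measure (K k x) (P (B i))\<bar> \<partial>\<mu>) \<longlonglongrightarrow> (\<Sum>i<N. 0)"
        by (intro tendsto_sum union.IH)
      then obtain k0 where k0: "\<And>k. k0 \<le> k \<Longrightarrow>
          (\<Sum>i<N. \<integral>x. \<bar>measure (\<rho> x) (B i) - measure (K k x) (P (B i))\<bar> \<partial>\<mu>) < \<epsilon> / 2"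
        using order_tendstoD(2)[of _ "0::real" sequentially "\<epsilon> / 2"] \<open>\<epsilon> > 0\<close> by (auto simp: eventually_sequentially)
      have "(\<integral>x. \<bar>measure (\<rho> x) (\<Union>i. B i) - measure (K k x) (P (\<Union>i. B i))\<bar> \<partial>\<mu>) < \<epsilon>" if "k0 \<le> k" for k
      proof -
        have "(\<integral>x. \<bar>measure (\<rho> x) (\<Union>i. B i) - measure (K k x) (P (\<Union>i. B i))\<bar> \<partial>\<mu>) \<le>
          (\<integral>x. (\<Sum>i<N. \<bar>measure (\<rho> x) (B i) - measure (K k x) (P (B i))\<bar>)
             + measure (\<rho> x) (R N) + measure (K k x) (P (R N)) \<partial>\<mu>)"
        proof (rule integral_mono)
          fix x assume "x \<in> space \<mu>"
          then have xM: "x \<in> space M" by (simp add: space_\<mu>)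
          note \<rho>x = prob_algebraD[OF measurable_space[OF \<rho> xM]]
          note Kx = prob_algebraD[OF kernel_space[OF xM, of k]]
          interpret \<rho>x: prob_space "\<rho> x" by (rule \<rho>x)
          interpret Kx: prob_space "K k x" by (rule Kx)
          have 1: "measure (\<rho> x) (\<Union>i. B i) = (\<Sum>i<N. measure (\<rho> x) (B i)) + measure (\<rho> x) (R N)"
            unfolding split[of N] using B R disj[of N]
            by (subst \<rho>x.finite_measure_Union) (auto simp: \<rho>x intro!: \<rho>x.finite_measure_finite_Union)
          have P_split: "P (\<Union>i. B i) = (\<Union>i\<in>{..<N}. P (B i)) \<union> P (R N)"
            unfolding split[of N] by (auto simp: P_def)
          have P_disj: "disjoint_family_on (\<lambda>i. P (B i)) {..<N}" "(\<Union>i\<in>{..<N}. P (B i)) \<inter> P (R N) = {}"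
            using disj[of N] by (auto simp: P_def disjoint_family_on_def)
          have 2: "measure (K k x) (P (\<Union>i. B i)) = (\<Sum>i<N. measure (K k x) (P (B i))) + measure (K k x) (P (R N))"
            unfolding P_split using P_sets[OF B] P_sets[OF R] P_disj
            by (subst Kx.finite_measure_Union) (auto simp: Kx intro!: Kx.finite_measure_finite_Union)
          have "\<bar>(\<Sum>i<N. measure (\<rho> x) (B i)) - (\<Sum>i<N. measure (K k x) (P (B i)))\<bar> \<le>
              (\<Sum>i<N. \<bar>measure (\<rho> x) (B i) - measure (K k x) (P (B i))\<bar>)"
            unfolding sum_subtractf[symmetric] by (rule sum_abs)
          moreover have "0 \<le> measure (\<rho> x) (R N)" "0 \<le> measure (K k x) (P (R N))" by auto
          ultimately show "\<bar>measure (\<rho> x) (\<Union>i. B i) - measure (K k x) (P (\<Union>i. B i))\<bar> \<le>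
            (\<Sum>i<N. \<bar>measure (\<rho> x) (B i) - measure (K k x) (P (B i))\<bar>)
             + measure (\<rho> x) (R N) + measure (K k x) (P (R N))"
            unfolding 1 2 by linarith
        next
          show "integrable \<mu> (\<lambda>x. \<bar>measure (\<rho> x) (\<Union>i. B i) - measure (K k x) (P (\<Union>i. B i))\<bar>)"
            using B by (intro integrable_abs Bochner_Integration.integrable_diff int_\<rho> int_K P_sets sets.countable_UN) auto
          show "integrable \<mu> (\<lambda>x. (\<Sum>i<N. \<bar>measure (\<rho> x) (B i) - measure (K k x) (P (B i))\<bar>)
             + measure (\<rho> x) (R N) + measure (K k x) (P (R N)))"
            by (intro Bochner_Integration.integrable_add Bochner_Integration.integrable_sum
              integrable_abs Bochner_Integration.integrable_diff int_\<rho> int_K P_sets B R)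
        qed
        also have "\<dots> = (\<Sum>i<N. \<integral>x. \<bar>measure (\<rho> x) (B i) - measure (K k x) (P (B i))\<bar> \<partial>\<mu>)
             + measure \<mu> (P (R N)) + measure \<mu> (P (R N))"
          using int_\<rho>[OF B] int_K[OF P_sets[OF B]] int_\<rho>[OF R] int_K[OF P_sets[OF R]]
          by (simp add: integral_\<rho>[OF R] integral_K[OF P_sets[OF R]])
        also have "\<dots> < \<epsilon>" using k0[OF that] N by linarith
        finally show ?thesis .
      qed
      then show "\<exists>k0. \<forall>k\<ge>k0. norm ((\<integral>x. \<bar>measure (\<rho> x) (\<Union>i. B i) - measure (K k x) (P (\<Union>i. B i))\<bar> \<partial>\<mu>) - 0) < \<epsilon>"
        by (intro exI[of _ k0]) simp
    qed
  qed
qed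

lemma kernel_\<pi>: "(\<lambda>x. distr (\<rho> x) M d) \<in> M \<rightarrow>\<^sub>M prob_algebra M"
  using measurable_compose[OF \<rho> measurable_distr_prob_space[OF d]] .

private abbreviation \<pi> :: "'a \<Rightarrow> 'a measure" where
  "\<pi> x \<equiv> distr (\<rho> x) M d"

private lemma L1_sets:
  assumes B: "B \<in> sets M"
  shows "(\<lambda>k. \<integral>x. \<bar>measure (\<pi> x) B - measure (K k x) B\<bar> \<partial>\<mu>) \<longlonglongrightarrow> 0"
proof -
  have dB: "d -` B \<in> sets borel" using measurable_sets[OF d B] by simp
  have "P (d -` B) = B"
    using d_e sets.sets_into_space[OF B] by (auto simp: P_def)
  moreover have "measure (\<pi> x) B = measure (\<rho> x) (d -` B)" if "x \<in> space \<mu>" for x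
  proof -
    have "\<rho> x \<in> space (prob_algebra borel)"
      using measurable_space[OF \<rho>] that by (simp add: space_\<mu>)
    note \<rho>x = prob_algebraD[OF this]
    have "d \<in> \<rho> x \<rightarrow>\<^sub>M M" using d \<rho>x(2) by (simp cong: measurable_cong_sets)
    then show ?thesis using B by (simp add: measure_distr \<rho>x(3))
  qed
  ultimately show ?thesis
    using L1_borel[OF dB] by (simp cong: Bochner_Integration.integral_cong)
qed

private lemma \<pi>_space: "x \<in> space M \<Longrightarrow> \<pi> x \<in> space (prob_algebra M)"
  using kernel_\<pi> by (rule measurable_space)

text \<open>A step function within \<open>1 / N\<close> of \<open>f\<close> reduces the claim to
  finitely many sets. Functions and not only sets are required because \<open>T m\<close> of an
  indicator is later integrated against \<open>\<pi> x\<close>.\<close>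

private lemma L1_fun:
  assumes f: "f \<in> unit_funs M"
  shows "(\<lambda>k. \<integral>x. \<bar>(\<integral>y. f y \<partial>\<pi> x) - T k f x\<bar> \<partial>\<mu>) \<longlonglongrightarrow> 0"
proof (rule LIMSEQ_I)
  fix \<epsilon> :: real assume "\<epsilon> > 0"
  obtain N0 :: nat where "4 / \<epsilon> < real N0" using reals_Archimedean2 by blast
  then have "4 / \<epsilon> < real (Suc N0)" by simp
  then obtain N :: nat where N: "4 / \<epsilon> < real N" "0 < N" by blast
  then have N': "2 / real N < \<epsilon> / 2" using \<open>\<epsilon> > 0\<close> by (simp add: field_simps)
  define C where "C i = {y \<in> space M. real i \<le> real N * f y}" for i :: nat
  note [measurable] = unit_funs_measurable[OF f]
  have C: "C i \<in> sets M" for i unfolding C_def by measurable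
  \<comment> \<open>The number of levels \<open>i\<close> reached by \<open>N * f y\<close> is its
    integer part, so \<open>s\<close> is \<open>f\<close> rounded down to a multiple of
    \<open>1 / N\<close>.\<close>
  define s where "s y = (\<Sum>i\<in>{1..N}. indicator (C i) y) / real N" for y
  have fs: "\<bar>f y - s y\<bar> \<le> 1 / real N" if y: "y \<in> space M" for y
  proof -
    define z where "z = real N * f y"
    have z: "0 \<le> z" "z \<le> real N"
      using unit_funs_nonneg[OF f y] unit_funs_le_1[OF f y] by (auto simp: z_def mult_left_le)
    then have "nat \<lfloor>z\<rfloor> \<le> N" by linarith
    have "(\<Sum>i\<in>{1..N}. indicator (C i) y :: real) = (\<Sum>i\<in>{1..N}. if real i \<le> z then 1 else 0)"
      using y by (intro sum.cong) (auto simp: C_def z_def indicator_def)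
    also have "\<dots> = real (card ({1..N} \<inter> {i. real i \<le> z}))" by (simp add: sum.If_cases)
    also have "{1..N} \<inter> {i. real i \<le> z} = {1..nat \<lfloor>z\<rfloor>}"
      using z \<open>nat \<lfloor>z\<rfloor> \<le> N\<close> by (auto simp: le_nat_iff le_floor_iff)
    finally have "real N * s y = real (nat \<lfloor>z\<rfloor>)" using N(2) by (simp add: s_def)
    then have "\<bar>real N * f y - real N * s y\<bar> \<le> 1" using z(1) unfolding z_def[symmetric] by linarith
    then have "real N * \<bar>f y - s y\<bar> \<le> 1"
      by (simp add: right_diff_distrib[symmetric] abs_mult)
    then show ?thesis using N(2) by (simp add: field_simps)
  qed
  have approx: "\<bar>(\<integral>y. f y \<partial>\<nu>) - (\<Sum>i\<in>{1..N}. measure \<nu> (C i)) / real N\<bar> \<le> 1 / real N"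
    if \<nu>: "\<nu> \<in> space (prob_algebra M)" for \<nu>
  proof -
    interpret prob_space \<nu> using \<nu> by (rule prob_algebraD)
    have int_C: "integrable \<nu> (indicat_real (C i))" for i
      by (rule integrable_unit_funs[OF \<nu> unit_funs_indicator[OF C]])
    have int_s: "integrable \<nu> s"
      unfolding s_def using int_C by (intro integrable_divide_zero Bochner_Integration.integrable_sum)
    have int_f: "integrable \<nu> f" by (rule integrable_unit_funs[OF \<nu> f])
    have "(\<integral>y. s y \<partial>\<nu>) = (\<Sum>i\<in>{1..N}. measure \<nu> (C i)) / real N"
      unfolding s_def using int_C measure_eq_integral[OF \<nu> C] by simp
    then have "\<bar>(\<integral>y. f y \<partial>\<nu>) - (\<Sum>i\<in>{1..N}. measure \<nu> (C i)) / real N\<bar> = \<bar>\<integral>y. f y - s y \<partial>\<nu>\<bar>"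
      using int_s int_f by simp
    also have "\<dots> \<le> (\<integral>y. \<bar>f y - s y\<bar> \<partial>\<nu>)" by (rule integral_abs_bound)
    also have "\<dots> \<le> (\<integral>y. 1 / real N \<partial>\<nu>)"
      using int_s int_f fs prob_algebraD(3)[OF \<nu>] by (intro integral_mono) auto
    finally show ?thesis by (simp add: prob_space)
  qed
  have "(\<lambda>k. \<Sum>i\<in>{1..N}. \<integral>x. \<bar>measure (\<pi> x) (C i) - measure (K k x) (C i)\<bar> \<partial>\<mu>) \<longlonglongrightarrow> (\<Sum>i\<in>{1..N}. 0)"
    by (intro tendsto_sum L1_sets C)
  then have "\<forall>\<^sub>F k in sequentially. (\<Sum>i\<in>{1..N}. \<integral>x. \<bar>measure (\<pi> x) (C i) - measure (K k x) (C i)\<bar> \<partial>\<mu>) < \<epsilon> / 2 * real N"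
    using \<open>\<epsilon> > 0\<close> N(2) by (intro order_tendstoD) auto
  then obtain k0 where k0: "\<And>k. k0 \<le> k \<Longrightarrow>
      (\<Sum>i\<in>{1..N}. \<integral>x. \<bar>measure (\<pi> x) (C i) - measure (K k x) (C i)\<bar> \<partial>\<mu>) < \<epsilon> / 2 * real N"
    unfolding eventually_sequentially by blast
  have "(\<integral>x. \<bar>(\<integral>y. f y \<partial>\<pi> x) - T k f x\<bar> \<partial>\<mu>) < \<epsilon>" if "k0 \<le> k" for k
  proof -
    have int: "integrable \<mu> (\<lambda>x. \<bar>measure (\<pi> x) (C i) - measure (K k x) (C i)\<bar>)" for i
      by (intro integrable_unit_funs[OF \<mu>'] unit_funs_abs_diff unit_funs_measure[OF kernel_\<pi>] KA_unit C)
    have "(\<integral>x. \<bar>(\<integral>y. f y \<partial>\<pi> x) - T k f x\<bar> \<partial>\<mu>) \<le>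
      (\<integral>x. 2 / real N + (\<Sum>i\<in>{1..N}. \<bar>measure (\<pi> x) (C i) - measure (K k x) (C i)\<bar>) / real N \<partial>\<mu>)"
    proof (rule integral_mono)
      show "integrable \<mu> (\<lambda>x. \<bar>(\<integral>y. f y \<partial>\<pi> x) - T k f x\<bar>)"
        by (intro integrable_unit_funs[OF \<mu>'] unit_funs_abs_diff unit_funs_kernel[OF kernel_\<pi>] T_unit f)
      show "integrable \<mu> (\<lambda>x. 2 / real N + (\<Sum>i\<in>{1..N}. \<bar>measure (\<pi> x) (C i) - measure (K k x) (C i)\<bar>) / real N)"
        using int by (intro Bochner_Integration.integrable_add integrable_divide_zero Bochner_Integration.integrable_sum) auto
      fix x assume "x \<in> space \<mu>"
      then have x: "x \<in> space M" by (simp add: space_\<mu>)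
      let ?a = "\<Sum>i\<in>{1..N}. measure (\<pi> x) (C i)" and ?b = "\<Sum>i\<in>{1..N}. measure (K k x) (C i)"
      have "\<bar>?a - ?b\<bar> \<le> (\<Sum>i\<in>{1..N}. \<bar>measure (\<pi> x) (C i) - measure (K k x) (C i)\<bar>)"
        unfolding sum_subtractf[symmetric] by (rule sum_abs)
      then have "\<bar>?a - ?b\<bar> / real N \<le> (\<Sum>i\<in>{1..N}. \<bar>measure (\<pi> x) (C i) - measure (K k x) (C i)\<bar>) / real N"
        by (rule divide_right_mono) simp
      moreover have "\<bar>?a / real N - ?b / real N\<bar> = \<bar>?a - ?b\<bar> / real N"
        by (simp add: diff_divide_distrib[symmetric])
      ultimately show "\<bar>(\<integral>y. f y \<partial>\<pi> x) - T k f x\<bar> \<le>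
          2 / real N + (\<Sum>i\<in>{1..N}. \<bar>measure (\<pi> x) (C i) - measure (K k x) (C i)\<bar>) / real N"
        using approx[OF \<pi>_space[OF x]] approx[OF kernel_space[OF x, of k]] unfolding T_def by linarith
    qed
    also have "\<dots> = 2 / real N + (\<Sum>i\<in>{1..N}. \<integral>x. \<bar>measure (\<pi> x) (C i) - measure (K k x) (C i)\<bar> \<partial>\<mu>) / real N"
      using int by (simp add: \<mu>.prob_space)
    also have "\<dots> < \<epsilon> / 2 + \<epsilon> / 2"
      using N' k0[OF that] N(2) by (intro add_strict_mono) (auto simp: pos_divide_less_eq)
    finally show ?thesis by simp
  qed
  then show "\<exists>k0. \<forall>k\<ge>k0. norm ((\<integral>x. \<bar>(\<integral>y. f y \<partial>\<pi> x) - T k f x\<bar> \<partial>\<mu>) - 0) < \<epsilon>"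
    by (intro exI[of _ k0]) simp
qed

lemma integral_\<pi>:
  assumes f: "f \<in> unit_funs M"
  shows "(\<integral>x. \<integral>y. f y \<partial>\<pi> x \<partial>\<mu>) = (\<integral>x. f x \<partial>\<mu>)"
proof -
  have int: "integrable \<mu> (\<lambda>x. \<integral>y. f y \<partial>\<pi> x)" "integrable \<mu> (T k f)" for k
    by (intro integrable_unit_funs[OF \<mu>'] unit_funs_kernel[OF kernel_\<pi>] T_unit f)+
  have "\<bar>(\<integral>x. \<integral>y. f y \<partial>\<pi> x \<partial>\<mu>) - (\<integral>x. f x \<partial>\<mu>)\<bar> \<le> (\<integral>x. \<bar>(\<integral>y. f y \<partial>\<pi> x) - T k f x\<bar> \<partial>\<mu>)" for k
    using integral_abs_bound[of \<mu> "\<lambda>x. (\<integral>y. f y \<partial>\<pi> x) - T k f x"] int integral_T[OF \<mu> f, of k] by simp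
  then have "\<bar>(\<integral>x. \<integral>y. f y \<partial>\<pi> x \<partial>\<mu>) - (\<integral>x. f x \<partial>\<mu>)\<bar> \<le> 0"
    using LIMSEQ_le_const[OF L1_fun[OF f]] by blast
  then show ?thesis by simp
qed

text \<open>For \<open>k \<ge> m\<close> consistency gives \<open>T k (T m f) = T k f\<close> on the
  space. The left side tends in L1(\<mu>) to the integral of \<open>T m f\<close> under
  \<open>\<pi> x\<close>, the right side to that of \<open>f\<close>; so the two integrals agree
  almost surely, for each \<open>m\<close> and each rational sublevel.\<close>

lemma AE_\<pi>_invariant: "AE x in \<mu>. \<pi> x \<in> invariant_measures M K"
proof -
  have "AE x in \<mu>. (\<integral>y. T m (indicator (sublevel (of_rat q))) y \<partial>\<pi> x) = measure (\<pi> x) (sublevel (of_rat q))" for m and q :: rat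
  proof -
    let ?f = "indicat_real (sublevel (of_rat q))"
    have f: "?f \<in> unit_funs M" by (rule unit_funs_indicator[OF sublevel_sets])
    let ?u = "\<lambda>x. \<integral>y. T m ?f y \<partial>\<pi> x" and ?v = "\<lambda>x. \<integral>y. ?f y \<partial>\<pi> x"
    have u: "?u \<in> unit_funs M" by (rule unit_funs_kernel[OF kernel_\<pi> T_unit[OF f]])
    have v: "?v \<in> unit_funs M" by (rule unit_funs_kernel[OF kernel_\<pi> f])
    have int: "integrable \<mu> (\<lambda>x. \<bar>?u x - ?v x\<bar>)"
      by (rule integrable_unit_funs[OF \<mu>' unit_funs_abs_diff[OF u v]])
    have le: "(\<integral>x. \<bar>?u x - ?v x\<bar> \<partial>\<mu>) \<le>
        (\<integral>x. \<bar>?u x - T k (T m ?f) x\<bar> \<partial>\<mu>) + (\<integral>x. \<bar>?v x - T k ?f x\<bar> \<partial>\<mu>)" if "m \<le> k" for k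
    proof -
      have int': "integrable \<mu> (\<lambda>x. \<bar>?u x - T k (T m ?f) x\<bar>)" "integrable \<mu> (\<lambda>x. \<bar>?v x - T k ?f x\<bar>)"
        by (rule integrable_unit_funs[OF \<mu>' unit_funs_abs_diff[OF u T_unit[OF T_unit[OF f]]]],
            rule integrable_unit_funs[OF \<mu>' unit_funs_abs_diff[OF v T_unit[OF f]]])
      have "(\<integral>x. \<bar>?u x - ?v x\<bar> \<partial>\<mu>) \<le> (\<integral>x. \<bar>?u x - T k (T m ?f) x\<bar> + \<bar>?v x - T k ?f x\<bar> \<partial>\<mu>)"
      proof (rule integral_mono[OF int Bochner_Integration.integrable_add[OF int']])
        fix x assume "x \<in> space \<mu>"
        then have "T k (T m ?f) x = T k ?f x" using T_T[OF that f] by (simp add: space_\<mu>)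
        then show "\<bar>?u x - ?v x\<bar> \<le> \<bar>?u x - T k (T m ?f) x\<bar> + \<bar>?v x - T k ?f x\<bar>" by linarith
      qed
      then show ?thesis using int' by simp
    qed
    have "(\<lambda>k. (\<integral>x. \<bar>?u x - T k (T m ?f) x\<bar> \<partial>\<mu>) + (\<integral>x. \<bar>?v x - T k ?f x\<bar> \<partial>\<mu>)) \<longlonglongrightarrow> 0 + 0"
      by (intro tendsto_add L1_fun f T_unit)
    then have "(\<integral>x. \<bar>?u x - ?v x\<bar> \<partial>\<mu>) \<le> 0 + 0"
      using le by (intro LIMSEQ_le_const) blast+
    then have "(\<integral>x. \<bar>?u x - ?v x\<bar> \<partial>\<mu>) = 0"
      using integral_unit_funs_nonneg[OF \<mu>' unit_funs_abs_diff[OF u v]] by linarith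
    then have "AE x in \<mu>. \<bar>?u x - ?v x\<bar> = 0"
      using integral_nonneg_eq_0_iff_AE[OF int] by simp
    with AE_space show ?thesis
    proof eventually_elim
      case (elim x)
      then have "?v x = measure (\<pi> x) (sublevel (of_rat q))"
        using \<pi>_space by (intro measure_eq_integral[OF _ sublevel_sets]) (simp add: space_\<mu>)
      then show ?case using elim(2) by simp
    qed
  qed
  then have "AE x in \<mu>. \<forall>m. \<forall>q::rat. (\<integral>y. T m (indicator (sublevel (of_rat q))) y \<partial>\<pi> x) = measure (\<pi> x) (sublevel (of_rat q))"
    by (simp add: AE_all_countable)
  with AE_space show ?thesis
  proof eventually_elim
    case (elim x)
    then show ?case using \<pi>_space by (intro invariantI) (simp_all add: space_\<mu>)
  qed
qed

text \<open>On the unit interval squaring has Lipschitz constant 2, so L1 convergence carries over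
  to second moments.\<close>

lemma tendsto_integral_T_power2:
  assumes B: "B \<in> sets M"
  shows "(\<lambda>m. \<integral>x. (T m (indicator B) x)\<^sup>2 \<partial>\<mu>) \<longlonglongrightarrow> (\<integral>x. (measure (\<pi> x) B)\<^sup>2 \<partial>\<mu>)"
proof -
  note f = unit_funs_indicator[OF B]
  let ?v = "\<lambda>x. measure (\<pi> x) B"
  have v: "?v \<in> unit_funs M" by (rule unit_funs_measure[OF kernel_\<pi> B])
  have int: "integrable \<mu> (\<lambda>x. (?v x)\<^sup>2)" "integrable \<mu> (\<lambda>x. (T m (indicator B) x)\<^sup>2)"
    "integrable \<mu> (\<lambda>x. \<bar>?v x - T m (indicator B) x\<bar>)" for m
    by (intro integrable_unit_funs[OF \<mu>'] unit_funs_power2 unit_funs_abs_diff T_unit v f)+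
  have le: "\<bar>(\<integral>x. (T m (indicator B) x)\<^sup>2 \<partial>\<mu>) - (\<integral>x. (?v x)\<^sup>2 \<partial>\<mu>)\<bar> \<le> 2 * (\<integral>x. \<bar>?v x - T m (indicator B) x\<bar> \<partial>\<mu>)" for m
  proof -
    have "\<bar>(\<integral>x. (T m (indicator B) x)\<^sup>2 \<partial>\<mu>) - (\<integral>x. (?v x)\<^sup>2 \<partial>\<mu>)\<bar> = \<bar>\<integral>x. (T m (indicator B) x)\<^sup>2 - (?v x)\<^sup>2 \<partial>\<mu>\<bar>"
      using int by simp
    also have "\<dots> \<le> (\<integral>x. \<bar>(T m (indicator B) x)\<^sup>2 - (?v x)\<^sup>2\<bar> \<partial>\<mu>)" by (rule integral_abs_bound)
    also have "\<dots> \<le> (\<integral>x. 2 * \<bar>?v x - T m (indicator B) x\<bar> \<partial>\<mu>)"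
    proof (rule integral_mono)
      fix x assume "x \<in> space \<mu>"
      then have x: "x \<in> space M" by (simp add: space_\<mu>)
      let ?t = "T m (indicator B) x"
      have "0 \<le> ?t" "?t \<le> 1" "0 \<le> ?v x" "?v x \<le> 1"
        using unit_funs_nonneg[OF T_unit[OF f] x] unit_funs_le_1[OF T_unit[OF f] x]
          unit_funs_nonneg[OF v x] unit_funs_le_1[OF v x] by auto
      moreover have "?t\<^sup>2 - (?v x)\<^sup>2 = (?t + ?v x) * (?t - ?v x)" by (simp add: power2_eq_square algebra_simps)
      ultimately show "\<bar>?t\<^sup>2 - (?v x)\<^sup>2\<bar> \<le> 2 * \<bar>?v x - ?t\<bar>"
        by (simp add: abs_mult abs_minus_commute mult_right_mono)
    qed (use int in auto)
    finally show ?thesis by simp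
  qed
  have lim: "(\<lambda>m. 2 * (\<integral>x. \<bar>?v x - T m (indicator B) x\<bar> \<partial>\<mu>)) \<longlonglongrightarrow> 2 * 0"
  proof (intro tendsto_mult_left)
    have "(\<integral>x. \<bar>?v x - T m (indicator B) x\<bar> \<partial>\<mu>) = (\<integral>x. \<bar>?v x - measure (K m x) B\<bar> \<partial>\<mu>)" for m
      using T_indicator[OF B] by (intro Bochner_Integration.integral_cong) (auto simp: space_\<mu>)
    then show "(\<lambda>m. \<integral>x. \<bar>?v x - T m (indicator B) x\<bar> \<partial>\<mu>) \<longlonglongrightarrow> 0"
      using L1_sets[OF B] by simp
  qed
  have "(\<lambda>m. (\<integral>x. (T m (indicator B) x)\<^sup>2 \<partial>\<mu>) - (\<integral>x. (?v x)\<^sup>2 \<partial>\<mu>)) \<longlonglongrightarrow> 0"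
  proof (rule Lim_null_comparison)
    show "\<forall>\<^sub>F m in sequentially. norm ((\<integral>x. (T m (indicator B) x)\<^sup>2 \<partial>\<mu>) - (\<integral>x. (?v x)\<^sup>2 \<partial>\<mu>))
        \<le> 2 * (\<integral>x. \<bar>?v x - T m (indicator B) x\<bar> \<partial>\<mu>)"
      using le by (simp only: real_norm_def eventually_True)
    show "(\<lambda>m. 2 * (\<integral>x. \<bar>?v x - T m (indicator B) x\<bar> \<partial>\<mu>)) \<longlonglongrightarrow> 0"
      using lim by simp
  qed
  then show ?thesis by (simp add: LIM_zero_iff)
qed

text \<open>Under an invariant \<open>\<pi> x\<close> the second moments decrease to a limit
  \<open>l x\<close> not below the square of the mean. Since \<mu> is the mixture of the
  \<open>\<pi> x\<close>, the gap \<open>l x - (measure (\<pi> x) B)\<^sup>2\<close> has integral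
  zero under \<mu>, hence vanishes almost surely.\<close>

lemma AE_\<pi>_tendsto:
  "AE x in \<mu>. \<forall>q::rat. (\<lambda>m. \<integral>y. (T m (indicator (sublevel (of_rat q))) y)\<^sup>2 \<partial>\<pi> x) \<longlonglongrightarrow> (measure (\<pi> x) (sublevel (of_rat q)))\<^sup>2"
proof -
  have "AE x in \<mu>. (\<lambda>m. \<integral>y. (T m (indicator B) y)\<^sup>2 \<partial>\<pi> x) \<longlonglongrightarrow> (measure (\<pi> x) B)\<^sup>2" if B: "B \<in> sets M" for B
  proof -
    note f = unit_funs_indicator[OF B]
    let ?v = "\<lambda>x. measure (\<pi> x) B"
    define h where "h m x = (\<integral>y. (T m (indicator B) y)\<^sup>2 \<partial>\<pi> x)" for m x
    define l where "l x = lim (\<lambda>m. h m x)" for x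
    have v: "?v \<in> unit_funs M" by (rule unit_funs_measure[OF kernel_\<pi> B])
    have h: "h m \<in> unit_funs M" for m
      unfolding h_def[abs_def] by (rule unit_funs_kernel[OF kernel_\<pi> unit_funs_power2[OF T_unit[OF f]]])
    have [measurable]: "h m \<in> borel_measurable \<mu>" for m by (rule unit_funs_measurable'[OF \<mu>' h])
    have [measurable]: "l \<in> borel_measurable \<mu>" unfolding l_def by measurable
    have inv: "AE x in \<mu>. (\<lambda>m. h m x) \<longlonglongrightarrow> l x \<and> (?v x)\<^sup>2 \<le> l x \<and> l x \<le> 1"
      using AE_\<pi>_invariant AE_space
    proof eventually_elim
      case (elim x)
      then have x: "x \<in> space M" by (simp add: space_\<mu>)
      have "decseq (\<lambda>m. h m x)"
        unfolding decseq_def h_def using integral_T_power2_antimono[OF elim(1) f] by blast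
      moreover have ge: "(?v x)\<^sup>2 \<le> h m x" for m
      proof -
        have "0 \<le> (\<integral>y. (T m (indicator B) y - measure (\<pi> x) B)\<^sup>2 \<partial>\<pi> x)" by simp
        then show ?thesis unfolding h_def integral_T_power2_variance[OF elim(1) B] by simp
      qed
      ultimately obtain L where "(\<lambda>m. h m x) \<longlonglongrightarrow> L" using decseq_convergent by metis
      then have lim: "(\<lambda>m. h m x) \<longlonglongrightarrow> l x" unfolding l_def by (simp add: limI)
      moreover have "(?v x)\<^sup>2 \<le> l x" using LIMSEQ_le_const[OF lim] ge by blast
      moreover have "l x \<le> 1" using LIMSEQ_le_const2[OF lim] unit_funs_le_1[OF h x] by blast
      ultimately show ?case by blast
    qed
    have int_l: "integrable \<mu> l"
    proof (rule \<mu>.integrable_const_bound[of _ 1])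
      show "AE x in \<mu>. norm (l x) \<le> 1"
        using inv
      proof eventually_elim
        case (elim x)
        moreover have "0 \<le> (?v x)\<^sup>2" by simp
        ultimately show ?case unfolding real_norm_def by linarith
      qed
    qed measurable
    have "(\<lambda>m. \<integral>x. h m x \<partial>\<mu>) \<longlonglongrightarrow> (\<integral>x. l x \<partial>\<mu>)"
    proof (rule integral_dominated_convergence[where w="\<lambda>_. 1"])
      show "AE x in \<mu>. (\<lambda>m. h m x) \<longlonglongrightarrow> l x" using inv by eventually_elim blast
      show "AE x in \<mu>. norm (h m x) \<le> 1" for m
        using h[of m] by (intro AE_I2) (auto simp: unit_funs_def space_\<mu>)
    qed auto
    moreover have "(\<integral>x. h m x \<partial>\<mu>) = (\<integral>x. (T m (indicator B) x)\<^sup>2 \<partial>\<mu>)" for m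
      unfolding h_def by (rule integral_\<pi>[OF unit_funs_power2[OF T_unit[OF f]]])
    ultimately have "(\<integral>x. l x \<partial>\<mu>) = (\<integral>x. (?v x)\<^sup>2 \<partial>\<mu>)"
      using tendsto_integral_T_power2[OF B] LIMSEQ_unique by simp
    moreover have int_v: "integrable \<mu> (\<lambda>x. (?v x)\<^sup>2)"
      by (rule integrable_unit_funs[OF \<mu>' unit_funs_power2[OF v]])
    ultimately have "(\<integral>x. l x - (?v x)\<^sup>2 \<partial>\<mu>) = 0" using int_l by simp
    moreover have "AE x in \<mu>. 0 \<le> l x - (?v x)\<^sup>2" using inv by eventually_elim simp
    ultimately have "AE x in \<mu>. l x - (?v x)\<^sup>2 = 0"
      using integral_nonneg_eq_0_iff_AE[of \<mu> "\<lambda>x. l x - (?v x)\<^sup>2"] int_l int_v by simp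
    with inv show ?thesis
    proof eventually_elim
      case (elim x)
      then have "l x = (?v x)\<^sup>2" by simp
      with elim(1) show ?case by (simp add: h_def)
    qed
  qed
  then show ?thesis by (simp add: AE_all_countable)
qed

end

end

section \<open>Extreme invariant measures\<close>

lemma (in consistent_kernels) consistent_kernels_subseq:
  assumes "strict_mono r"
  shows "consistent_kernels M (\<lambda>k. K (r k))"
  using kernel consistent strict_mono_less_eq[OF assms] by unfold_locales auto

text \<open>\<open>K m\<close> followed by \<open>K n\<close> is \<open>K m\<close>, so invariance
  passes from later to earlier kernels. A subsequence is cofinal and therefore has the same
  invariant measures.\<close>

lemma (in consistent_kernels) invariant_measures_cofinal:
  assumes "\<nu> \<in> space (prob_algebra M)" "\<nu> \<bind> K m = \<nu>" "n \<le> m"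
  shows "\<nu> \<bind> K n = \<nu>"
proof -
  have K': "K n \<in> \<nu> \<rightarrow>\<^sub>M subprob_algebra M" for n
    using measurable_prob_algebraD[OF kernel] prob_algebraD(2)[OF assms(1)] by (simp cong: measurable_cong_sets)
  have "\<nu> \<bind> K n = (\<nu> \<bind> K m) \<bind> K n" by (simp add: assms(2))
  also have "\<dots> = \<nu> \<bind> (\<lambda>x. K m x \<bind> K n)"
    by (rule bind_assoc[OF K' measurable_prob_algebraD[OF kernel]])
  also have "\<dots> = \<nu> \<bind> K m"
    using consistent[OF assms(3)] prob_algebraD(3)[OF assms(1)] by (intro bind_cong) auto
  finally show ?thesis by (simp add: assms(2))
qed

lemma (in consistent_kernels) invariant_measures_subseq:
  assumes "strict_mono r"
  shows "invariant_measures M (\<lambda>k. K (r k)) = invariant_measures M K"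
  using invariant_measures_cofinal strict_mono_imp_increasing[OF assms]
  unfolding invariant_measures_def by blast

lemma integral_dominated_measure:
  assumes \<nu>: "\<nu> \<in> space (prob_algebra M)" and \<nu>1: "\<nu>1 \<in> space (prob_algebra M)"
    and c: "0 < c" "\<And>B. B \<in> sets M \<Longrightarrow> c * measure \<nu>1 B \<le> measure \<nu> B"
    and f: "f \<in> unit_funs M"
  shows "c * (\<integral>x. f x \<partial>\<nu>1) \<le> (\<integral>x. f x \<partial>\<nu>)"
proof -
  interpret \<nu>: prob_space \<nu> by (rule prob_algebraD[OF \<nu>])
  interpret \<nu>1: prob_space \<nu>1 by (rule prob_algebraD[OF \<nu>1])
  have sets: "sets (scale_measure (ennreal c) \<nu>1) = sets \<nu>" "sets \<nu> = sets M"
    using prob_algebraD(2)[OF \<nu>] prob_algebraD(2)[OF \<nu>1] by auto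
  have "scale_measure (ennreal c) \<nu>1 \<le> \<nu>"
    using c by (simp add: le_measure[OF sets(1)] sets \<nu>.emeasure_eq_measure \<nu>1.emeasure_eq_measure
      ennreal_mult[symmetric] prob_algebraD(2)[OF \<nu>1])
  then have "(\<integral>\<^sup>+x. ennreal (f x) \<partial>scale_measure (ennreal c) \<nu>1) \<le> (\<integral>\<^sup>+x. ennreal (f x) \<partial>\<nu>)"
    by (rule nn_integral_mono_measure[OF sets(1)])
  then have "ennreal (c * (\<integral>x. f x \<partial>\<nu>1)) \<le> ennreal (\<integral>x. f x \<partial>\<nu>)"
    using c(1) unit_funs_measurable'[OF \<nu>1 f]
    by (simp add: nn_integral_scale_measure nn_integral_unit_funs[OF \<nu> f] nn_integral_unit_funs[OF \<nu>1 f] ennreal_mult')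
  then show ?thesis
    using integral_unit_funs_nonneg[OF \<nu> f] by simp
qed

context coded_kernels
begin

text \<open>Since the mean of \<open>T m\<close> of an indicator is fixed, the condition says that
  its variance tends to 0. It plays the part of triviality on the tail sigma-algebra, in a form
  given by countably many measurable functions of \<nu>.\<close>

definition ergodic_measures :: "'a measure set" where
  "ergodic_measures = {\<nu> \<in> invariant_measures M K. \<forall>q::rat.
    (\<lambda>m. \<integral>y. (T m (indicator (sublevel (of_rat q))) y)\<^sup>2 \<partial>\<nu>) \<longlonglongrightarrow> (measure \<nu> (sublevel (of_rat q)))\<^sup>2}"

text \<open>A measure dominated by \<open>\<nu> / c\<close> inherits the convergence \<open>T m 1\<^sub>B \<longlonglongrightarrow> \<nu>(B)\<close> in \<open>L\<^sup>2\<close>,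
  which determines the mass of \<open>B\<close>.\<close>

lemma ergodic_unique:
  assumes \<nu>: "\<nu> \<in> ergodic_measures" and \<nu>1: "\<nu>1 \<in> invariant_measures M K"
    and c: "0 < c" "\<And>B. B \<in> sets M \<Longrightarrow> c * measure \<nu>1 B \<le> measure \<nu> B"
  shows "\<nu>1 = \<nu>"
proof (rule prob_eqI)
  have \<nu>': "\<nu> \<in> invariant_measures M K" using \<nu> by (simp add: ergodic_measures_def)
  show \<nu>_prob: "\<nu> \<in> space (prob_algebra M)" and \<nu>1_prob: "\<nu>1 \<in> space (prob_algebra M)"
    using invariantD \<nu>' \<nu>1 by auto
  interpret \<nu>: prob_space \<nu> by (rule prob_algebraD[OF \<nu>_prob])
  interpret \<nu>1: prob_space \<nu>1 by (rule prob_algebraD[OF \<nu>1_prob])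
  fix q :: rat
  let ?B = "sublevel (of_rat q)"
  let ?a = "measure \<nu> ?B" and ?b = "measure \<nu>1 ?B"
  let ?f = "\<lambda>m. T m (indicator ?B)"
  note f = T_unit[OF unit_funs_indicator[OF sublevel_sets]]
  have bound: "(?b - ?a)\<^sup>2 \<le> ((\<integral>y. (?f m y)\<^sup>2 \<partial>\<nu>) - ?a\<^sup>2) / c" for m
  proof -
    have g: "(\<lambda>y. (?f m y - ?a)\<^sup>2) \<in> unit_funs M"
      by (intro unit_funs_diff_power2 f unit_funs_const) auto
    have int: "integrable \<nu>1 (\<lambda>y. (?f m y)\<^sup>2)" "integrable \<nu>1 (?f m)"
      by (rule integrable_unit_funs[OF \<nu>1_prob unit_funs_power2[OF f]], rule integrable_unit_funs[OF \<nu>1_prob f])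
    have "0 \<le> (\<integral>y. (?f m y - ?b)\<^sup>2 \<partial>\<nu>1)" by simp
    then have "?b\<^sup>2 \<le> (\<integral>y. (?f m y)\<^sup>2 \<partial>\<nu>1)"
      unfolding integral_T_power2_variance[OF \<nu>1 sublevel_sets] by simp
    then have "(?b - ?a)\<^sup>2 \<le> (\<integral>y. (?f m y)\<^sup>2 \<partial>\<nu>1) - 2 * ?b * ?a + ?a\<^sup>2"
      by (simp add: power2_diff)
    also have "\<dots> = (\<integral>y. (?f m y - ?a)\<^sup>2 \<partial>\<nu>1)"
      using int integral_T_indicator[OF \<nu>1 sublevel_sets] by (simp add: power2_diff \<nu>1.prob_space)
    also have "\<dots> \<le> (\<integral>y. (?f m y - ?a)\<^sup>2 \<partial>\<nu>) / c"
      using integral_dominated_measure[OF \<nu>_prob \<nu>1_prob c g] c(1) by (simp add: pos_le_divide_eq mult.commute)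
    also have "\<dots> = ((\<integral>y. (?f m y)\<^sup>2 \<partial>\<nu>) - ?a\<^sup>2) / c"
      unfolding integral_T_power2_variance[OF \<nu>' sublevel_sets] ..
    finally show ?thesis .
  qed
  have "(\<lambda>m. \<integral>y. (?f m y)\<^sup>2 \<partial>\<nu>) \<longlonglongrightarrow> ?a\<^sup>2"
    using \<nu> by (simp add: ergodic_measures_def)
  then have "(\<lambda>m. ((\<integral>y. (?f m y)\<^sup>2 \<partial>\<nu>) - ?a\<^sup>2) / c) \<longlonglongrightarrow> (?a\<^sup>2 - ?a\<^sup>2) / c"
    using c(1) by (intro tendsto_intros) auto
  then have "(?b - ?a)\<^sup>2 \<le> (?a\<^sup>2 - ?a\<^sup>2) / c"
    by (rule LIMSEQ_le_const) (use bound in blast)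
  then show "?b = ?a" by simp
qed

lemma ergodic_imp_extreme:
  assumes \<nu>: "\<nu> \<in> ergodic_measures"
  shows "\<nu> \<in> extreme_measures (invariant_measures M K)"
  unfolding extreme_measures_def
proof (intro CollectI conjI ballI allI impI)
  show \<nu>_inv: "\<nu> \<in> invariant_measures M K" using \<nu> by (simp add: ergodic_measures_def)
  fix \<nu>1 \<nu>2 t
  assume \<nu>12: "\<nu>1 \<in> invariant_measures M K" "\<nu>2 \<in> invariant_measures M K"
    and t: "0 < t \<and> t < 1 \<and> (\<forall>B\<in>sets \<nu>. measure \<nu> B = t * measure \<nu>1 B + (1 - t) * measure \<nu>2 B)"
  note sets = prob_algebraD(2)[OF invariantD(1)[OF \<nu>_inv]]
  \<comment> \<open>In a convex combination each component is dominated by the whole, \<nu>1 with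
    factor \<open>t\<close> and \<nu>2 with factor \<open>1 - t\<close>.\<close>
  show "\<nu>1 = \<nu>"
    by (rule ergodic_unique[OF \<nu> \<nu>12(1), of t]) (use t sets in auto)
  show "\<nu>2 = \<nu>"
    by (rule ergodic_unique[OF \<nu> \<nu>12(2), of "1 - t"]) (use t sets in auto)
qed

lemma coded_kernels_subseq:
  assumes "strict_mono r"
  shows "coded_kernels M (\<lambda>k. K (r k)) e d"
proof -
  interpret S: consistent_kernels M "\<lambda>k. K (r k)" using assms by (rule consistent_kernels_subseq)
  show ?thesis by unfold_locales (use e d d_e e01 in auto)
qed

text \<open>Write \<open>\<nu>\<close> as \<open>\<integral>\<pi>(x) \<nu>(dx)\<close> with almost all \<open>\<pi>(x)\<close> invariant. Conditioning on \<open>C\<close> and on its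
  complement splits \<open>\<nu>\<close> into invariant measures, so extremality forces \<open>\<pi>\<close> to be constant.\<close>

lemma extreme_imp_ergodic:
  assumes \<nu>: "\<nu> \<in> extreme_measures (invariant_measures M K)"
  shows "\<nu> \<in> ergodic_measures"
proof -
  have \<nu>_inv: "\<nu> \<in> invariant_measures M K" using \<nu> by (simp add: extreme_measures_def)
  note \<nu>_prob = invariantD(1)[OF \<nu>_inv]
  note sets_\<nu> = prob_algebraD(2)[OF \<nu>_prob] and space_\<nu> = prob_algebraD(3)[OF \<nu>_prob]
  interpret \<nu>: prob_space \<nu> by (rule prob_algebraD[OF \<nu>_prob])
  define Aj where "Aj j = sublevel (of_rat (nat_to_rat_surj j))" for j
  have Aj [measurable]: "Aj j \<in> sets M" for j by (simp add: Aj_def)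
  note f = unit_funs_indicator[OF Aj]
  have T_K: "T n (indicator (Aj j)) x = measure (K n x) (Aj j)" if "x \<in> space \<nu>" for n j x
    using that by (intro T_indicator Aj) (simp add: space_\<nu>)
  obtain r where r: "strict_mono r" "AE x in \<nu>. \<forall>j. convergent (\<lambda>k. T (r k) (indicator (Aj j)) x)"
  proof (rule AE_convergent_subsequence[of \<nu> "\<lambda>n j. T n (indicator (Aj j))" "\<lambda>n j. \<integral>x. (T n (indicator (Aj j)) x)\<^sup>2 \<partial>\<nu>"])
    show "prob_space \<nu>" by (rule \<nu>.prob_space_axioms)
    show "T n (indicator (Aj j)) \<in> borel_measurable \<nu>" for n j
      by (rule unit_funs_measurable'[OF \<nu>_prob T_unit[OF f]])
    show "T n (indicator (Aj j)) x \<in> {0..1}" if "x \<in> space \<nu>" for n j x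
      using T_unit[OF f, of n j] that by (auto simp: unit_funs_def space_\<nu>)
    show "(\<integral>x. (T n (indicator (Aj j)) x - T m (indicator (Aj j)) x)\<^sup>2 \<partial>\<nu>) =
        (\<integral>x. (T n (indicator (Aj j)) x)\<^sup>2 \<partial>\<nu>) - (\<integral>x. (T m (indicator (Aj j)) x)\<^sup>2 \<partial>\<nu>)" if "n \<le> m" for n m j
      by (rule integral_T_diff_power2[OF \<nu>_inv f that])
  qed auto
  interpret S: coded_kernels M "\<lambda>k. K (r k)" e d using r(1) by (rule coded_kernels_subseq)
  have inv_S: "invariant_measures M (\<lambda>k. K (r k)) = invariant_measures M K"
    by (rule invariant_measures_subseq[OF r(1)])
  have S_T: "S.T k g = T (r k) g" for k g by (simp add: fun_eq_iff S.T_def T_def)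
  obtain \<rho> where \<rho>: "\<rho> \<in> M \<rightarrow>\<^sub>M prob_algebra (borel :: real measure)"
    "\<And>x t. x \<in> space M \<Longrightarrow> (\<And>q::rat. convergent (\<lambda>k. measure (K (r k) x) (sublevel (of_rat q)))) \<Longrightarrow>
      measure (\<rho> x) {..t} = (INF q\<in>{q. t < of_rat q}. lim (\<lambda>k. measure (K (r k) x) (sublevel (of_rat q))))"
    by (rule limit_cdf_kernel[of "\<lambda>k. K (r k)" M M e, folded sublevel_def, OF kernel e e01]) auto
  have conv: "AE x in \<nu>. \<forall>q::rat. convergent (\<lambda>k. measure (K (r k) x) (sublevel (of_rat q)))"
    using r(2) AE_space
  proof eventually_elim
    case (elim x)
    show ?case
    proof
      fix q :: rat
      obtain j where "q = nat_to_rat_surj j" using surj_nat_to_rat_surj by (metis surjD)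
      then show "convergent (\<lambda>k. measure (K (r k) x) (sublevel (of_rat q)))"
        using elim(1)[rule_format, of j] T_K[OF elim(2)] by (simp add: Aj_def)
    qed
  qed
  have cdf: "AE x in \<nu>. \<forall>t. measure (\<rho> x) {..t} =
      (INF q\<in>{q::rat. t < of_rat q}. lim (\<lambda>k. measure (K (r k) x) (sublevel (of_rat q))))"
    using conv AE_space by eventually_elim (auto intro!: \<rho>(2) simp: space_\<nu>)
  have \<nu>_S: "\<nu> \<in> invariant_measures M (\<lambda>k. K (r k))" using \<nu>_inv by (simp add: inv_S)
  define \<pi> where "\<pi> x = distr (\<rho> x) M d" for x
  have \<pi>: "\<pi> \<in> M \<rightarrow>\<^sub>M prob_algebra M"
    and integral_\<pi>: "\<And>f. f \<in> unit_funs M \<Longrightarrow> (\<integral>x. \<integral>y. f y \<partial>\<pi> x \<partial>\<nu>) = (\<integral>x. f x \<partial>\<nu>)"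
    and inv_\<pi>: "AE x in \<nu>. \<pi> x \<in> invariant_measures M K"
    and lim_\<pi>: "\<And>B. B \<in> sets M \<Longrightarrow> (\<lambda>m. \<integral>x. (T (r m) (indicator B) x)\<^sup>2 \<partial>\<nu>) \<longlonglongrightarrow> (\<integral>x. (measure (\<pi> x) B)\<^sup>2 \<partial>\<nu>)"
    using S.kernel_\<pi>[OF \<nu>_S \<rho>(1) conv cdf] S.integral_\<pi>[OF \<nu>_S \<rho>(1) conv cdf]
      S.AE_\<pi>_invariant[OF \<nu>_S \<rho>(1) conv cdf] S.tendsto_integral_T_power2[OF \<nu>_S \<rho>(1) conv cdf]
    by (simp_all add: \<pi>_def[abs_def] inv_S S_T)
  have integral_measure_\<pi>: "(\<integral>x. measure (\<pi> x) B \<partial>\<nu>) = measure \<nu> B" if B: "B \<in> sets M" for B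
  proof -
    have "(\<integral>x. measure (\<pi> x) B \<partial>\<nu>) = (\<integral>x. \<integral>y. indicator B y \<partial>\<pi> x \<partial>\<nu>)"
      using measurable_space[OF \<pi>] B by (intro Bochner_Integration.integral_cong measure_eq_integral[symmetric]) (auto simp: space_\<nu>)
    also have "\<dots> = measure \<nu> B"
      using integral_\<pi>[OF unit_funs_indicator[OF B]] measure_eq_integral[OF \<nu>_prob B] by simp
    finally show ?thesis .
  qed
  \<comment> \<open>A mixture of the measures \<open>\<pi> x\<close> over \<open>x\<close> in
    \<open>C\<close>, weighted by \<nu>. It inherits invariance from them, whereas the conditioned
    measure itself need not be invariant.\<close>
  define \<nu>c where "\<nu>c C = uniform_measure \<nu> C \<bind> \<pi>" for C
  have uniform: "uniform_measure \<nu> C \<in> space (prob_algebra M)" if "C \<in> sets M" "measure \<nu> C > 0" for C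
    using that prob_space_uniform_measure[of \<nu> C] by (simp add: space_prob_algebra sets_\<nu> \<nu>.emeasure_eq_measure)
  have \<nu>c_inv: "\<nu>c C \<in> invariant_measures M K" if C: "C \<in> sets M" "measure \<nu> C > 0" for C
    unfolding invariant_measures_def
  proof (intro CollectI conjI allI)
    show "\<nu>c C \<in> space (prob_algebra M)"
      unfolding \<nu>c_def by (rule bind_in_prob_algebra[OF uniform[OF C] \<pi>])
    fix n
    have \<pi>': "\<pi> \<in> uniform_measure \<nu> C \<rightarrow>\<^sub>M subprob_algebra M"
      using measurable_prob_algebraD[OF \<pi>] sets_\<nu> by (simp cong: measurable_cong_sets)
    have "\<nu>c C \<bind> K n = uniform_measure \<nu> C \<bind> (\<lambda>x. \<pi> x \<bind> K n)"
      unfolding \<nu>c_def by (rule bind_assoc[OF \<pi>' measurable_prob_algebraD[OF kernel]])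
    also have "\<dots> = uniform_measure \<nu> C \<bind> \<pi>"
    proof (rule bind_cong_AE'[OF uniform[OF C] measurable_bind_prob_space[OF \<pi> kernel] \<pi>])
      show "AE x in uniform_measure \<nu> C. \<pi> x \<bind> K n = \<pi> x"
        using inv_\<pi> C by (intro AE_uniform_measureI) (auto simp: sets_\<nu> elim!: eventually_mono dest: invariantD(2))
    qed
    finally show "\<nu>c C \<bind> K n = \<nu>c C" by (simp add: \<nu>c_def)
  qed
  have \<nu>c_measure: "measure (\<nu>c C) B * measure \<nu> C = (\<integral>x. indicator C x * measure (\<pi> x) B \<partial>\<nu>)"
    if C: "C \<in> sets M" "measure \<nu> C > 0" and B: "B \<in> sets M" for C B
  proof -
    have "measure (\<nu>c C) B = (\<integral>x. measure (\<pi> x) B \<partial>uniform_measure \<nu> C)"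
      unfolding \<nu>c_def by (rule measure_bind_prob_algebra[OF uniform[OF C] \<pi> B])
    also have "\<dots> = (\<integral>x. indicator C x / measure \<nu> C * measure (\<pi> x) B \<partial>\<nu>)"
    proof -
      have [measurable]: "C \<in> sets \<nu>" using C(1) by (simp add: sets_\<nu>)
      have g: "(\<lambda>x. indicator C x / measure \<nu> C) \<in> borel_measurable \<nu>"
        by measurable
      have "uniform_measure \<nu> C = density \<nu> (\<lambda>x. ennreal (indicator C x / measure \<nu> C))"
        unfolding uniform_measure_def
      proof (rule density_cong)
        have "indicator C x / emeasure \<nu> C = ennreal (indicator C x / measure \<nu> C)" for x
          using C(2) divide_ennreal[of 1 "measure \<nu> C"]
          by (cases "x \<in> C") (simp_all add: \<nu>.emeasure_eq_measure)
        then show "AE x in \<nu>. indicator C x / emeasure \<nu> C = ennreal (indicator C x / measure \<nu> C)"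
          by simp
      qed (measurable, use g in measurable)
      moreover have "(\<lambda>x. measure (\<pi> x) B) \<in> borel_measurable \<nu>"
        by (rule unit_funs_measurable'[OF \<nu>_prob unit_funs_measure[OF \<pi> B]])
      ultimately show ?thesis
        using g by (simp add: integral_density)
    qed
    also have "\<dots> = (\<integral>x. indicator C x * measure (\<pi> x) B / measure \<nu> C \<partial>\<nu>)" by simp
    also have "\<dots> = (\<integral>x. indicator C x * measure (\<pi> x) B \<partial>\<nu>) / measure \<nu> C"
      by (rule integral_divide_zero)
    finally show ?thesis using C(2) by simp
  qed
  have const: "AE x in \<nu>. measure (\<pi> x) B = measure \<nu> B" if B: "B \<in> sets M" for B
  proof -
    let ?v = "\<lambda>x. measure (\<pi> x) B" and ?b = "measure \<nu> B"
    have v: "?v \<in> unit_funs M" by (rule unit_funs_measure[OF \<pi> B])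
    have v_int: "integrable \<nu> ?v" by (rule integrable_unit_funs[OF \<nu>_prob v])
    \<comment> \<open>The points where \<open>\<pi> x\<close> gives \<open>B\<close> more than the
      average mass. The mean of \<open>?v\<close> over \<open>C\<close> strictly exceeds
      \<open>?b\<close> unless \<open>C\<close> is null, while extremality will force it to be
      \<open>?b\<close>.\<close>
    define C where "C = {x \<in> space M. ?b < ?v x}"
    have [measurable]: "?v \<in> borel_measurable M" by (rule unit_funs_measurable[OF v])
    have C: "C \<in> sets M" unfolding C_def by measurable
    have Cv_int: "integrable \<nu> (\<lambda>x. indicator C x * ?v x)"
      by (rule integrable_unit_funs[OF \<nu>_prob unit_funs_mult[OF unit_funs_indicator[OF C] v]])
    have C_int: "integrable \<nu> (\<lambda>x. indicator C x * ?b)"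
      by (rule integrable_mult_left) (rule integrable_unit_funs[OF \<nu>_prob unit_funs_indicator[OF C]])
    have le: "AE x in \<nu>. ?v x \<le> ?b"
    proof (cases "measure \<nu> C = 0")
      case True
      then have "AE x in \<nu>. x \<notin> C"
        using C \<nu>.prob_eq_0[of C] by (simp add: sets_\<nu>)
      with AE_space show ?thesis by eventually_elim (auto simp: C_def space_\<nu>)
    next
      case False
      then have C_pos: "0 < measure \<nu> C" using measure_nonneg[of \<nu> C] by linarith
      have "measure (\<nu>c C) B = ?b"
      \<comment> \<open>If \<open>C\<close> has full mass its complement is null and cannot be
        conditioned on; the mean over \<open>C\<close> is then the full mean.\<close>
      proof (cases "measure \<nu> C = 1")
        case True
        then have "AE x in \<nu>. x \<in> C" using C \<nu>.prob_eq_1 by (simp add: sets_\<nu>)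
        then have "(\<integral>x. indicator C x * ?v x \<partial>\<nu>) = (\<integral>x. ?v x \<partial>\<nu>)"
          using Cv_int v_int by (intro integral_cong_AE) (auto elim!: eventually_mono)
        then show ?thesis using \<nu>c_measure[OF C C_pos B] True integral_measure_\<pi>[OF B] by simp
      next
        case False
        let ?D = "space M - C"
        have D: "?D \<in> sets M" using C by simp
        have D_prob: "measure \<nu> ?D = 1 - measure \<nu> C"
          using \<nu>.prob_compl[of C] C by (simp add: sets_\<nu> space_\<nu>)
        have t1: "measure \<nu> C < 1" using False \<nu>.prob_le_1[of C] by linarith
        have D_pos: "0 < measure \<nu> ?D" using t1 D_prob by simp
        have "measure \<nu> B' = measure \<nu> C * measure (\<nu>c C) B' + (1 - measure \<nu> C) * measure (\<nu>c ?D) B'"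
          if B': "B' \<in> sets \<nu>" for B'
        proof -
          have B'': "B' \<in> sets M" using B' by (simp add: sets_\<nu>)
          note w = unit_funs_measure[OF \<pi> B'']
          have "integrable \<nu> (\<lambda>x. indicator C x * measure (\<pi> x) B')" "integrable \<nu> (\<lambda>x. indicator ?D x * measure (\<pi> x) B')"
            by (rule integrable_unit_funs[OF \<nu>_prob unit_funs_mult[OF unit_funs_indicator[OF C] w]],
                rule integrable_unit_funs[OF \<nu>_prob unit_funs_mult[OF unit_funs_indicator[OF D] w]])
          then have "(\<integral>x. indicator C x * measure (\<pi> x) B' \<partial>\<nu>) + (\<integral>x. indicator ?D x * measure (\<pi> x) B' \<partial>\<nu>)
            = (\<integral>x. indicator C x * measure (\<pi> x) B' + indicator ?D x * measure (\<pi> x) B' \<partial>\<nu>)" by simp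
          also have "\<dots> = (\<integral>x. measure (\<pi> x) B' \<partial>\<nu>)"
            by (intro Bochner_Integration.integral_cong) (auto simp: indicator_def space_\<nu>)
          also have "\<dots> = measure \<nu> B'" by (rule integral_measure_\<pi>[OF B''])
          finally show ?thesis
            using \<nu>c_measure[OF C C_pos B''] \<nu>c_measure[OF D D_pos B''] D_prob by (simp add: mult.commute)
        qed
        then have "\<nu>c C = \<nu>"
          using \<nu> \<nu>c_inv[OF C C_pos] \<nu>c_inv[OF D D_pos] C_pos t1 unfolding extreme_measures_def by blast
        then show ?thesis by simp
      qed
      then have "(\<integral>x. indicator C x * ?v x \<partial>\<nu>) = ?b * measure \<nu> C"
        using \<nu>c_measure[OF C C_pos B] by simp
      then have "(\<integral>x. indicator C x * ?v x - indicator C x * ?b \<partial>\<nu>) = 0"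
        using Cv_int C_int C sets.sets_into_space[OF C] by (simp add: sets_\<nu> space_\<nu> Int_absorb2)
      moreover have "AE x in \<nu>. 0 \<le> indicator C x * ?v x - indicator C x * ?b"
        by (rule AE_I2) (auto simp: indicator_def C_def)
      ultimately have "AE x in \<nu>. indicator C x * ?v x - indicator C x * ?b = 0"
        using integral_nonneg_eq_0_iff_AE[OF Bochner_Integration.integrable_diff[OF Cv_int C_int]] by simp
      with AE_space show ?thesis
        by eventually_elim (auto simp: C_def space_\<nu> indicator_def split: if_splits)
    qed
    \<comment> \<open>The one-sided bound suffices: a function that almost surely does not exceed
      its own mean equals it almost surely.\<close>
    have "(\<integral>x. ?b - ?v x \<partial>\<nu>) = 0"
      using v_int integral_measure_\<pi>[OF B] by (simp add: \<nu>.prob_space)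
    moreover have "AE x in \<nu>. 0 \<le> ?b - ?v x" using le by eventually_elim simp
    ultimately have "AE x in \<nu>. ?b - ?v x = 0"
      using integral_nonneg_eq_0_iff_AE[of \<nu> "\<lambda>x. ?b - ?v x"] v_int by simp
    then show ?thesis by eventually_elim simp
  qed
  show ?thesis
    unfolding ergodic_measures_def
  proof (intro CollectI conjI allI \<nu>_inv)
    fix q :: rat
    let ?B = "sublevel (of_rat q)"
    let ?c = "\<lambda>m. \<integral>y. (T m (indicator ?B) y)\<^sup>2 \<partial>\<nu>"
    \<comment> \<open>The limit kernel controls the second moments along \<open>r\<close> only;
      monotonicity extends the limit to the whole sequence.\<close>
    have "decseq ?c"
      unfolding decseq_def using integral_T_power2_antimono[OF \<nu>_inv unit_funs_indicator[OF sublevel_sets]] by blast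
    moreover have "0 \<le> ?c m" for m by simp
    ultimately obtain L where L: "?c \<longlonglongrightarrow> L" using decseq_convergent by metis
    then have "(?c \<circ> r) \<longlonglongrightarrow> L" using r(1) by (rule LIMSEQ_subseq_LIMSEQ)
    moreover have "(?c \<circ> r) \<longlonglongrightarrow> (\<integral>x. (measure (\<pi> x) ?B)\<^sup>2 \<partial>\<nu>)"
      using lim_\<pi>[OF sublevel_sets] by (simp add: comp_def)
    ultimately have "L = (\<integral>x. (measure (\<pi> x) ?B)\<^sup>2 \<partial>\<nu>)" by (rule LIMSEQ_unique)
    also have "\<dots> = (\<integral>x. (measure \<nu> ?B)\<^sup>2 \<partial>\<nu>)"
      using const[OF sublevel_sets[of "of_rat q"]] unit_funs_measurable'[OF \<nu>_prob unit_funs_power2[OF unit_funs_measure[OF \<pi> sublevel_sets]]]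
      by (intro integral_cong_AE) (auto elim!: eventually_mono)
    also have "\<dots> = (measure \<nu> ?B)\<^sup>2" by (simp add: \<nu>.prob_space)
    finally show "?c \<longlonglongrightarrow> (measure \<nu> ?B)\<^sup>2" using L by simp
  qed
qed

lemma extreme_eq_ergodic: "extreme_measures (invariant_measures M K) = ergodic_measures"
  using ergodic_imp_extreme extreme_imp_ergodic by blast

section \<open>Measurability of the sets of invariant and of extreme measures\<close>

lemma measurable_integral_prob_algebra:
  assumes "f \<in> unit_funs M"
  shows "(\<lambda>\<nu>. \<integral>x. f x \<partial>\<nu>) \<in> borel_measurable (prob_algebra M)"
  unfolding prob_algebra_def
  by (rule measurable_restrict_space1[OF integral_measurable_subprob_algebra[OF unit_funs_measurable[OF assms]]])

lemma invariant_measures_eq: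
  "invariant_measures M K = {\<nu> \<in> space (prob_algebra M). \<forall>n. \<forall>q::rat.
    (\<integral>y. T n (indicator (sublevel (of_rat q))) y \<partial>\<nu>) = measure \<nu> (sublevel (of_rat q))}"
  using invariantI integral_T_indicator[OF _ sublevel_sets] invariantD(1) by blast

lemma sets_invariant_measures: "invariant_measures M K \<in> sets (prob_algebra M)"
proof -
  have [measurable]: "(\<lambda>\<nu>. \<integral>y. T n (indicator (sublevel (of_rat q))) y \<partial>\<nu>) \<in> borel_measurable (prob_algebra M)" for n and q :: rat
    by (rule measurable_integral_prob_algebra[OF T_unit[OF unit_funs_indicator[OF sublevel_sets]]])
  show ?thesis unfolding invariant_measures_eq by measurable
qed

lemma sets_ergodic_measures: "ergodic_measures \<in> sets (prob_algebra M)"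
proof -
  have [measurable]: "(\<lambda>\<nu>. \<integral>y. (T m (indicator (sublevel (of_rat q))) y)\<^sup>2 \<partial>\<nu>) \<in> borel_measurable (prob_algebra M)" for m and q :: rat
    by (rule measurable_integral_prob_algebra[OF unit_funs_power2[OF T_unit[OF unit_funs_indicator[OF sublevel_sets]]]])
  \<comment> \<open>The limit varies with \<nu>, so it is subtracted and convergence to the constant
    0 is tested.\<close>
  have "Measurable.pred (prob_algebra M) (\<lambda>\<nu>. \<forall>q::rat.
    (\<lambda>m. (\<integral>y. (T m (indicator (sublevel (of_rat q))) y)\<^sup>2 \<partial>\<nu>) - (measure \<nu> (sublevel (of_rat q)))\<^sup>2) \<longlonglongrightarrow> 0)"
    by measurable
  then have "{\<nu> \<in> space (prob_algebra M). \<forall>q::rat.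
      (\<lambda>m. (\<integral>y. (T m (indicator (sublevel (of_rat q))) y)\<^sup>2 \<partial>\<nu>) - (measure \<nu> (sublevel (of_rat q)))\<^sup>2) \<longlonglongrightarrow> 0}
    \<in> sets (prob_algebra M)" (is "?E \<in> _")
    unfolding pred_def .
  moreover have "ergodic_measures = invariant_measures M K \<inter> ?E"
    using invariantD(1) by (auto simp: ergodic_measures_def LIM_zero_iff)
  ultimately show ?thesis
    using sets_invariant_measures by simp
qed

end

section \<open>Random kernels and Gibbs specifications\<close>

text \<open>The limiting kernel has to be measurable in \<open>\<xi>\<close>, so the almost surely convergent subsequence is
  chosen once, for the measure \<open>P(d\<xi>) \<mu>(\<xi>)(dy)\<close> on the product space.\<close>

lemma random_ergodic_decomposition:
  fixes Q :: "'h \<Rightarrow> nat \<Rightarrow> 'a \<Rightarrow> 'a measure" and e :: "'a \<Rightarrow> real"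
  assumes P: "prob_space P"
    and Q: "\<And>n. (\<lambda>x. Q (fst x) n (snd x)) \<in> P \<Otimes>\<^sub>M M \<rightarrow>\<^sub>M prob_algebra M"
    and coded: "\<And>\<xi>. \<xi> \<in> space P \<Longrightarrow> coded_kernels M (Q \<xi>) e d"
    and \<mu>: "\<mu> \<in> P \<rightarrow>\<^sub>M prob_algebra M"
    and inv: "AE \<xi> in P. \<mu> \<xi> \<in> invariant_measures M (Q \<xi>)"
  obtains \<kappa> where "\<kappa> \<in> P \<rightarrow>\<^sub>M prob_algebra (prob_algebra M)"
    "AE \<xi> in P. emeasure (\<kappa> \<xi>) (invariant_measures M (Q \<xi>)) = 1"
    "AE \<xi> in P. emeasure (\<kappa> \<xi>) (extreme_measures (invariant_measures M (Q \<xi>))) = 1"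
    "AE \<xi> in P. \<forall>B\<in>sets M. (\<integral>\<^sup>+\<nu>. emeasure \<nu> B \<partial>\<kappa> \<xi>) = emeasure (\<mu> \<xi>) B"
proof -
  interpret P: prob_space P by (rule P)
  have P': "P \<in> space (prob_algebra P)" using P by (simp add: space_prob_algebra)
  \<comment> \<open>The coding maps are the same for all \<xi>; one instance of the locale at an
    arbitrary point supplies their properties.\<close>
  obtain \<xi>0 where "\<xi>0 \<in> space P" using P.not_empty by blast
  interpret coded0: coded_kernels M "Q \<xi>0" e d by (rule coded) fact
  define X where "X = P \<Otimes>\<^sub>M M"
  define A where "A t = {y \<in> space M. e y \<le> t}" for t
  have A [measurable]: "A t \<in> sets M" for t using coded0.sublevel_sets[of t] by (simp add: A_def coded0.sublevel_def)
  define Aj where "Aj j = A (of_rat (nat_to_rat_surj j))" for j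
  have Aj: "Aj j \<in> sets M" for j by (simp add: Aj_def)
  define g where "g n j x = measure (Q (fst x) n (snd x)) (Aj j)" for n j x
  have g: "g n j \<in> unit_funs X" for n j
    unfolding g_def[abs_def] X_def by (rule unit_funs_measure[OF Q Aj])
  \<comment> \<open>This is the point mass at \<xi> times \<open>\<mu> \<xi>\<close>, the fibre of
    the measure on the product space.\<close>
  define Y where "Y \<xi> = distr (\<mu> \<xi>) X (Pair \<xi>)" for \<xi>
  have Y: "Y \<in> P \<rightarrow>\<^sub>M prob_algebra X"
    unfolding Y_def[abs_def] X_def by (rule measurable_distr_prob_space2[OF \<mu>]) simp
  define Mt where "Mt = P \<bind> Y"
  have Mt: "Mt \<in> space (prob_algebra X)"
    unfolding Mt_def by (rule bind_in_prob_algebra[OF P' Y])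
  note sets_Mt = prob_algebraD(2)[OF Mt]
  have \<mu>_prob: "\<mu> \<xi> \<in> space (prob_algebra M)" if "\<xi> \<in> space P" for \<xi>
    using measurable_space[OF \<mu> that] .
  have Pair_meas: "Pair \<xi> \<in> \<mu> \<xi> \<rightarrow>\<^sub>M X" if "\<xi> \<in> space P" for \<xi>
    using measurable_Pair1'[OF that, of M] prob_algebraD(2)[OF \<mu>_prob[OF that]]
    by (simp add: X_def cong: measurable_cong_sets)
  have int_Y: "(\<integral>x. h x \<partial>Y \<xi>) = (\<integral>y. h (\<xi>, y) \<partial>\<mu> \<xi>)" if "h \<in> unit_funs X" "\<xi> \<in> space P" for h \<xi>
    unfolding Y_def by (rule integral_distr[OF Pair_meas[OF that(2)] unit_funs_measurable[OF that(1)]])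
  have int_Mt: "(\<integral>x. h x \<partial>Mt) = (\<integral>\<xi>. \<integral>x. h x \<partial>Y \<xi> \<partial>P)" if "h \<in> unit_funs X" for h
    unfolding Mt_def by (rule integral_bind_unit_funs[OF P' Y that])
  have diff: "(\<integral>x. (g n j x - g m j x)\<^sup>2 \<partial>Mt) = (\<integral>x. (g n j x)\<^sup>2 \<partial>Mt) - (\<integral>x. (g m j x)\<^sup>2 \<partial>Mt)" if "n \<le> m" for n m j
  proof -
    note u = unit_funs_diff_power2[OF g g, of n j m j]
    note g2 = unit_funs_power2[OF g]
    have int: "integrable P (\<lambda>\<xi>. \<integral>x. h x \<partial>Y \<xi>)" if "h \<in> unit_funs X" for h
      by (rule integrable_unit_funs[OF P' unit_funs_kernel[OF Y that]])
    \<comment> \<open>Invariance lives on the fibres and for almost every \<xi> only, so the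
      Pythagoras identity is proved there and then integrated over \<open>P\<close>.\<close>
    have "AE \<xi> in P. (\<integral>x. (g n j x - g m j x)\<^sup>2 \<partial>Y \<xi>) = (\<integral>x. (g n j x)\<^sup>2 \<partial>Y \<xi>) - (\<integral>x. (g m j x)\<^sup>2 \<partial>Y \<xi>)"
      using inv AE_space
    proof eventually_elim
      case (elim \<xi>)
      interpret coded_kernels M "Q \<xi>" e d by (rule coded[OF elim(2)])
      have T_g: "T n (indicator (Aj j)) y = g n j (\<xi>, y)" if "y \<in> space (\<mu> \<xi>)" for n y
        using that prob_algebraD(3)[OF \<mu>_prob[OF elim(2)]] by (simp add: g_def T_indicator Aj)
      show ?case
        unfolding int_Y[OF u elim(2)] int_Y[OF g2 elim(2)]
        using integral_T_diff_power2[OF elim(1) unit_funs_indicator[OF Aj[of j]] that] T_g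
        by (simp cong: Bochner_Integration.integral_cong)
    qed
    then have "(\<integral>\<xi>. \<integral>x. (g n j x - g m j x)\<^sup>2 \<partial>Y \<xi> \<partial>P) =
        (\<integral>\<xi>. (\<integral>x. (g n j x)\<^sup>2 \<partial>Y \<xi>) - (\<integral>x. (g m j x)\<^sup>2 \<partial>Y \<xi>) \<partial>P)"
      using int[OF u] int[OF g2[of n j]] int[OF g2[of m j]]
      by (intro integral_cong_AE borel_measurable_diff borel_measurable_integrable)
    also have "\<dots> = (\<integral>\<xi>. \<integral>x. (g n j x)\<^sup>2 \<partial>Y \<xi> \<partial>P) - (\<integral>\<xi>. \<integral>x. (g m j x)\<^sup>2 \<partial>Y \<xi> \<partial>P)"
      by (rule Bochner_Integration.integral_diff[OF int[OF g2] int[OF g2]])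
    finally show ?thesis unfolding int_Mt[OF u] int_Mt[OF g2] .
  qed
  obtain r where r: "strict_mono r" "AE x in Mt. \<forall>j. convergent (\<lambda>k. g (r k) j x)"
  proof (rule AE_convergent_subsequence[of Mt g "\<lambda>n j. \<integral>x. (g n j x)\<^sup>2 \<partial>Mt", OF prob_algebraD(1)[OF Mt] _ _ diff])
    show "g n j \<in> borel_measurable Mt" for n j by (rule unit_funs_measurable'[OF Mt g])
    show "g n j x \<in> {0..1}" if "x \<in> space Mt" for n j x
      using g[of n j] that prob_algebraD(3)[OF Mt] by (auto simp: unit_funs_def)
  qed auto
  have [measurable]: "g n j \<in> borel_measurable X" for n j by (rule unit_funs_measurable[OF g])
  \<comment> \<open>Convergence is rewritten as the Cauchy property, whose set is measurable;
    measurability is needed to split the almost sure statement over the fibres.\<close>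
  have conv_pred: "Measurable.pred X (\<lambda>x. \<forall>j. convergent (\<lambda>k. g (r k) j x))"
    unfolding Cauchy_convergent_iff[symmetric]
    by (intro pred_intros_countable) (simp add: pred_def sets_Collect_Cauchy)
  have conv: "AE \<xi> in P. AE y in \<mu> \<xi>. \<forall>j. convergent (\<lambda>k. g (r k) j (\<xi>, y))"
  proof -
    have "AE \<xi> in P. AE x in Y \<xi>. \<forall>j. convergent (\<lambda>k. g (r k) j x)"
      using r(2) unfolding Mt_def by (subst (asm) AE_bind[OF measurable_prob_algebraD[OF Y] conv_pred])
    with AE_space show ?thesis
    proof eventually_elim
      case (elim \<xi>)
      then show ?case
        unfolding Y_def using conv_pred by (subst (asm) AE_distr_iff[OF Pair_meas]) (auto simp: pred_def)
    qed
  qed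
  have Qr: "(\<lambda>x. Q (fst x) (r k) (snd x)) \<in> X \<rightarrow>\<^sub>M prob_algebra M" for k
    unfolding X_def by (rule Q)
  obtain \<rho> where \<rho>: "\<rho> \<in> X \<rightarrow>\<^sub>M prob_algebra (borel :: real measure)"
    "\<And>x t. x \<in> space X \<Longrightarrow> (\<And>q::rat. convergent (\<lambda>k. measure (Q (fst x) (r k) (snd x)) (A (of_rat q)))) \<Longrightarrow>
      measure (\<rho> x) {..t} = (INF q\<in>{q. t < of_rat q}. lim (\<lambda>k. measure (Q (fst x) (r k) (snd x)) (A (of_rat q))))"
    by (rule limit_cdf_kernel[of "\<lambda>k x. Q (fst x) (r k) (snd x)" X M e, folded A_def, OF Qr coded0.e coded0.e01]) auto
  define \<pi> where "\<pi> x = distr (\<rho> x) M d" for x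
  have \<pi>: "\<pi> \<in> X \<rightarrow>\<^sub>M prob_algebra M"
    unfolding \<pi>_def[abs_def] using measurable_compose[OF \<rho>(1) measurable_distr_prob_space[OF coded0.d]] .
  define \<kappa> where "\<kappa> \<xi> = distr (\<mu> \<xi>) (prob_algebra M) (\<lambda>y. \<pi> (\<xi>, y))" for \<xi>
  have \<kappa>: "\<kappa> \<in> P \<rightarrow>\<^sub>M prob_algebra (prob_algebra M)"
    unfolding \<kappa>_def[abs_def]
    by (rule measurable_distr_prob_space2[OF \<mu>]) (use \<pi> in \<open>simp add: X_def\<close>)
  have main: "AE \<xi> in P. emeasure (\<kappa> \<xi>) (invariant_measures M (Q \<xi>)) = 1 \<and>
    emeasure (\<kappa> \<xi>) (extreme_measures (invariant_measures M (Q \<xi>))) = 1 \<and>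
    (\<forall>B\<in>sets M. (\<integral>\<^sup>+\<nu>. emeasure \<nu> B \<partial>\<kappa> \<xi>) = emeasure (\<mu> \<xi>) B)"
    using inv conv AE_space
  proof eventually_elim
    case (elim \<xi>)
    note \<xi> = elim(3)
    note \<mu>\<xi> = \<mu>_prob[OF \<xi>]
    note sets_\<mu> = prob_algebraD(2)[OF \<mu>\<xi>] and space_\<mu> = prob_algebraD(3)[OF \<mu>\<xi>]
    interpret \<mu>: prob_space "\<mu> \<xi>" by (rule prob_algebraD[OF \<mu>\<xi>])
    interpret K: coded_kernels M "Q \<xi>" e d by (rule coded[OF \<xi>])
    interpret S: coded_kernels M "\<lambda>k. Q \<xi> (r k)" e d by (rule K.coded_kernels_subseq[OF r(1)])
    have inv_S: "invariant_measures M (\<lambda>k. Q \<xi> (r k)) = invariant_measures M (Q \<xi>)"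
      by (rule K.invariant_measures_subseq[OF r(1)])
    have S_A: "S.sublevel t = A t" for t by (simp add: S.sublevel_def A_def)
    have X_pair: "(\<xi>, y) \<in> space X" if "y \<in> space M" for y
      using that \<xi> by (simp add: X_def space_pair_measure)
    have conv\<xi>: "AE y in \<mu> \<xi>. \<forall>q::rat. convergent (\<lambda>k. measure (Q \<xi> (r k) y) (A (of_rat q)))"
      using elim(2)
    proof eventually_elim
      case (elim y)
      show ?case
      proof
        fix q :: rat
        obtain j where "q = nat_to_rat_surj j" using surj_nat_to_rat_surj by (metis surjD)
        then show "convergent (\<lambda>k. measure (Q \<xi> (r k) y) (A (of_rat q)))"
          using elim[rule_format, of j] by (simp add: g_def Aj_def)
      qed
    qed
    have cdf\<xi>: "AE y in \<mu> \<xi>. \<forall>t. measure (\<rho> (\<xi>, y)) {..t} =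
        (INF q\<in>{q::rat. t < of_rat q}. lim (\<lambda>k. measure (Q \<xi> (r k) y) (A (of_rat q))))"
      using conv\<xi> AE_space
    proof eventually_elim
      case (elim y)
      then show ?case using \<rho>(2)[OF X_pair, of y] by (simp add: space_\<mu>)
    qed
    have \<rho>\<xi>: "(\<lambda>y. \<rho> (\<xi>, y)) \<in> M \<rightarrow>\<^sub>M prob_algebra borel"
      using measurable_compose[OF measurable_Pair1'[OF \<xi>, of M]] \<rho>(1) by (simp add: X_def)
    have \<mu>_S: "\<mu> \<xi> \<in> invariant_measures M (\<lambda>k. Q \<xi> (r k))" using elim(1) by (simp add: inv_S)
    note facts = \<mu>_S \<rho>\<xi> conv\<xi>[folded S_A] cdf\<xi>[folded S_A]
    have \<pi>\<xi>: "(\<lambda>y. \<pi> (\<xi>, y)) \<in> M \<rightarrow>\<^sub>M prob_algebra M"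
      and integral_\<pi>: "\<And>f. f \<in> unit_funs M \<Longrightarrow> (\<integral>y. \<integral>z. f z \<partial>\<pi> (\<xi>, y) \<partial>\<mu> \<xi>) = (\<integral>y. f y \<partial>\<mu> \<xi>)"
      and inv_\<pi>: "AE y in \<mu> \<xi>. \<pi> (\<xi>, y) \<in> invariant_measures M (Q \<xi>)"
      using S.kernel_\<pi>[OF facts] S.integral_\<pi>[OF facts] S.AE_\<pi>_invariant[OF facts]
      by (simp_all add: \<pi>_def inv_S)
    have erg_\<pi>: "AE y in \<mu> \<xi>. \<pi> (\<xi>, y) \<in> S.ergodic_measures"
      using inv_\<pi> S.AE_\<pi>_tendsto[OF facts]
      by eventually_elim (simp add: S.ergodic_measures_def inv_S \<pi>_def)
    \<comment> \<open>The criterion is stated for the subsequence. It meets the full sequence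
      through extremality: both have the same invariant measures, hence the same extreme
      ones.\<close>
    have ergodic: "extreme_measures (invariant_measures M (Q \<xi>)) = S.ergodic_measures"
      using S.extreme_eq_ergodic by (simp add: inv_S)
    have \<pi>\<mu>: "(\<lambda>y. \<pi> (\<xi>, y)) \<in> \<mu> \<xi> \<rightarrow>\<^sub>M prob_algebra M"
      using \<pi>\<xi> sets_\<mu> by (simp cong: measurable_cong_sets)
    \<comment> \<open>Almost sure membership yields mass one because \<open>G\<close> is measurable;
      for the extreme measures this is supplied by the countable criterion.\<close>
    have one: "emeasure (\<kappa> \<xi>) G = 1" if G: "G \<in> sets (prob_algebra M)" "AE y in \<mu> \<xi>. \<pi> (\<xi>, y) \<in> G" for G
    proof -
      have "emeasure (\<kappa> \<xi>) G = emeasure (\<mu> \<xi>) ((\<lambda>y. \<pi> (\<xi>, y)) -` G \<inter> space (\<mu> \<xi>))"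
        unfolding \<kappa>_def by (rule emeasure_distr[OF \<pi>\<mu> G(1)])
      also have "\<dots> = 1"
      proof (rule \<mu>.emeasure_eq_1_AE)
        show "(\<lambda>y. \<pi> (\<xi>, y)) -` G \<inter> space (\<mu> \<xi>) \<in> sets (\<mu> \<xi>)" by (rule measurable_sets[OF \<pi>\<mu> G(1)])
        show "AE y in \<mu> \<xi>. y \<in> (\<lambda>y. \<pi> (\<xi>, y)) -` G \<inter> space (\<mu> \<xi>)" using G(2) AE_space by eventually_elim simp
      qed
      finally show ?thesis .
    qed
    show ?case
    proof (intro conjI ballI)
      show "emeasure (\<kappa> \<xi>) (invariant_measures M (Q \<xi>)) = 1"
        using K.sets_invariant_measures inv_\<pi> by (rule one)
      show "emeasure (\<kappa> \<xi>) (extreme_measures (invariant_measures M (Q \<xi>))) = 1"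
        unfolding ergodic using S.sets_ergodic_measures erg_\<pi> by (rule one)
      fix B assume B: "B \<in> sets M"
      have "(\<lambda>\<nu>. emeasure \<nu> B) \<in> borel_measurable (prob_algebra M)"
        unfolding prob_algebra_def
        by (intro measurable_restrict_space1 measurable_emeasure_subprob_algebra B)
      then have "(\<integral>\<^sup>+\<nu>. emeasure \<nu> B \<partial>\<kappa> \<xi>) = (\<integral>\<^sup>+y. emeasure (\<pi> (\<xi>, y)) B \<partial>\<mu> \<xi>)"
        unfolding \<kappa>_def by (intro nn_integral_distr[OF \<pi>\<mu>]) simp
      also have "\<dots> = (\<integral>\<^sup>+y. ennreal (\<integral>z. indicator B z \<partial>\<pi> (\<xi>, y)) \<partial>\<mu> \<xi>)"
      proof (rule nn_integral_cong)
        fix y assume "y \<in> space (\<mu> \<xi>)"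
        then have y: "\<pi> (\<xi>, y) \<in> space (prob_algebra M)" using measurable_space[OF \<pi>\<mu>] by blast
        interpret prob_space "\<pi> (\<xi>, y)" by (rule prob_algebraD[OF y])
        show "emeasure (\<pi> (\<xi>, y)) B = ennreal (\<integral>z. indicator B z \<partial>\<pi> (\<xi>, y))"
          by (simp only: emeasure_eq_measure measure_eq_integral[OF y B])
      qed
      also have "\<dots> = ennreal (\<integral>y. \<integral>z. indicator B z \<partial>\<pi> (\<xi>, y) \<partial>\<mu> \<xi>)"
        by (rule nn_integral_unit_funs[OF \<mu>\<xi> unit_funs_kernel[OF \<pi>\<xi> unit_funs_indicator[OF B]]])
      also have "\<dots> = emeasure (\<mu> \<xi>) B"
        by (simp only: integral_\<pi>[OF unit_funs_indicator[OF B]] measure_eq_integral[OF \<mu>\<xi> B] \<mu>.emeasure_eq_measure)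
      finally show "(\<integral>\<^sup>+\<nu>. emeasure \<nu> B \<partial>\<kappa> \<xi>) = emeasure (\<mu> \<xi>) B" .
    qed
  qed
  show thesis
    by (rule that[OF \<kappa>]) (use main in \<open>eventually_elim; blast\<close>)+
qed

section \<open>Gibbs specifications as consistent families, and the barycenter of a
  metastate\<close>

lemma barycenter_eq_bind:
  assumes K: "K \<in> space (prob_algebra (prob_algebra M))"
  shows "barycenter M K = K \<bind> (\<lambda>\<nu>. \<nu>)"
proof (rule measure_eqI)
  have id: "(\<lambda>\<nu>. \<nu>) \<in> prob_algebra M \<rightarrow>\<^sub>M prob_algebra M" by simp
  show "sets (barycenter M K) = sets (K \<bind> (\<lambda>\<nu>. \<nu>))"
    by (simp add: sets_bind'[OF K id])
  show "emeasure (barycenter M K) B = emeasure (K \<bind> (\<lambda>\<nu>. \<nu>)) B" if "B \<in> sets (barycenter M K)" for B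
    using that by (simp add: emeasure_barycenter[OF K] emeasure_bind_prob_algebra[OF K id])
qed

lemma gibbs_specification_bind:
  assumes "gibbs_specification S E \<gamma>" "finite \<Lambda>" "\<Lambda> \<subseteq> S" "\<Delta> \<subseteq> \<Lambda>" "\<omega> \<in> space (config_space S E)"
  shows "\<gamma> \<Lambda> \<omega> \<bind> \<gamma> \<Delta> = \<gamma> \<Lambda> \<omega>"
proof (rule measure_eqI)
  have \<Delta>: "\<gamma> \<Delta> \<in> config_space S E \<rightarrow>\<^sub>M prob_algebra (config_space S E)"
    and \<Lambda>: "\<gamma> \<Lambda> \<in> config_space S E \<rightarrow>\<^sub>M prob_algebra (config_space S E)"
    and eq: "\<forall>A\<in>sets (config_space S E). (\<integral>\<^sup>+\<sigma>. emeasure (\<gamma> \<Delta> \<sigma>) A \<partial>(\<gamma> \<Lambda> \<omega>)) = emeasure (\<gamma> \<Lambda> \<omega>) A"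
    using assms finite_subset[OF assms(4,2)] unfolding gibbs_specification_def by auto
  have \<Lambda>\<omega>: "\<gamma> \<Lambda> \<omega> \<in> space (prob_algebra (config_space S E))" using \<Lambda> assms(5) by (rule measurable_space)
  show sets: "sets (\<gamma> \<Lambda> \<omega> \<bind> \<gamma> \<Delta>) = sets (\<gamma> \<Lambda> \<omega>)"
    using sets_bind'[OF \<Lambda>\<omega> \<Delta>] prob_algebraD(2)[OF \<Lambda>\<omega>] by simp
  show "emeasure (\<gamma> \<Lambda> \<omega> \<bind> \<gamma> \<Delta>) A = emeasure (\<gamma> \<Lambda> \<omega>) A" if "A \<in> sets (\<gamma> \<Lambda> \<omega> \<bind> \<gamma> \<Delta>)" for A
    using that eq emeasure_bind_prob_algebra[OF \<Lambda>\<omega> \<Delta>] prob_algebraD(2)[OF \<Lambda>\<omega>] sets by simp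
qed

lemma gibbs_measures_iff_bind:
  assumes "gibbs_specification S E \<gamma>" and \<mu>: "\<mu> \<in> space (prob_algebra (config_space S E))"
  shows "\<mu> \<in> gibbs_measures S E \<gamma> \<longleftrightarrow> (\<forall>\<Lambda>. finite \<Lambda> \<and> \<Lambda> \<subseteq> S \<longrightarrow> \<mu> \<bind> \<gamma> \<Lambda> = \<mu>)"
proof -
  have "(\<mu> \<bind> \<gamma> \<Lambda> = \<mu>) \<longleftrightarrow> (\<forall>A\<in>sets (config_space S E). (\<integral>\<^sup>+\<omega>. emeasure (\<gamma> \<Lambda> \<omega>) A \<partial>\<mu>) = emeasure \<mu> A)"
    if "finite \<Lambda>" "\<Lambda> \<subseteq> S" for \<Lambda>
  proof -
    have \<Lambda>: "\<gamma> \<Lambda> \<in> config_space S E \<rightarrow>\<^sub>M prob_algebra (config_space S E)"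
      using assms that unfolding gibbs_specification_def by auto
    note sets = sets_bind'[OF \<mu> \<Lambda>] prob_algebraD(2)[OF \<mu>]
    show ?thesis
      using emeasure_bind_prob_algebra[OF \<mu> \<Lambda>] sets by (auto intro!: measure_eqI)
  qed
  then show ?thesis using \<mu> by (simp add: gibbs_measures_def)
qed

theorem corollary2p3:
  fixes S :: "'s set" and E :: "'e measure" and P :: "'h measure"
    and \<gamma> :: "'h \<Rightarrow> 's set \<Rightarrow> ('s \<Rightarrow> 'e) \<Rightarrow> ('s \<Rightarrow> 'e) measure"
    and \<kappa> :: "'h \<Rightarrow> ('s \<Rightarrow> 'e) measure measure"
  assumes "countable S"
    and "standard_borel_space E"
    and "prob_space P"
    and "random_specification P S E \<gamma>"
    and "AE \<xi> in P. gibbs_measures S E (\<gamma> \<xi>) \<noteq> {}"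
    and "metastate P S E \<gamma> \<kappa>"
  shows "\<exists>\<kappa>ex. metastate P S E \<gamma> \<kappa>ex \<and>
    (AE \<xi> in P. barycenter (config_space S E) (\<kappa>ex \<xi>) = barycenter (config_space S E) (\<kappa> \<xi>)) \<and>
    (AE \<xi> in P. emeasure (\<kappa>ex \<xi>) (extreme_measures (gibbs_measures S E (\<gamma> \<xi>))) = 1)"
proof -
  interpret P: prob_space P by fact
  let ?M = "config_space S E"
  have spec: "gibbs_specification S E (\<gamma> \<xi>)" if "\<xi> \<in> space P" for \<xi>
    using assms(4) that by (simp add: random_specification_def)
  have \<kappa>: "\<kappa> \<in> P \<rightarrow>\<^sub>M prob_algebra (prob_algebra ?M)"
    and \<kappa>_G: "AE \<xi> in P. emeasure (\<kappa> \<xi>) (gibbs_measures S E (\<gamma> \<xi>)) = 1"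
    using assms(6) by (auto simp: metastate_def)
  \<comment> \<open>A Gibbs measure exists for almost every \<xi> and, as a probability measure,
    needs a point in the space; so does the construction of the coding maps.\<close>
  have "space ?M \<noteq> {}"
  proof
    assume empty: "space ?M = {}"
    have "space (prob_algebra ?M) = {}"
      using prob_algebraD(1,3)[of _ ?M] prob_space.not_empty empty by blast
    then have "gibbs_measures S E (\<gamma> \<xi>) = {}" for \<xi> by (simp add: gibbs_measures_def)
    then show False using assms(5) by simp
  qed
  then obtain e :: "('s \<Rightarrow> 'e) \<Rightarrow> real" and d where e: "e \<in> borel_measurable ?M" and d: "d \<in> borel \<rightarrow>\<^sub>M ?M"
    and e01: "\<And>\<omega>. \<omega> \<in> space ?M \<Longrightarrow> e \<omega> \<in> {0..1}" and d_e: "\<And>\<omega>. \<omega> \<in> space ?M \<Longrightarrow> d (e \<omega>) = \<omega>"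
    by (rule config_space_real_retract[OF assms(1,2)]) blast
  \<comment> \<open>An exhaustion by finite volumes along a numbering of \<open>S\<close>; it is
    increasing, and constant from some index on if \<open>S\<close> is finite.\<close>
  define \<Lambda> where "\<Lambda> n = {s \<in> S. to_nat_on S s < n}" for n
  have \<Lambda>: "finite (\<Lambda> n)" "\<Lambda> n \<subseteq> S" for n
  proof -
    have "inj_on (to_nat_on S) (\<Lambda> n)"
      using inj_on_to_nat_on[OF assms(1)] by (rule inj_on_subset) (auto simp: \<Lambda>_def)
    then show "finite (\<Lambda> n)" by (rule inj_on_finite[of _ _ "{..<n}"]) (auto simp: \<Lambda>_def)
    show "\<Lambda> n \<subseteq> S" by (auto simp: \<Lambda>_def)
  qed
  have \<Lambda>_mono: "\<Lambda> n \<subseteq> \<Lambda> m" if "n \<le> m" for n m using that by (auto simp: \<Lambda>_def)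
  have \<Lambda>_cofinal: "\<exists>n. \<Delta> \<subseteq> \<Lambda> n" if "finite \<Delta>" "\<Delta> \<subseteq> S" for \<Delta>
  proof -
    \<comment> \<open>\<open>Suc\<close> compensates the strict inequality in the definition of
      \<open>\<Lambda> n\<close>; for empty \<Delta> the inclusion holds whatever \<open>Max\<close>
      returns.\<close>
    have "\<Delta> \<subseteq> \<Lambda> (Suc (Max (to_nat_on S ` \<Delta>)))"
      using that by (auto simp: \<Lambda>_def less_Suc_eq_le)
    then show ?thesis ..
  qed
  define Q where "Q \<xi> n = \<gamma> \<xi> (\<Lambda> n)" for \<xi> n
  have kernel: "\<gamma> \<xi> \<Delta> \<in> ?M \<rightarrow>\<^sub>M prob_algebra ?M" if "\<xi> \<in> space P" "finite \<Delta>" "\<Delta> \<subseteq> S" for \<xi> \<Delta>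
    using spec that by (auto simp: gibbs_specification_def)
  \<comment> \<open>A random specification is jointly measurable set by set; this is assembled into
    measurability as a map into the space of probability measures.\<close>
  have Q_meas: "(\<lambda>x. Q (fst x) n (snd x)) \<in> P \<Otimes>\<^sub>M ?M \<rightarrow>\<^sub>M prob_algebra ?M" for n
  proof (rule measurable_prob_algebraI)
    have Qx: "Q (fst x) n (snd x) \<in> space (prob_algebra ?M)" if "x \<in> space (P \<Otimes>\<^sub>M ?M)" for x
      using that kernel[OF _ \<Lambda>] by (auto simp: Q_def space_pair_measure intro: measurable_space)
    then show prob: "prob_space (Q (fst x) n (snd x))" if "x \<in> space (P \<Otimes>\<^sub>M ?M)" for x
      using that prob_algebraD(1) by blast
    show "(\<lambda>x. Q (fst x) n (snd x)) \<in> P \<Otimes>\<^sub>M ?M \<rightarrow>\<^sub>M subprob_algebra ?M"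
    proof (rule measurable_subprob_algebra)
      show "subprob_space (Q (fst x) n (snd x))" if "x \<in> space (P \<Otimes>\<^sub>M ?M)" for x
        using prob[OF that] by (rule prob_space_imp_subprob_space)
      show "sets (Q (fst x) n (snd x)) = sets ?M" if "x \<in> space (P \<Otimes>\<^sub>M ?M)" for x
        using Qx[OF that] by (rule prob_algebraD)
      fix A assume "A \<in> sets ?M"
      then have "(\<lambda>x. measure (Q (fst x) n (snd x)) A) \<in> borel_measurable (P \<Otimes>\<^sub>M ?M)"
        using assms(4) \<Lambda>[of n] by (simp add: random_specification_def Q_def case_prod_unfold)
      then have "(\<lambda>x. ennreal (measure (Q (fst x) n (snd x)) A)) \<in> borel_measurable (P \<Otimes>\<^sub>M ?M)"
        by simp
      also have "?this \<longleftrightarrow> (\<lambda>x. emeasure (Q (fst x) n (snd x)) A) \<in> borel_measurable (P \<Otimes>\<^sub>M ?M)"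
      proof (rule measurable_cong)
        fix x assume "x \<in> space (P \<Otimes>\<^sub>M ?M)"
        then interpret prob_space "Q (fst x) n (snd x)" by (rule prob)
        show "ennreal (measure (Q (fst x) n (snd x)) A) = emeasure (Q (fst x) n (snd x)) A"
          by (simp add: emeasure_eq_measure)
      qed
      finally show "(\<lambda>x. emeasure (Q (fst x) n (snd x)) A) \<in> borel_measurable (P \<Otimes>\<^sub>M ?M)" .
    qed
  qed
  have coded: "coded_kernels ?M (Q \<xi>) e d" if \<xi>: "\<xi> \<in> space P" for \<xi>
  proof
    show "Q \<xi> n \<in> ?M \<rightarrow>\<^sub>M prob_algebra ?M" for n
      unfolding Q_def by (rule kernel[OF \<xi> \<Lambda>])
    show "Q \<xi> m \<omega> \<bind> Q \<xi> n = Q \<xi> m \<omega>" if "n \<le> m" "\<omega> \<in> space ?M" for n m \<omega>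
      unfolding Q_def by (rule gibbs_specification_bind[OF spec[OF \<xi>] \<Lambda> \<Lambda>_mono[OF that(1)] that(2)])
  qed (use e d e01 d_e in auto)
  have inv_eq: "invariant_measures ?M (Q \<xi>) = gibbs_measures S E (\<gamma> \<xi>)" if \<xi>: "\<xi> \<in> space P" for \<xi>
  proof -
    have "\<nu> \<in> invariant_measures ?M (Q \<xi>) \<longleftrightarrow> \<nu> \<in> gibbs_measures S E (\<gamma> \<xi>)"
      if \<nu>: "\<nu> \<in> space (prob_algebra ?M)" for \<nu>
    proof -
      \<comment> \<open>The inclusion into the Gibbs measures is the one with content: \<Delta> lies
        in some \<open>\<Lambda> n\<close>, and \<open>Q \<xi> n\<close> followed by
        \<open>\<gamma> \<xi> \<Delta>\<close> is again \<open>Q \<xi> n\<close> by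
        consistency.\<close>
      have "\<nu> \<bind> \<gamma> \<xi> \<Delta> = \<nu>" if "\<forall>n. \<nu> \<bind> Q \<xi> n = \<nu>" and \<Delta>: "finite \<Delta>" "\<Delta> \<subseteq> S" for \<Delta>
      proof -
        obtain n where n: "\<Delta> \<subseteq> \<Lambda> n" using \<Lambda>_cofinal[OF \<Delta>] by blast
        have Q': "Q \<xi> n \<in> \<nu> \<rightarrow>\<^sub>M subprob_algebra ?M"
          using measurable_prob_algebraD[OF kernel[OF \<xi> \<Lambda>]] prob_algebraD(2)[OF \<nu>]
          by (simp add: Q_def cong: measurable_cong_sets)
        have "\<nu> \<bind> \<gamma> \<xi> \<Delta> = (\<nu> \<bind> Q \<xi> n) \<bind> \<gamma> \<xi> \<Delta>" using that(1) by simp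
        also have "\<dots> = \<nu> \<bind> (\<lambda>\<omega>. Q \<xi> n \<omega> \<bind> \<gamma> \<xi> \<Delta>)"
          by (rule bind_assoc[OF Q' measurable_prob_algebraD[OF kernel[OF \<xi> \<Delta>]]])
        also have "\<dots> = \<nu> \<bind> Q \<xi> n"
          using gibbs_specification_bind[OF spec[OF \<xi>] \<Lambda> n] prob_algebraD(3)[OF \<nu>]
          by (intro bind_cong) (auto simp: Q_def)
        finally show ?thesis using that(1) by simp
      qed
      then show ?thesis
        using \<nu> \<Lambda> by (auto simp: invariant_measures_def gibbs_measures_iff_bind[OF spec[OF \<xi>] \<nu>] Q_def)
    qed
    then show ?thesis by (auto simp: invariant_measures_def gibbs_measures_def)
  qed
  \<comment> \<open>The barycenter as a bind: in this form measurability in \<xi> is immediate, and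
    associativity shows that a mixture of Gibbs measures is Gibbs.\<close>
  define \<mu> where "\<mu> \<xi> = \<kappa> \<xi> \<bind> (\<lambda>\<nu>. \<nu>)" for \<xi>
  have id: "(\<lambda>\<nu>. \<nu>) \<in> prob_algebra ?M \<rightarrow>\<^sub>M prob_algebra ?M" by simp
  have \<mu>: "\<mu> \<in> P \<rightarrow>\<^sub>M prob_algebra ?M"
    unfolding \<mu>_def[abs_def] by (rule measurable_bind_prob_space[OF \<kappa> id])
  have \<mu>_inv: "AE \<xi> in P. \<mu> \<xi> \<in> invariant_measures ?M (Q \<xi>)"
    using \<kappa>_G AE_space
  proof eventually_elim
    case (elim \<xi>)
    have \<kappa>\<xi>: "\<kappa> \<xi> \<in> space (prob_algebra (prob_algebra ?M))" using \<kappa> elim(2) by (rule measurable_space)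
    interpret \<kappa>: prob_space "\<kappa> \<xi>" by (rule prob_algebraD[OF \<kappa>\<xi>])
    have "\<kappa>.prob (gibbs_measures S E (\<gamma> \<xi>)) = 1" using elim(1) by (simp add: measure_def)
    then have G: "AE \<nu> in \<kappa> \<xi>. \<nu> \<in> gibbs_measures S E (\<gamma> \<xi>)" by (rule \<kappa>.AE_prob_1)
    show ?case
      unfolding invariant_measures_def
    proof (intro CollectI conjI allI)
      show "\<mu> \<xi> \<in> space (prob_algebra ?M)" using \<mu> elim(2) by (rule measurable_space)
      fix n
      have Q_\<xi>: "Q \<xi> n \<in> ?M \<rightarrow>\<^sub>M prob_algebra ?M" unfolding Q_def by (rule kernel[OF elim(2) \<Lambda>])
      have id': "(\<lambda>\<nu>. \<nu>) \<in> \<kappa> \<xi> \<rightarrow>\<^sub>M subprob_algebra ?M"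
        using measurable_prob_algebraD[OF id] prob_algebraD(2)[OF \<kappa>\<xi>] by (simp cong: measurable_cong_sets)
      have "\<mu> \<xi> \<bind> Q \<xi> n = \<kappa> \<xi> \<bind> (\<lambda>\<nu>. \<nu> \<bind> Q \<xi> n)"
        unfolding \<mu>_def by (rule bind_assoc[OF id' measurable_prob_algebraD[OF Q_\<xi>]])
      also have "\<dots> = \<kappa> \<xi> \<bind> (\<lambda>\<nu>. \<nu>)"
      proof (rule bind_cong_AE'[OF \<kappa>\<xi> measurable_bind_prob_space[OF id Q_\<xi>] id])
        show "AE \<nu> in \<kappa> \<xi>. \<nu> \<bind> Q \<xi> n = \<nu>"
          using G by eventually_elim (simp add: inv_eq[OF elim(2), symmetric] invariant_measures_def)
      qed
      finally show "\<mu> \<xi> \<bind> Q \<xi> n = \<mu> \<xi>" by (simp add: \<mu>_def)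
    qed
  qed
  obtain \<kappa>ex where \<kappa>ex: "\<kappa>ex \<in> P \<rightarrow>\<^sub>M prob_algebra (prob_algebra ?M)"
    "AE \<xi> in P. emeasure (\<kappa>ex \<xi>) (invariant_measures ?M (Q \<xi>)) = 1"
    "AE \<xi> in P. emeasure (\<kappa>ex \<xi>) (extreme_measures (invariant_measures ?M (Q \<xi>))) = 1"
    "AE \<xi> in P. \<forall>B\<in>sets ?M. (\<integral>\<^sup>+\<nu>. emeasure \<nu> B \<partial>\<kappa>ex \<xi>) = emeasure (\<mu> \<xi>) B"
    by (rule random_ergodic_decomposition[OF assms(3) Q_meas coded \<mu> \<mu>_inv])
  show ?thesis
  proof (intro exI[of _ \<kappa>ex] conjI)
    show "metastate P S E \<gamma> \<kappa>ex"
      unfolding metastate_def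
    proof (intro conjI \<kappa>ex(1))
      show "AE \<xi> in P. emeasure (\<kappa>ex \<xi>) (gibbs_measures S E (\<gamma> \<xi>)) = 1"
        using \<kappa>ex(2) AE_space by eventually_elim (simp add: inv_eq)
    qed
    show "AE \<xi> in P. emeasure (\<kappa>ex \<xi>) (extreme_measures (gibbs_measures S E (\<gamma> \<xi>))) = 1"
      using \<kappa>ex(3) AE_space by eventually_elim (simp add: inv_eq)
    show "AE \<xi> in P. barycenter ?M (\<kappa>ex \<xi>) = barycenter ?M (\<kappa> \<xi>)"
      using \<kappa>ex(4) AE_space
    proof eventually_elim
      case (elim \<xi>)
      have 1: "\<kappa>ex \<xi> \<in> space (prob_algebra (prob_algebra ?M))" using \<kappa>ex(1) elim(2) by (rule measurable_space)
      have 2: "\<kappa> \<xi> \<in> space (prob_algebra (prob_algebra ?M))" using \<kappa> elim(2) by (rule measurable_space)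
      show ?case
        using elim(1) by (intro measure_eqI) (simp_all add: emeasure_barycenter[OF 1] barycenter_eq_bind[OF 2] \<mu>_def
          sets_bind'[OF 2 id])
    qed
  qed
qed

end
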